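(* Let $M$ be a connected Riemannian manifold with Riemannian measure $\mu$. Let $T$ be the Laplacian with domain $C_c^\infty(M)$ (with Neumann boundary conditions imposed if $M$ has a boundary), viewed as an operator in $L^2(M,\mu)$. (1) If $T$ is essentially self-adjoint, then $T$ satisfies the $L^2$-Liouville property. In particular, all harmonic functions in $L^2(M,\mu)$ are constant if $M$ has no boundary. (2) If $T$ satisfies the $L^2$-Liouville property, $T$ is strictly positive and $\mu(M)=\infty$, then $T$ is essentially self-adjoint.
   Context: $(M,g)$ is a smooth connected Riemannian manifold (not necessarily complete), possibly with boundary; if $M$ has a boundary, $M$ is assumed orientable and Neumann boundary conditions are imposed, i.e. functions in the domain of $T$ have vanishing normal derivative on the boundary, so that $\langle u,\Delta v\rangle=\int_M g(\nabla u,\nabla v)\,d\mu=\langle\Delta u,v\rangle$ for $u,v\in D(T)$. $L^2(M,\mu)$ has inner product $\langle u,v\rangle=\int_M uv\,d\mu$. The Laplacian is $\Delta u=-\operatorname{div}\nabla u$, and $T$ acts as $\Delta$ on its domain. A function (distribution) $u$ is harmonic if $\Delta u=0$ in the distributional sense (such $u$ is smooth). A densely defined symmetric operator $T$ is essentially self-adjoint if its closure is self-adjoint (equivalently, it has a unique self-adjoint extension); it is strictly positive if there is $C>0$ with $\langle Tf,f\rangle\ge C\|f\|^2$ for all $f\in D(T)$; it satisfies the $L^2$-Liouville property if every $f\in\ker T^*$ is ($\mu$-a.e.) constant. *)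

theory Defs
  imports "HOL-Analysis.Analysis"
begin

section \<open>Smooth functions\<close>

fun Ck_on :: "nat \<Rightarrow> 'e::real_normed_vector set \<Rightarrow> ('e \<Rightarrow> 'f::real_normed_vector) \<Rightarrow> bool" where
  "Ck_on 0 W f \<longleftrightarrow> continuous_on W f"
| "Ck_on (Suc k) W f \<longleftrightarrow>
     (\<forall>x\<in>W. f differentiable (at x)) \<and> (\<forall>v. Ck_on k W (\<lambda>x. frechet_derivative f (at x) v))"

text \<open>On a set that is not open (such as a relatively open subset of a half-space), smooth means
  locally extendable to a smooth function on an open set.\<close>

definition smooth_on :: "'e::real_normed_vector set \<Rightarrow> ('e \<Rightarrow> 'f::real_normed_vector) \<Rightarrow> bool" where
  "smooth_on S f \<longleftrightarrow>
     (\<forall>x\<in>S. \<exists>W F. open W \<and> x \<in> W \<and> (\<forall>k. Ck_on k W F) \<and> (\<forall>y\<in>W \<inter> S. F y = f y))"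


section \<open>Smooth manifolds, possibly with boundary\<close>

text \<open>The manifold is the whole type \<open>'a\<close>; its dimension is \<open>CARD('n)\<close>. A chart is a
  pair of a domain and a coordinate map, whose values outside the domain are irrelevant.\<close>

type_synonym ('a, 'n) chart = "'a set \<times> ('a \<Rightarrow> real ^ 'n)"

abbreviation chart_dom :: "('a, 'n::finite) chart \<Rightarrow> 'a set" where
  "chart_dom c \<equiv> fst c"

abbreviation chart_map :: "('a, 'n::finite) chart \<Rightarrow> 'a \<Rightarrow> real ^ 'n" where
  "chart_map c \<equiv> snd c"

definition chart_img :: "('a, 'n::finite) chart \<Rightarrow> (real ^ 'n) set" where
  "chart_img c = chart_map c ` chart_dom c"

definition chart_inv :: "('a, 'n::finite) chart \<Rightarrow> real ^ 'n \<Rightarrow> 'a" where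
  "chart_inv c = inv_into (chart_dom c) (chart_map c)"

definition half_space :: "'n::finite \<Rightarrow> (real ^ 'n) set" where
  "half_space i = {x. 0 \<le> x $ i}"

definition is_chart :: "('a::topological_space, 'n::finite) chart \<Rightarrow> bool" where
  "is_chart c \<longleftrightarrow>
     open (chart_dom c) \<and>
     homeomorphism (chart_dom c) (chart_img c) (chart_map c) (chart_inv c) \<and>
     (open (chart_img c) \<or> (\<exists>i. openin (top_of_set (half_space i)) (chart_img c)))"

definition transition :: "('a, 'n::finite) chart \<Rightarrow> ('a, 'n) chart \<Rightarrow> real ^ 'n \<Rightarrow> real ^ 'n" where
  "transition c c' = chart_map c' \<circ> chart_inv c"

definition overlap :: "('a, 'n::finite) chart \<Rightarrow> ('a, 'n) chart \<Rightarrow> (real ^ 'n) set" where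
  "overlap c c' = chart_map c ` (chart_dom c \<inter> chart_dom c')"

definition smooth_atlas ::
    "('a::{t2_space, second_countable_topology}, 'n::finite) chart set \<Rightarrow> bool" where
  "smooth_atlas \<A> \<longleftrightarrow>
     (\<forall>c\<in>\<A>. is_chart c) \<and>
     (\<Union>c\<in>\<A>. chart_dom c) = UNIV \<and>
     (\<forall>c\<in>\<A>. \<forall>c'\<in>\<A>. smooth_on (overlap c c') (transition c c'))"

definition manifold_boundary :: "('a, 'n::finite) chart set \<Rightarrow> 'a set" where
  "manifold_boundary \<A> =
     {p. \<exists>c\<in>\<A>. p \<in> chart_dom c \<and> chart_map c p \<notin> interior (chart_img c)}"

text \<open>A continuous choice of orientations of the tangent spaces: \<open>s c p\<close> tells whether the
  coordinate frame of \<open>c\<close> at \<open>p\<close> is positively or negatively oriented. Unlike the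
  existence of an oriented atlas, this is also correct for one-dimensional manifolds with boundary,
  whose charts at the boundary must all take values in \<open>{0..}\<close>.\<close>

definition orientable :: "('a::topological_space, 'n::finite) chart set \<Rightarrow> bool" where
  "orientable \<A> \<longleftrightarrow>
     (\<exists>s :: ('a, 'n) chart \<Rightarrow> 'a \<Rightarrow> real.
        (\<forall>c\<in>\<A>. continuous_on (chart_dom c) (s c) \<and> (\<forall>p\<in>chart_dom c. s c p \<in> {-1, 1})) \<and>
        (\<forall>c\<in>\<A>. \<forall>c'\<in>\<A>. \<forall>p\<in>chart_dom c \<inter> chart_dom c'. \<forall>D.
           (transition c c' has_derivative D) (at (chart_map c p) within overlap c c') \<longrightarrow>
           s c p = sgn (det (matrix D)) * s c' p))"

definition smooth_fun :: "('a, 'n::finite) chart set \<Rightarrow> ('a \<Rightarrow> real) \<Rightarrow> bool" where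
  "smooth_fun \<A> u \<longleftrightarrow> (\<forall>c\<in>\<A>. smooth_on (chart_img c) (u \<circ> chart_inv c))"

definition supp :: "('a::topological_space \<Rightarrow> real) \<Rightarrow> 'a set" where
  "supp u = closure {p. u p \<noteq> 0}"

definition Cc_infty :: "('a::topological_space, 'n::finite) chart set \<Rightarrow> ('a \<Rightarrow> real) set" where
  "Cc_infty \<A> = {u. smooth_fun \<A> u \<and> compact (supp u)}"


section \<open>Riemannian metrics\<close>

text \<open>A metric is given by its coordinate matrices \<open>(g\<^sub>i\<^sub>j)\<close>: \<open>g c x\<close> is the matrix in the
  chart \<open>c\<close> at the coordinate point \<open>x\<close>. Derivatives are taken within chart images, so that
  they make sense (and are unique) at boundary points.\<close>

type_synonym ('a, 'n) metric = "('a, 'n) chart \<Rightarrow> real ^ 'n \<Rightarrow> real ^ 'n ^ 'n"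

definition riemannian_metric ::
    "('a, 'n::finite) chart set \<Rightarrow> ('a, 'n) metric \<Rightarrow> bool" where
  "riemannian_metric \<A> g \<longleftrightarrow>
     (\<forall>c\<in>\<A>. smooth_on (chart_img c) (g c) \<and>
        (\<forall>x\<in>chart_img c. transpose (g c x) = g c x \<and> (\<forall>v. v \<noteq> 0 \<longrightarrow> 0 < v \<bullet> (g c x *v v)))) \<and>
     (\<forall>c\<in>\<A>. \<forall>c'\<in>\<A>. \<forall>x\<in>overlap c c'. \<forall>D.
        (transition c c' has_derivative D) (at x within overlap c c') \<longrightarrow>
        g c x = transpose (matrix D) ** g c' (transition c c' x) ** matrix D)"

definition riemannian_manifold ::
    "('a::{t2_space, second_countable_topology}, 'n::finite) chart set \<Rightarrow> ('a, 'n) metric \<Rightarrow> bool" where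
  "riemannian_manifold \<A> g \<longleftrightarrow> smooth_atlas \<A> \<and> riemannian_metric \<A> g"

definition vol_density :: "('a, 'n::finite) metric \<Rightarrow> ('a, 'n) chart \<Rightarrow> real ^ 'n \<Rightarrow> real" where
  "vol_density g c x = sqrt (det (g c x))"

text \<open>There is exactly one such measure on a Riemannian manifold.\<close>

definition riemannian_measure ::
    "('a::topological_space, 'n::finite) chart set \<Rightarrow> ('a, 'n) metric \<Rightarrow> 'a measure \<Rightarrow> bool" where
  "riemannian_measure \<A> g \<mu> \<longleftrightarrow>
     sets \<mu> = sets borel \<and>
     (\<forall>c\<in>\<A>. \<forall>A\<in>sets borel. A \<subseteq> chart_dom c \<longrightarrow>
        emeasure \<mu> A = (\<integral>\<^sup>+x\<in>chart_map c ` A. ennreal (vol_density g c x) \<partial>lborel))"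


section \<open>The Laplacian\<close>

definition partial_deriv ::
    "('a, 'n::finite) chart \<Rightarrow> 'n \<Rightarrow> (real ^ 'n \<Rightarrow> real) \<Rightarrow> real ^ 'n \<Rightarrow> real" where
  "partial_deriv c i f x = frechet_derivative f (at x within chart_img c) (axis i 1)"

text \<open>Coordinate expressions: \<open>(\<nabla>u)\<^sup>i = g\<^sup>i\<^sup>j \<partial>\<^sub>j u\<close> and \<open>div X = |g|\<^sup>-\<^sup>1\<^sup>/\<^sup>2 \<partial>\<^sub>i (|g|\<^sup>1\<^sup>/\<^sup>2 X\<^sup>i)\<close>.\<close>

definition grad_in ::
    "('a, 'n::finite) metric \<Rightarrow> ('a, 'n) chart \<Rightarrow> ('a \<Rightarrow> real) \<Rightarrow> real ^ 'n \<Rightarrow> real ^ 'n" where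
  "grad_in g c u x = matrix_inv (g c x) *v (\<chi> j. partial_deriv c j (u \<circ> chart_inv c) x)"

definition div_in ::
    "('a, 'n::finite) metric \<Rightarrow> ('a, 'n) chart \<Rightarrow> (real ^ 'n \<Rightarrow> real ^ 'n) \<Rightarrow> real ^ 'n \<Rightarrow> real" where
  "div_in g c X x =
     (\<Sum>i\<in>UNIV. partial_deriv c i (\<lambda>y. vol_density g c y * X y $ i) x) / vol_density g c x"

text \<open>For smooth \<open>u\<close> the value does not depend on the chart chosen around \<open>p\<close>.\<close>

definition laplacian ::
    "('a, 'n::finite) chart set \<Rightarrow> ('a, 'n) metric \<Rightarrow> ('a \<Rightarrow> real) \<Rightarrow> 'a \<Rightarrow> real" where
  "laplacian \<A> g u p =
     (let c = (SOME c. c \<in> \<A> \<and> p \<in> chart_dom c)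
      in - div_in g c (grad_in g c u) (chart_map c p))"

text \<open>The outward unit normal at a boundary point \<open>x\<close> of a chart image that is relatively open
  in \<open>half_space i\<close>; there the vectors tangent to the boundary are those with vanishing
  \<open>i\<close>-th component.\<close>

definition outward_unit_normal ::
    "('a, 'n::finite) metric \<Rightarrow> ('a, 'n) chart \<Rightarrow> 'n \<Rightarrow> real ^ 'n \<Rightarrow> real ^ 'n \<Rightarrow> bool" where
  "outward_unit_normal g c i x \<nu> \<longleftrightarrow>
     (\<forall>w. w $ i = 0 \<longrightarrow> w \<bullet> (g c x *v \<nu>) = 0) \<and> \<nu> \<bullet> (g c x *v \<nu>) = 1 \<and> \<nu> $ i < 0"

definition neumann ::
    "('a, 'n::finite) chart set \<Rightarrow> ('a, 'n) metric \<Rightarrow> ('a \<Rightarrow> real) \<Rightarrow> bool" where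
  "neumann \<A> g u \<longleftrightarrow>
     (\<forall>c\<in>\<A>. \<forall>i. openin (top_of_set (half_space i)) (chart_img c) \<longrightarrow>
        (\<forall>x\<in>chart_img c. \<forall>\<nu>. x $ i = 0 \<and> outward_unit_normal g c i x \<nu> \<longrightarrow>
           frechet_derivative (u \<circ> chart_inv c) (at x within chart_img c) \<nu> = 0))"

text \<open>Operators are given by their graphs.\<close>

definition laplace_op ::
    "('a::topological_space, 'n::finite) chart set \<Rightarrow> ('a, 'n) metric \<Rightarrow>
     (('a \<Rightarrow> real) \<times> ('a \<Rightarrow> real)) set" where
  "laplace_op \<A> g = {(u, laplacian \<A> g u) | u. u \<in> Cc_infty \<A> \<and> neumann \<A> g u}"

definition locally_integrable :: "'a::topological_space measure \<Rightarrow> ('a \<Rightarrow> real) \<Rightarrow> bool" where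
  "locally_integrable \<mu> u \<longleftrightarrow> u \<in> borel_measurable \<mu> \<and> (\<forall>K. compact K \<longrightarrow> set_integrable \<mu> K u)"

definition harmonic ::
    "('a::topological_space, 'n::finite) chart set \<Rightarrow> ('a, 'n) metric \<Rightarrow> 'a measure \<Rightarrow>
     ('a \<Rightarrow> real) \<Rightarrow> bool" where
  "harmonic \<A> g \<mu> u \<longleftrightarrow>
     locally_integrable \<mu> u \<and>
     (\<forall>\<phi>\<in>Cc_infty \<A>. supp \<phi> \<inter> manifold_boundary \<A> = {} \<longrightarrow>
        (\<integral>p. u p * laplacian \<A> g \<phi> p \<partial>\<mu>) = 0)"


section \<open>Operators in the real Hilbert space of square-integrable functions\<close>

text \<open>Elements of \<open>L\<^sup>2\<close> are represented by functions. The graphs \<open>l2_closure M A\<close> and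
  \<open>l2_adjoint M A\<close> are invariant under changing functions on null sets, so comparing them as
  sets of pairs of functions is the same as comparing them modulo equality almost everywhere.\<close>

definition l2_space :: "'a measure \<Rightarrow> ('a \<Rightarrow> real) set" where
  "l2_space M = {f \<in> borel_measurable M. integrable M (\<lambda>x. (f x)\<^sup>2)}"

definition l2_inner :: "'a measure \<Rightarrow> ('a \<Rightarrow> real) \<Rightarrow> ('a \<Rightarrow> real) \<Rightarrow> real" where
  "l2_inner M f h = (\<integral>x. f x * h x \<partial>M)"

definition l2_norm :: "'a measure \<Rightarrow> ('a \<Rightarrow> real) \<Rightarrow> real" where
  "l2_norm M f = sqrt (l2_inner M f f)"

definition l2_closure ::
    "'a measure \<Rightarrow> (('a \<Rightarrow> real) \<times> ('a \<Rightarrow> real)) set \<Rightarrow> (('a \<Rightarrow> real) \<times> ('a \<Rightarrow> real)) set" where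
  "l2_closure M A = {(f, h). f \<in> l2_space M \<and> h \<in> l2_space M \<and>
     (\<exists>F H. (\<forall>n::nat. (F n, H n) \<in> A) \<and>
        (\<lambda>n. l2_norm M (\<lambda>x. F n x - f x)) \<longlonglongrightarrow> 0 \<and>
        (\<lambda>n. l2_norm M (\<lambda>x. H n x - h x)) \<longlonglongrightarrow> 0)}"

definition l2_adjoint ::
    "'a measure \<Rightarrow> (('a \<Rightarrow> real) \<times> ('a \<Rightarrow> real)) set \<Rightarrow> (('a \<Rightarrow> real) \<times> ('a \<Rightarrow> real)) set" where
  "l2_adjoint M A = {(f, h). f \<in> l2_space M \<and> h \<in> l2_space M \<and>
     (\<forall>(u, v)\<in>A. l2_inner M v f = l2_inner M u h)}"

definition densely_defined ::
    "'a measure \<Rightarrow> (('a \<Rightarrow> real) \<times> ('a \<Rightarrow> real)) set \<Rightarrow> bool" where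
  "densely_defined M A \<longleftrightarrow>
     (\<forall>f\<in>l2_space M. \<forall>e>0. \<exists>u\<in>Domain A. l2_norm M (\<lambda>x. u x - f x) < e)"

definition self_adjoint ::
    "'a measure \<Rightarrow> (('a \<Rightarrow> real) \<times> ('a \<Rightarrow> real)) set \<Rightarrow> bool" where
  "self_adjoint M A \<longleftrightarrow> densely_defined M A \<and> l2_adjoint M A = A"

definition essentially_self_adjoint ::
    "'a measure \<Rightarrow> (('a \<Rightarrow> real) \<times> ('a \<Rightarrow> real)) set \<Rightarrow> bool" where
  "essentially_self_adjoint M A \<longleftrightarrow> self_adjoint M (l2_closure M A)"

definition strictly_positive ::
    "'a measure \<Rightarrow> (('a \<Rightarrow> real) \<times> ('a \<Rightarrow> real)) set \<Rightarrow> bool" where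
  "strictly_positive M A \<longleftrightarrow> (\<exists>C>0. \<forall>(u, v)\<in>A. l2_inner M v u \<ge> C * (l2_norm M u)\<^sup>2)"

definition ae_constant :: "'a measure \<Rightarrow> ('a \<Rightarrow> real) \<Rightarrow> bool" where
  "ae_constant M f \<longleftrightarrow> (\<exists>k. AE x in M. f x = k)"

definition l2_liouville ::
    "'a measure \<Rightarrow> (('a \<Rightarrow> real) \<times> ('a \<Rightarrow> real)) set \<Rightarrow> bool" where
  "l2_liouville M A \<longleftrightarrow> (\<forall>f. (f, \<lambda>_. 0) \<in> l2_adjoint M A \<longrightarrow> ae_constant M f)"

end

theory Submission
  imports Defs
begin

text \<open>Let \<open>\<Gamma>(u, v) = g(\<nabla>u, \<nabla>v)\<close>. Green's formula \<open>\<integral> u \<Delta>v = \<integral> \<Gamma>(u, v)\<close> on the domain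
  of \<open>T\<close> is proved chart by chart and patched with a partition of unity. If \<open>T\<close> is essentially
  self-adjoint and \<open>T\<^sup>* f = 0\<close>, then \<open>f\<close> lies in the kernel of the closure of \<open>T\<close>, so there are
  \<open>u\<^sub>n \<longlonglongrightarrow> f\<close> with \<open>\<Delta>u\<^sub>n \<longlonglongrightarrow> 0\<close>; the energies \<open>\<integral> \<Gamma>(u\<^sub>n, u\<^sub>n) = \<langle>u\<^sub>n, \<Delta>u\<^sub>n\<rangle>\<close> tend to zero,
  which makes \<open>f\<close> locally constant, hence constant by connectedness. Conversely, the Liouville
  property and \<open>\<mu>(M) = \<infinity>\<close> give \<open>ker T\<^sup>* = 0\<close>, so the range of \<open>T\<close> is dense; strict positivity makes
  the range of the closure closed, and a surjective densely defined symmetric operator is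
  self-adjoint.\<close>

section \<open>Smooth functions\<close>

text \<open>A kernel element \<open>f\<close> of the adjoint is only square integrable, so its
  gradient is never formed: the smooth approximants carry all derivatives, and local constancy is
  read off from the increments \<open>f (x + h) - f x\<close>, which survive convergence in the
  mean. Two features of the setting shape the rest. Chart images may be relatively open in a
  half-space, so coordinate calculus runs on sets that need not be open, with derivatives taken
  within the set, and the boundary term in Green's formula disappears only because the test function
  or the normal component of the gradient vanishes there. Moreover \<open>laplacian\<close> selects
  an unspecified chart at each point, so even its continuity presupposes chart independence. This is
  obtained weakly: second derivatives are never transformed; instead Green's formula in two charts
  is compared through the first-order quantity \<open>\<Gamma>(u, v)\<close>, whose invariance needs
  only the chain rule. Infinite volume enters at one place: no nonzero constant is then square
  integrable.\<close>

definition Cinf :: "'e::real_normed_vector set \<Rightarrow> ('e \<Rightarrow> 'f::real_normed_vector) \<Rightarrow> bool" where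
  "Cinf W f \<longleftrightarrow> (\<forall>k. Ck_on k W f)"

text \<open>A derivative sees a neighbourhood of the point, so agreement on \<open>W\<close>
  suffices because \<open>W\<close> is open. This is what permits replacing
  \<open>frechet_derivative\<close> by any explicit formula valid on \<open>W\<close>.\<close>

lemma Ck_on_cong:
  assumes "open W" "Ck_on k W f" "\<And>x. x \<in> W \<Longrightarrow> f x = h x"
  shows "Ck_on k W h"
  using assms(2,3)
proof (induction k arbitrary: f h)
  case 0
  then show ?case using continuous_on_cong by (metis Ck_on.simps(1))
next
  case (Suc k)
  have D: "(h has_derivative frechet_derivative f (at x)) (at x)" if "x \<in> W" for x
  proof -
    have "(f has_derivative frechet_derivative f (at x)) (at x)"
      using Suc.prems(1) that by (simp add: frechet_derivative_works[symmetric])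
    then show ?thesis
      by (rule has_derivative_transform_within_open[OF _ \<open>open W\<close> that]) (use Suc.prems in auto)
  qed
  have E: "frechet_derivative h (at x) = frechet_derivative f (at x)" if "x \<in> W" for x
    using frechet_derivative_at[OF D[OF that]] by simp
  have "Ck_on k W (\<lambda>x. frechet_derivative h (at x) v)" for v
    using Suc.IH[of "\<lambda>x. frechet_derivative f (at x) v"] Suc.prems E by simp
  then show ?case using D by (auto simp: differentiable_def)
qed

lemma Ck_on_subset: "Ck_on k W f \<Longrightarrow> V \<subseteq> W \<Longrightarrow> Ck_on k V f"
  by (induction k arbitrary: f) (auto intro: continuous_on_subset)

lemma Cinf_subset: "Cinf W f \<Longrightarrow> V \<subseteq> W \<Longrightarrow> Cinf V f"
  unfolding Cinf_def using Ck_on_subset by blast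

lemma Cinf_has_derivative:
  assumes "Cinf W f" "x \<in> W"
  shows "(f has_derivative frechet_derivative f (at x)) (at x)"
proof -
  have "Ck_on (Suc 0) W f" using assms(1) by (auto simp: Cinf_def simp del: Ck_on.simps)
  then show ?thesis using assms(2) by (simp add: frechet_derivative_works[symmetric])
qed

lemma Cinf_deriv:
  assumes "Cinf W f"
  shows "Cinf W (\<lambda>x. frechet_derivative f (at x) v)"
  unfolding Cinf_def
proof
  fix k
  have "Ck_on (Suc k) W f" using assms by (simp add: Cinf_def del: Ck_on.simps)
  then show "Ck_on k W (\<lambda>x. frechet_derivative f (at x) v)" by simp
qed

lemma Cinf_continuous_on: "Cinf W f \<Longrightarrow> continuous_on W f"
  unfolding Cinf_def by (metis Ck_on.simps(1))

text \<open>Smoothness is a greatest fixed point: if every member of a class is differentiable with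
  directional derivatives again in the class, all members are smooth. Closure properties then
  require a suitable class and first derivatives only, instead of formulas for derivatives of order
  \<open>k\<close>.\<close>

lemma Cinf_coinduct:
  assumes "open W" "P f"
    and D: "\<And>f. P f \<Longrightarrow> \<exists>f'. (\<forall>x\<in>W. (f has_derivative f' x) (at x)) \<and> (\<forall>v. P (\<lambda>x. f' x v))"
  shows "Cinf W f"
  unfolding Cinf_def
proof
  fix k
  show "Ck_on k W f" using \<open>P f\<close>
  proof (induction k arbitrary: f)
    case 0
    then show ?case using D[OF 0]
      by (auto intro!: continuous_at_imp_continuous_on dest: has_derivative_continuous)
  next
    case (Suc k)
    obtain f' where f': "\<And>x. x \<in> W \<Longrightarrow> (f has_derivative f' x) (at x)" "\<And>v. P (\<lambda>x. f' x v)"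
      using D[OF Suc.prems] by blast
    have "frechet_derivative f (at x) = f' x" if "x \<in> W" for x
      using frechet_derivative_at[OF f'(1)[OF that]] by simp
    then have "Ck_on k W (\<lambda>x. frechet_derivative f (at x) v)" for v
      using Ck_on_cong[OF \<open>open W\<close> Suc.IH[OF f'(2)[of v]]] by simp
    then show ?case using f'(1) by (auto simp: differentiable_def)
  qed
qed

lemma Cinf_const: "open W \<Longrightarrow> Cinf W (\<lambda>_. c)"
  by (rule Cinf_coinduct[where P = "\<lambda>f. \<exists>c. f = (\<lambda>_. c)"]) (auto intro!: exI[of _ "\<lambda>_ _. 0"])

lemma Cinf_bounded_linear:
  assumes "open W" "Cinf W f" "bounded_linear L"
  shows "Cinf W (\<lambda>x. L (f x))"
proof (rule Cinf_coinduct[OF \<open>open W\<close>, where P = "\<lambda>h. \<exists>f. Cinf W f \<and> h = (\<lambda>x. L (f x))"])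
  fix h assume "\<exists>f. Cinf W f \<and> h = (\<lambda>x. L (f x))"
  then obtain f where f: "Cinf W f" "h = (\<lambda>x. L (f x))" by blast
  show "\<exists>h'. (\<forall>x\<in>W. (h has_derivative h' x) (at x)) \<and>
              (\<forall>v. \<exists>f. Cinf W f \<and> (\<lambda>x. h' x v) = (\<lambda>x. L (f x)))"
  proof (intro exI[of _ "\<lambda>x v. L (frechet_derivative f (at x) v)"] conjI ballI allI)
    fix x assume "x \<in> W"
    then show "(h has_derivative (\<lambda>v. L (frechet_derivative f (at x) v))) (at x)"
      unfolding f(2) by (intro bounded_linear.has_derivative[OF assms(3)] Cinf_has_derivative[OF f(1)])
  next
    fix v show "\<exists>fa. Cinf W fa \<and> (\<lambda>x. L (frechet_derivative f (at x) v)) = (\<lambda>x. L (fa x))"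
      using Cinf_deriv[OF f(1)] by (intro exI[of _ "\<lambda>x. frechet_derivative f (at x) v"]) auto
  qed
qed (use assms in auto)

lemma Cinf_ident: "open W \<Longrightarrow> Cinf W (\<lambda>x. x)"
proof (rule Cinf_coinduct[where P = "\<lambda>f. f = (\<lambda>x. x) \<or> (\<exists>c. f = (\<lambda>_. c))"])
  fix f :: "'a \<Rightarrow> 'a" assume "f = (\<lambda>x. x) \<or> (\<exists>c. f = (\<lambda>_. c))"
  then show "\<exists>f'. (\<forall>x\<in>W. (f has_derivative f' x) (at x)) \<and>
      (\<forall>v. (\<lambda>x. f' x v) = (\<lambda>x. x) \<or> (\<exists>c. (\<lambda>x. f' x v) = (\<lambda>_. c)))"
  proof
    assume "f = (\<lambda>x. x)"
    then show ?thesis by (intro exI[of _ "\<lambda>_ v. v"]) auto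
  next
    assume "\<exists>c. f = (\<lambda>_. c)"
    then show ?thesis by (intro exI[of _ "\<lambda>_ _. 0"]) auto
  qed
qed auto

text \<open>A class of functions that contains the first derivatives of all its members, so that one
  coinduction yields all closure properties at once.\<close>

inductive smooth_alg ::
    "'e::real_normed_vector set \<Rightarrow> 'd::euclidean_space set \<Rightarrow> ('e \<Rightarrow> 'd) \<Rightarrow> ('e \<Rightarrow> real) \<Rightarrow> bool"
  for W U G where
  base: "Cinf W f \<Longrightarrow> smooth_alg W U G f"
| add: "smooth_alg W U G f \<Longrightarrow> smooth_alg W U G h \<Longrightarrow> smooth_alg W U G (\<lambda>x. f x + h x)"
| mult: "smooth_alg W U G f \<Longrightarrow> smooth_alg W U G h \<Longrightarrow> smooth_alg W U G (\<lambda>x. f x * h x)"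
| inverse: "smooth_alg W U G f \<Longrightarrow> (\<And>x. x \<in> W \<Longrightarrow> f x \<noteq> 0) \<Longrightarrow> smooth_alg W U G (\<lambda>x. inverse (f x))"
| sqrt: "smooth_alg W U G f \<Longrightarrow> (\<And>x. x \<in> W \<Longrightarrow> 0 < f x) \<Longrightarrow> smooth_alg W U G (\<lambda>x. sqrt (f x))"
| comp: "Cinf U \<phi> \<Longrightarrow> smooth_alg W U G (\<lambda>x. \<phi> (G x))"

lemma smooth_alg_sum:
  assumes "open W" "finite I" "\<And>i. i \<in> I \<Longrightarrow> smooth_alg W U G (f i)"
  shows "smooth_alg W U G (\<lambda>x. \<Sum>i\<in>I. f i x)"
  using assms(2,3)
proof (induction I rule: finite_induct)
  case empty
  then show ?case using smooth_alg.base[OF Cinf_const[OF assms(1)]] by simp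
next
  case (insert i I)
  then show ?case using smooth_alg.add[of W U G "f i" "\<lambda>x. \<Sum>i\<in>I. f i x"] by simp
qed

lemma smooth_alg_Cinf:
  fixes G :: "'e::real_normed_vector \<Rightarrow> 'd::euclidean_space"
  assumes W: "open W" and G: "Cinf W G" "\<And>x. x \<in> W \<Longrightarrow> G x \<in> U" and f: "smooth_alg W U G f"
  shows "Cinf W f"
proof (rule Cinf_coinduct[OF W, where P = "smooth_alg W U G", OF f])
  fix f :: "'e \<Rightarrow> real" assume "smooth_alg W U G f"
  then show "\<exists>f'. (\<forall>x\<in>W. (f has_derivative f' x) (at x)) \<and> (\<forall>v. smooth_alg W U G (\<lambda>x. f' x v))"
  proof induction
    case (base f)
    then show ?case
      by (intro exI[of _ "\<lambda>x. frechet_derivative f (at x)"])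
         (blast intro: smooth_alg.base[OF Cinf_deriv] Cinf_has_derivative)
  next
    case (add f h)
    then obtain f' h' where "\<forall>x\<in>W. (f has_derivative f' x) (at x)" "\<forall>v. smooth_alg W U G (\<lambda>x. f' x v)"
       "\<forall>x\<in>W. (h has_derivative h' x) (at x)" "\<forall>v. smooth_alg W U G (\<lambda>x. h' x v)" by blast
    then show ?case
      by (intro exI[of _ "\<lambda>x v. f' x v + h' x v"] conjI ballI allI)
         (auto intro: has_derivative_add smooth_alg.add)
  next
    case (mult f h)
    then obtain f' h' where f': "\<forall>x\<in>W. (f has_derivative f' x) (at x)" "\<forall>v. smooth_alg W U G (\<lambda>x. f' x v)"
      and h': "\<forall>x\<in>W. (h has_derivative h' x) (at x)" "\<forall>v. smooth_alg W U G (\<lambda>x. h' x v)" by blast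
    have "smooth_alg W U G (\<lambda>x. f x * h' x v + f' x v * h x)" for v
      using smooth_alg.add[OF smooth_alg.mult smooth_alg.mult] mult.hyps f'(2) h'(2) by blast
    then show ?case
      using has_derivative_mult[OF f'(1)[rule_format] h'(1)[rule_format]]
      by (intro exI[of _ "\<lambda>x v. f x * h' x v + f' x v * h x"]) blast
  next
    case (inverse f)
    then obtain f' where f': "\<forall>x\<in>W. (f has_derivative f' x) (at x)" "\<forall>v. smooth_alg W U G (\<lambda>x. f' x v)"
      by blast
    have "smooth_alg W U G (\<lambda>x. (- 1) * (inverse (f x) * f' x v * inverse (f x)))" for v
      by (intro smooth_alg.mult smooth_alg.inverse[OF inverse.hyps]
            smooth_alg.base[OF Cinf_const[OF W]] f'(2)[rule_format]) auto
    moreover have "((\<lambda>x. inverse (f x)) has_derivative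
        (\<lambda>v. (- 1) * (inverse (f x) * f' x v * inverse (f x)))) (at x)" if "x \<in> W" for x
      using Deriv.has_derivative_inverse[OF inverse.hyps(2)[OF that] f'(1)[rule_format, OF that]] by simp
    ultimately show ?case
      by (intro exI[of _ "\<lambda>x v. (- 1) * (inverse (f x) * f' x v * inverse (f x))"]) blast
  next
    case (sqrt f)
    then obtain f' where f': "\<forall>x\<in>W. (f has_derivative f' x) (at x)" "\<forall>v. smooth_alg W U G (\<lambda>x. f' x v)"
      by blast
    have "smooth_alg W U G (\<lambda>x. f' x v * (inverse (sqrt (f x)) * (1/2)))" for v
      by (intro smooth_alg.mult smooth_alg.inverse smooth_alg.sqrt sqrt.hyps
            smooth_alg.base[OF Cinf_const[OF W]] f'(2)[rule_format]) (auto dest: sqrt.hyps(2))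
    moreover have "((\<lambda>x. sqrt (f x)) has_derivative (\<lambda>v. f' x v * (inverse (sqrt (f x)) * (1/2)))) (at x)"
      if "x \<in> W" for x
      using has_derivative_real_sqrt[OF sqrt.hyps(2)[OF that] f'(1)[rule_format, OF that]]
      by (simp add: field_simps)
    ultimately show ?case
      by (intro exI[of _ "\<lambda>x v. f' x v * (inverse (sqrt (f x)) * (1/2))"]) blast
  next
    case (comp \<phi>)
    \<comment> \<open>The direction in which \<open>\<phi>\<close> is differentiated varies with
      \<open>x\<close>. Expanding it in the basis separates the dependence into products of
      components of the derivative of \<open>G\<close> and partial derivatives of
      \<open>\<phi>\<close> composed with \<open>G\<close>, both in the class.\<close>
    let ?f' = "\<lambda>x v. \<Sum>b\<in>Basis. frechet_derivative (\<lambda>y. G y \<bullet> b) (at x) v * frechet_derivative \<phi> (at (G x)) b"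
    have Gb: "Cinf W (\<lambda>y. G y \<bullet> b)" for b
      using Cinf_bounded_linear[OF W G(1) bounded_linear_inner_left] .
    have "((\<lambda>x. \<phi> (G x)) has_derivative ?f' x) (at x)" if "x \<in> W" for x
    proof -
      have DG: "(G has_derivative frechet_derivative G (at x)) (at x)"
        using Cinf_has_derivative[OF G(1) that] .
      have Dp: "(\<phi> has_derivative frechet_derivative \<phi> (at (G x))) (at (G x))"
        using Cinf_has_derivative[OF comp G(2)[OF that]] .
      have eq: "frechet_derivative (\<lambda>y. G y \<bullet> b) (at x) v = frechet_derivative G (at x) v \<bullet> b" for b v
      proof -
        have "((\<lambda>y. G y \<bullet> b) has_derivative (\<lambda>v. frechet_derivative G (at x) v \<bullet> b)) (at x)"
          by (auto intro!: derivative_eq_intros DG)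
        from frechet_derivative_at[OF this] show ?thesis by metis
      qed
      have lin: "linear (frechet_derivative \<phi> (at (G x)))"
        using Dp has_derivative_linear by blast
      have "frechet_derivative \<phi> (at (G x)) (frechet_derivative G (at x) v) = ?f' x v" for v
      proof -
        have "frechet_derivative \<phi> (at (G x)) (frechet_derivative G (at x) v)
            = frechet_derivative \<phi> (at (G x)) (\<Sum>b\<in>Basis. (frechet_derivative G (at x) v \<bullet> b) *\<^sub>R b)"
          by (simp add: euclidean_representation)
        also have "\<dots> = ?f' x v"
          by (simp add: linear_sum[OF lin] linear_scale[OF lin] eq)
        finally show ?thesis .
      qed
      then have "frechet_derivative \<phi> (at (G x)) \<circ> frechet_derivative G (at x) = ?f' x" by auto
      then show ?thesis using diff_chain_at[OF DG Dp] by (simp add: o_def)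
    qed
    moreover have "smooth_alg W U G (\<lambda>x. ?f' x v)" for v
      by (rule smooth_alg_sum[OF W], simp, rule smooth_alg.mult[OF smooth_alg.base[OF Cinf_deriv[OF Gb]]],
          rule smooth_alg.comp[OF Cinf_deriv[OF comp]])
    ultimately show ?case by (intro exI[of _ ?f'] conjI ballI allI)
  qed
qed

lemma Cinf_compose:
  fixes G :: "'e::real_normed_vector \<Rightarrow> 'd::euclidean_space" and \<phi> :: "'d \<Rightarrow> real"
  assumes "open W" "Cinf W G" "\<And>x. x \<in> W \<Longrightarrow> G x \<in> U" "Cinf U \<phi>"
  shows "Cinf W (\<lambda>x. \<phi> (G x))"
  by (rule smooth_alg_Cinf[OF assms(1-3) smooth_alg.comp[OF assms(4)]])

context
  fixes W :: "'e::real_normed_vector set"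
  assumes W: "open W"
begin

text \<open>The composition slot of the class is filled with a constant map, which leaves the
  algebraic operations.\<close>

private lemma alg: "smooth_alg W UNIV (\<lambda>_. 0::real) f \<Longrightarrow> Cinf W f"
  by (rule smooth_alg_Cinf[OF W]) (auto intro: Cinf_const W)

lemma Cinf_add: "Cinf W f \<Longrightarrow> Cinf W h \<Longrightarrow> Cinf W (\<lambda>x. f x + h x :: real)"
  by (rule alg[OF smooth_alg.add[OF smooth_alg.base smooth_alg.base]])

lemma Cinf_mult: "Cinf W f \<Longrightarrow> Cinf W h \<Longrightarrow> Cinf W (\<lambda>x. f x * h x :: real)"
  by (rule alg[OF smooth_alg.mult[OF smooth_alg.base smooth_alg.base]])

lemma Cinf_inverse: "Cinf W f \<Longrightarrow> (\<And>x. x \<in> W \<Longrightarrow> f x \<noteq> 0) \<Longrightarrow> Cinf W (\<lambda>x. inverse (f x) :: real)"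
  by (rule alg[OF smooth_alg.inverse[OF smooth_alg.base]])

lemma Cinf_sqrt: "Cinf W f \<Longrightarrow> (\<And>x. x \<in> W \<Longrightarrow> 0 < f x) \<Longrightarrow> Cinf W (\<lambda>x. sqrt (f x))"
  by (rule alg[OF smooth_alg.sqrt[OF smooth_alg.base]])

lemma Cinf_prod:
  "finite I \<Longrightarrow> (\<And>i. i \<in> I \<Longrightarrow> Cinf W (f i)) \<Longrightarrow> Cinf W (\<lambda>x. \<Prod>i\<in>I. f i x :: real)"
  by (induction I rule: finite_induct) (simp_all add: Cinf_const W Cinf_mult)

end

section \<open>Smooth bump functions\<close>

text \<open>For \<open>k = 0\<close> this is the classical \<open>exp (- 1/t)\<close> on the
  positive axis, extended by zero. The factors \<open>t^(-k)\<close> make the linear span of the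
  family closed under differentiation, which is what the coinduction principle asks for.\<close>

definition bump :: "nat \<Rightarrow> real \<Rightarrow> real" where
  "bump k t = (if t > 0 then inverse t ^ k * exp (- inverse t) else 0)"

text \<open>Away from zero this is the product rule for \<open>t^(-k) exp (- 1/t)\<close>. Only the
  origin has content: there the exponential decay beats every power.\<close>

lemma DERIV_bump: "(bump k has_real_derivative bump (k + 2) t - real k * bump (k + 1) t) (at t)"
proof (cases t "0::real" rule: linorder_cases)
  case less
  have "((\<lambda>_. 0) has_real_derivative 0) (at t)" by simp
  then have "(bump k has_real_derivative 0) (at t)"
    by (rule has_field_derivative_transform_within_open[where S="{..<0}"]) (use less in \<open>auto simp: bump_def\<close>)
  then show ?thesis using less by (simp add: bump_def)
next
  case greater
  have "((\<lambda>t. inverse t ^ k * exp (- inverse t)) has_real_derivative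
          bump (k + 2) t - real k * bump (k + 1) t) (at t)"
    using greater
    by (cases k) (auto intro!: derivative_eq_intros simp: bump_def field_simps power2_eq_square,
                  metis One_nat_def power_eq_if)
  then show ?thesis
    by (rule has_field_derivative_transform_within_open[where S="{0<..}"]) (use greater in \<open>auto simp: bump_def\<close>)
next
  case equal
  \<comment> \<open>With \<open>s = 1/h\<close> the difference quotient \<open>bump k h / h\<close>
    becomes \<open>s^(k + 1) / exp s\<close>.\<close>
  have "((\<lambda>s::real. s ^ (k + 1) / exp s) \<longlongrightarrow> 0) at_top" by (rule tendsto_power_div_exp_0)
  then have "((\<lambda>h::real. inverse h ^ (k + 1) / exp (inverse h)) \<longlongrightarrow> 0) (at_right 0)"
    using filterlim_compose filterlim_inverse_at_top_right by blast
  then have "((\<lambda>h. bump k h / h) \<longlongrightarrow> 0) (at_right 0)"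
    by (rule Lim_transform_eventually)
       (auto simp: eventually_at_filter bump_def exp_minus field_simps)
  moreover have "((\<lambda>h. bump k h / h) \<longlongrightarrow> 0) (at_left 0)"
    by (rule Lim_transform_eventually[OF tendsto_const])
       (auto simp: eventually_at_filter bump_def)
  ultimately have "((\<lambda>h. bump k h / h) \<longlongrightarrow> 0) (at 0)"
    by (simp add: filterlim_split_at)
  then show ?thesis by (simp add: equal DERIV_def bump_def)
qed

inductive bump_span :: "(real \<Rightarrow> real) \<Rightarrow> bool" where
  "bump_span (bump k)"
| "bump_span f \<Longrightarrow> bump_span h \<Longrightarrow> bump_span (\<lambda>x. f x + h x)"
| "bump_span f \<Longrightarrow> bump_span (\<lambda>x. c * f x)"

lemma bump_span_deriv:
  "bump_span f \<Longrightarrow> \<exists>f'. (\<forall>x. (f has_real_derivative f' x) (at x)) \<and> bump_span f'"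
proof (induction rule: bump_span.induct)
  case (1 k)
  have "bump_span (\<lambda>t. bump (k + 2) t + (- real k) * bump (k + 1) t)"
    by (intro bump_span.intros)
  then show ?case using DERIV_bump by force
next
  case (2 f h)
  then obtain f' h' where "\<forall>x. (f has_real_derivative f' x) (at x)" "bump_span f'"
    "\<forall>x. (h has_real_derivative h' x) (at x)" "bump_span h'" by blast
  then show ?case
    by (intro exI[of _ "\<lambda>x. f' x + h' x"]) (auto intro!: derivative_intros bump_span.intros)
next
  case (3 f c)
  then obtain f' where "\<forall>x. (f has_real_derivative f' x) (at x)" "bump_span f'" by blast
  then show ?case
    by (intro exI[of _ "\<lambda>x. c * f' x"]) (auto intro!: DERIV_cmult bump_span.intros)
qed

lemma Cinf_bump: "Cinf UNIV (bump k)"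
proof (rule Cinf_coinduct[where P = bump_span])
  fix f assume "bump_span f"
  then obtain f' where "\<forall>x. (f has_real_derivative f' x) (at x)" "bump_span f'"
    using bump_span_deriv by blast
  moreover from this(2) have "bump_span (\<lambda>x. f' x * v)" for v
    using bump_span.intros(3)[of f' v] by (simp add: mult.commute)
  ultimately show "\<exists>f'. (\<forall>x\<in>UNIV. (f has_derivative f' x) (at x)) \<and> (\<forall>v. bump_span (\<lambda>x. f' x v))"
    by (intro exI[of _ "\<lambda>x v. f' x * v"]) (auto simp: has_field_derivative_def)
qed (auto intro: bump_span.intros)

text \<open>If \<open>a $ i < b $ i\<close>, the \<open>i\<close>-th factor is positive exactly for
  \<open>x $ i\<close> strictly between the bounds. The parameter \<open>m\<close> steepens the
  profile: \<open>exp (- 1 / (m s))\<close> tends to 1 for fixed \<open>s > 0\<close> as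
  \<open>m\<close> grows.\<close>

definition box_bump :: "real ^ 'n::finite \<Rightarrow> real ^ 'n \<Rightarrow> real \<Rightarrow> real ^ 'n \<Rightarrow> real" where
  "box_bump a b m x = (\<Prod>i\<in>UNIV. bump 0 (m * ((x $ i - a $ i) * (b $ i - x $ i))))"

lemma Cinf_box_bump: "Cinf UNIV (box_bump a b m)"
  unfolding box_bump_def[abs_def]
proof (rule Cinf_prod)
  fix i :: 'a
  have 1: "Cinf UNIV (\<lambda>x::real^'a. x $ i)"
    by (rule Cinf_bounded_linear[OF _ Cinf_ident bounded_linear_vec_nth]) auto
  have "Cinf UNIV (\<lambda>x::real^'a. m * ((x $ i + (- a $ i)) * (b $ i + (-1) * x $ i)))"
    by (intro Cinf_mult Cinf_add Cinf_const 1 open_UNIV)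
  then have "Cinf UNIV (\<lambda>x::real^'a. m * ((x $ i - a $ i) * (b $ i - x $ i)))" by simp
  then show "Cinf UNIV (\<lambda>x::real^'a. bump 0 (m * ((x $ i - a $ i) * (b $ i - x $ i))))"
    by (rule Cinf_compose[OF open_UNIV _ _ Cinf_bump]) auto
qed auto

lemma bump_nonneg: "0 \<le> bump k t" by (simp add: bump_def)

lemma bump_0_le_1: "bump 0 t \<le> 1" by (simp add: bump_def)

lemma bump_pos_iff: "0 < bump k t \<longleftrightarrow> 0 < t" by (simp add: bump_def)

lemma box_bump_nonneg: "0 \<le> box_bump a b m x"
  by (simp add: box_bump_def prod_nonneg bump_nonneg)

lemma box_bump_le_1: "box_bump a b m x \<le> 1"
  unfolding box_bump_def by (rule prod_le_1) (auto simp: bump_nonneg bump_0_le_1)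

lemma box_bump_pos: "0 < m \<Longrightarrow> x \<in> box a b \<Longrightarrow> 0 < box_bump a b m x"
  by (auto simp: box_bump_def mem_box_cart bump_pos_iff intro!: prod_pos)

text \<open>The order of the bounds matters: with reversed bounds the quadratic is positive between
  them although the box is empty.\<close>

lemma box_bump_eq_0:
  assumes "0 < m" "x \<notin> box a b" "\<And>i. a $ i < b $ i"
  shows "box_bump a b m x = 0"
proof -
  obtain i where i: "x $ i \<le> a $ i \<or> b $ i \<le> x $ i"
    using assms(2) by (auto simp: mem_box_cart not_less)
  have "(x $ i - a $ i) * (b $ i - x $ i) \<le> 0"
    using i assms(3)[of i] by (auto intro: mult_nonpos_nonneg mult_nonneg_nonpos)
  then have "bump 0 (m * ((x $ i - a $ i) * (b $ i - x $ i))) = 0"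
    using assms(1) mult_nonneg_nonpos[of m] by (force simp: bump_def not_less[symmetric])
  then show ?thesis unfolding box_bump_def by (intro prod_zero) auto
qed

text \<open>Together with the bound by 1, this carries orthogonality to smooth test functions over
  to indicators of boxes by dominated convergence.\<close>

lemma box_bump_tendsto:
  assumes "\<And>i. a $ i < b $ i"
  shows "(\<lambda>m. box_bump a b (real (Suc m)) x) \<longlonglongrightarrow> indicator (box a b) x"
proof (cases "x \<in> box a b")
  case True
  have "(\<lambda>m. bump 0 (real (Suc m) * s)) \<longlonglongrightarrow> 1" if "0 < s" for s
  proof -
    have "(\<lambda>m. exp (- (inverse (real (Suc m)) * inverse s))) \<longlonglongrightarrow> exp (- (0 * inverse s))"
      by (intro tendsto_intros LIMSEQ_inverse_real_of_nat)
    moreover have "bump 0 (real (Suc m) * s) = exp (- (inverse (real (Suc m)) * inverse s))" for m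
      using that unfolding bump_def by (simp add: zero_less_mult_iff del: of_nat_Suc)
    ultimately show ?thesis by simp
  qed
  then have "(\<lambda>m. box_bump a b (real (Suc m)) x) \<longlonglongrightarrow> (\<Prod>i\<in>(UNIV::'a set). 1)"
    unfolding box_bump_def using True by (intro tendsto_prod) (auto simp: mem_box_cart)
  then show ?thesis using True by simp
next
  case False
  then have "box_bump a b (real (Suc m)) x = 0" for m
    using box_bump_eq_0[OF _ False assms] by simp
  then show ?thesis using False by simp
qed

section \<open>Smooth functions on coordinate domains\<close>

lemma smooth_on_iff_Cinf:
  "smooth_on S f \<longleftrightarrow> (\<forall>x\<in>S. \<exists>W F. open W \<and> x \<in> W \<and> Cinf W F \<and> (\<forall>y\<in>W \<inter> S. F y = f y))"
  by (simp only: smooth_on_def Cinf_def)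

lemma smooth_onE:
  assumes "smooth_on S f" "x \<in> S"
  obtains W F where "open W" "x \<in> W" "Cinf W F" "\<And>y. y \<in> W \<inter> S \<Longrightarrow> F y = f y"
  using bspec[OF assms(1)[unfolded smooth_on_iff_Cinf] assms(2)] by (elim exE conjE) blast

lemma smooth_onI:
  assumes "\<And>x. x \<in> S \<Longrightarrow> \<exists>W F. open W \<and> x \<in> W \<and> Cinf W F \<and> (\<forall>y\<in>W \<inter> S. F y = f y)"
  shows "smooth_on S f"
  unfolding smooth_on_iff_Cinf using assms by (rule ballI)

lemma smooth_on_subset: "smooth_on S f \<Longrightarrow> T \<subseteq> S \<Longrightarrow> smooth_on T f"
  by (rule smooth_onI, erule smooth_onE, erule (1) subsetD) blast

lemma smooth_on_cong: "smooth_on S f \<Longrightarrow> (\<And>x. x \<in> S \<Longrightarrow> f x = h x) \<Longrightarrow> smooth_on S h"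
  by (rule smooth_onI, erule smooth_onE, assumption) force

lemma Cinf_imp_smooth_on: "open W \<Longrightarrow> Cinf W f \<Longrightarrow> S \<subseteq> W \<Longrightarrow> smooth_on S f"
  by (rule smooth_onI) blast

lemma smooth_on_const: "smooth_on S (\<lambda>_. c)"
  by (rule Cinf_imp_smooth_on[OF open_UNIV Cinf_const]) auto

lemma smooth_on_local:
  assumes "\<And>x. x \<in> S \<Longrightarrow> \<exists>U. open U \<and> x \<in> U \<and> smooth_on (S \<inter> U) f"
  shows "smooth_on S f"
proof (rule smooth_onI)
  fix x assume "x \<in> S"
  then obtain U where U: "open U" "x \<in> U" "smooth_on (S \<inter> U) f" using assms by blast
  obtain W F where "open W" "x \<in> W" "Cinf W F" "\<And>y. y \<in> W \<inter> (S \<inter> U) \<Longrightarrow> F y = f y"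
    by (rule smooth_onE[OF U(3), of x]) (use U \<open>x \<in> S\<close> in auto)
  then show "\<exists>W F. open W \<and> x \<in> W \<and> Cinf W F \<and> (\<forall>y\<in>W \<inter> S. F y = f y)"
    using U by (intro exI[of _ "W \<inter> U"] exI[of _ F]) (auto intro: Cinf_subset)
qed

text \<open>The derivative of a local extension serves. On a general \<open>S\<close> it need not be
  unique, so only existence is claimed here.\<close>

lemma smooth_on_has_derivative_ex:
  assumes "smooth_on S f" "x \<in> S"
  shows "\<exists>D. (f has_derivative D) (at x within S)"
proof -
  obtain W F where W: "open W" "x \<in> W" "Cinf W F" "\<And>y. y \<in> W \<inter> S \<Longrightarrow> F y = f y"
    using smooth_onE[OF assms] by blast
  have F: "(F has_derivative frechet_derivative F (at x)) (at x within S)"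
    using Cinf_has_derivative[OF W(3,2)] has_derivative_at_withinI by blast
  obtain d where d: "d > 0" "ball x d \<subseteq> W" using W(1,2) openE by blast
  have "(f has_derivative frechet_derivative F (at x)) (at x within S)"
    by (rule has_derivative_transform_within[OF F d(1) assms(2)])
       (use d W(4) in \<open>auto simp: dist_commute subset_eq\<close>)
  then show ?thesis by blast
qed

lemma smooth_on_differentiable: "smooth_on S f \<Longrightarrow> x \<in> S \<Longrightarrow> f differentiable (at x within S)"
  using smooth_on_has_derivative_ex unfolding differentiable_def .

lemma smooth_on_has_derivative:
  "smooth_on S f \<Longrightarrow> x \<in> S \<Longrightarrow> (f has_derivative frechet_derivative f (at x within S)) (at x within S)"
  using smooth_on_differentiable frechet_derivative_works by blast

lemma smooth_on_continuous_on: "smooth_on S f \<Longrightarrow> continuous_on S f"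
  unfolding continuous_on_eq_continuous_within
  using smooth_on_differentiable differentiable_imp_continuous_within by blast

lemma smooth_on_bounded_linear:
  assumes "smooth_on S f" "bounded_linear L"
  shows "smooth_on S (\<lambda>x. L (f x))"
proof (rule smooth_onI)
  fix x assume "x \<in> S"
  then obtain W F where "open W" "x \<in> W" "Cinf W F" "\<And>y. y \<in> W \<inter> S \<Longrightarrow> F y = f y"
    using smooth_onE[OF assms(1)] by blast
  then show "\<exists>W F. open W \<and> x \<in> W \<and> Cinf W F \<and> (\<forall>y\<in>W \<inter> S. F y = L (f y))"
    by (intro exI[of _ W] exI[of _ "\<lambda>x. L (F x)"]) (auto intro: Cinf_bounded_linear assms)
qed

lemma smooth_on_compose:
  fixes G :: "'e::real_normed_vector \<Rightarrow> 'd::euclidean_space" and \<phi> :: "'d \<Rightarrow> real"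
  assumes "smooth_on S G" "\<And>x. x \<in> S \<Longrightarrow> G x \<in> T" "smooth_on T \<phi>"
  shows "smooth_on S (\<lambda>x. \<phi> (G x))"
proof (rule smooth_onI)
  fix x assume "x \<in> S"
  then obtain W F where W: "open W" "x \<in> W" "Cinf W F" "\<And>y. y \<in> W \<inter> S \<Longrightarrow> F y = G y"
    using smooth_onE[OF assms(1)] by blast
  obtain U \<psi> where U: "open U" "G x \<in> U" "Cinf U \<psi>" "\<And>y. y \<in> U \<inter> T \<Longrightarrow> \<psi> y = \<phi> y"
    using smooth_onE[OF assms(3) assms(2)[OF \<open>x \<in> S\<close>]] by blast
  \<comment> \<open>The extension \<open>F\<close> of \<open>G\<close> may leave \<open>U\<close> at
    points outside \<open>S\<close>, so its domain is cut down to the preimage of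
    \<open>U\<close>.\<close>
  define W' where "W' = W \<inter> F -` U"
  have "open W'" unfolding W'_def
    using Cinf_continuous_on[OF W(3)] W(1) U(1) by (simp add: continuous_open_preimage)
  moreover have "x \<in> W'" using W \<open>x \<in> S\<close> U(2) by (auto simp: W'_def)
  moreover have "Cinf W' (\<lambda>y. \<psi> (F y))"
    by (rule Cinf_compose[OF \<open>open W'\<close> Cinf_subset[OF W(3)] _ U(3)]) (auto simp: W'_def)
  moreover have "\<forall>y\<in>W' \<inter> S. \<psi> (F y) = \<phi> (G y)"
    using W(4) U(4) assms(2) unfolding W'_def by (metis Int_iff vimage_eq)
  ultimately show "\<exists>W F. open W \<and> x \<in> W \<and> Cinf W F \<and> (\<forall>y\<in>W \<inter> S. F y = \<phi> (G y))" by blast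
qed

lemma smooth_on_binary:
  fixes f h :: "'e::real_normed_vector \<Rightarrow> real"
  assumes "smooth_on S f" "smooth_on S h"
    and op: "\<And>W F H :: 'e \<Rightarrow> real. open W \<Longrightarrow> Cinf W F \<Longrightarrow> Cinf W H \<Longrightarrow> Cinf W (\<lambda>x. op (F x) (H x) :: real)"
  shows "smooth_on S (\<lambda>x. op (f x) (h x))"
proof (rule smooth_onI)
  fix x assume "x \<in> S"
  obtain W F where W: "open W" "x \<in> W" "Cinf W F" "\<And>y. y \<in> W \<inter> S \<Longrightarrow> F y = f y"
    using smooth_onE[OF assms(1) \<open>x \<in> S\<close>] by blast
  obtain U H where U: "open U" "x \<in> U" "Cinf U H" "\<And>y. y \<in> U \<inter> S \<Longrightarrow> H y = h y"
    using smooth_onE[OF assms(2) \<open>x \<in> S\<close>] by blast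
  have "Cinf (W \<inter> U) (\<lambda>x. op (F x) (H x))"
    by (rule op) (use W U in \<open>auto intro: Cinf_subset\<close>)
  then show "\<exists>W F. open W \<and> x \<in> W \<and> Cinf W F \<and> (\<forall>y\<in>W \<inter> S. F y = op (f y) (h y))"
    using W U by (intro exI[of _ "W \<inter> U"] exI[of _ "\<lambda>x. op (F x) (H x)"]) auto
qed

lemma smooth_on_add: "smooth_on S f \<Longrightarrow> smooth_on S h \<Longrightarrow> smooth_on S (\<lambda>x. f x + h x :: real)"
  by (rule smooth_on_binary) (auto intro: Cinf_add)

lemma smooth_on_mult: "smooth_on S f \<Longrightarrow> smooth_on S h \<Longrightarrow> smooth_on S (\<lambda>x. f x * h x :: real)"
  by (rule smooth_on_binary) (auto intro: Cinf_mult)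

lemma smooth_on_minus: "smooth_on S f \<Longrightarrow> smooth_on S (\<lambda>x. - f x :: real)"
  by (rule smooth_on_bounded_linear[OF _ bounded_linear_minus[OF bounded_linear_ident]])

lemma smooth_on_inverse:
  fixes f :: "'e::real_normed_vector \<Rightarrow> real"
  assumes "smooth_on S f" "\<And>x. x \<in> S \<Longrightarrow> f x \<noteq> 0"
  shows "smooth_on S (\<lambda>x. inverse (f x))"
proof (rule smooth_on_compose[OF assms(1), of "- {0}" inverse])
  have "Cinf (- {0}) (\<lambda>x::real. inverse x)"
    by (rule Cinf_inverse) (auto intro: Cinf_ident)
  then show "smooth_on (- {0::real}) inverse"
    by (intro Cinf_imp_smooth_on[of "- {0}"]) auto
qed (use assms in auto)

lemma smooth_on_divide:
  "smooth_on S f \<Longrightarrow> smooth_on S h \<Longrightarrow> (\<And>x. x \<in> S \<Longrightarrow> h x \<noteq> 0) \<Longrightarrow> smooth_on S (\<lambda>x. f x / h x :: real)"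
  unfolding divide_inverse by (intro smooth_on_mult smooth_on_inverse)

lemma smooth_on_sqrt:
  fixes f :: "'e::real_normed_vector \<Rightarrow> real"
  assumes "smooth_on S f" "\<And>x. x \<in> S \<Longrightarrow> 0 < f x"
  shows "smooth_on S (\<lambda>x. sqrt (f x))"
proof (rule smooth_on_compose[OF assms(1), of "{0<..}" sqrt])
  have "Cinf {0<..} (\<lambda>x::real. sqrt x)"
    by (rule Cinf_sqrt) (auto intro: Cinf_ident)
  then show "smooth_on {0::real<..} sqrt"
    by (intro Cinf_imp_smooth_on[of "{0<..}"]) auto
qed (use assms in auto)

lemma smooth_on_sum:
  "finite I \<Longrightarrow> (\<And>i. i \<in> I \<Longrightarrow> smooth_on S (f i)) \<Longrightarrow> smooth_on S (\<lambda>x. \<Sum>i\<in>I. f i x :: real)"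
  by (induction I rule: finite_induct) (simp_all add: smooth_on_const smooth_on_add)

lemma smooth_on_prod:
  "finite I \<Longrightarrow> (\<And>i. i \<in> I \<Longrightarrow> smooth_on S (f i)) \<Longrightarrow> smooth_on S (\<lambda>x. \<Prod>i\<in>I. f i x :: real)"
  by (induction I rule: finite_induct) (simp_all add: smooth_on_const smooth_on_mult)

lemma smooth_on_det:
  fixes A :: "'e::real_normed_vector \<Rightarrow> real ^ 'n ^ 'n"
  assumes "\<And>i j. smooth_on S (\<lambda>x. A x $ i $ j)"
  shows "smooth_on S (\<lambda>x. det (A x))"
  unfolding det_def
  by (intro smooth_on_sum smooth_on_mult smooth_on_prod smooth_on_const assms)
     (auto simp: finite_permutations)

section \<open>Calculus on relatively open subsets of the space or a half-space\<close>

text \<open>The shape of a chart image, stated for a bare set so that it passes to relatively open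
  subsets such as images of neighbourhoods.\<close>

definition coord_domain :: "(real ^ 'n::finite) set \<Rightarrow> bool" where
  "coord_domain V \<longleftrightarrow> open V \<or> (\<exists>i. openin (top_of_set (half_space i)) V)"

text \<open>Treats both shapes uniformly: \<open>V\<close> is relatively open in a closed convex set
  \<open>H\<close>, the whole space or a half-space.\<close>

lemma coord_domainE:
  assumes "coord_domain V"
  obtains H where "H = UNIV \<or> (\<exists>i. H = half_space i)" "openin (top_of_set H) V"
proof (cases "open V")
  case True
  then show ?thesis using that[of UNIV] by simp
next
  case False
  with assms have "\<exists>i. openin (top_of_set (half_space i)) V" by (simp add: coord_domain_def)
  then obtain i where "openin (top_of_set (half_space i)) V" ..
  then show ?thesis using that[of "half_space i"] by blast
qed

lemma coord_domain_openin:
  assumes "coord_domain V" "openin (top_of_set V) U"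
  shows "coord_domain U"
  using assms(1) unfolding coord_domain_def
proof (elim disjE exE)
  assume "open V"
  then show "open U \<or> (\<exists>i. openin (top_of_set (half_space i)) U)"
    using openin_open_trans[OF assms(2)] by simp
next
  fix i assume "openin (top_of_set (half_space i)) V"
  from openin_trans[OF assms(2) this]
  show "open U \<or> (\<exists>i. openin (top_of_set (half_space i)) U)" by (intro disjI2 exI)
qed

lemma closed_half_space: "closed (half_space i)"
  unfolding half_space_def by (rule closed_halfspace_component_ge_cart)

lemma convex_half_space: "convex (half_space i)"
proof -
  have "half_space i = {x. axis i 1 \<bullet> x \<ge> 0}"
    by (auto simp: half_space_def inner_axis')
  then show ?thesis by (simp add: convex_halfspace_ge)
qed

lemma coord_domain_borel: "coord_domain V \<Longrightarrow> V \<in> sets borel"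
proof (elim coord_domainE)
  fix H assume H: "H = UNIV \<or> (\<exists>i. H = half_space i)" "openin (top_of_set H) V"
  then obtain T where "open T" "V = H \<inter> T" by (auto simp: openin_open)
  moreover have "closed H" using H(1) closed_half_space by auto
  ultimately show "V \<in> sets borel" by auto
qed

lemma at_within_openin:
  assumes "openin (top_of_set V) U" "x \<in> U"
  shows "at x within U = at x within V"
proof -
  obtain T where "open T" "U = V \<inter> T" using assms(1) by (auto simp: openin_open)
  then show ?thesis using assms(2) by (intro at_within_nhd[of x T]) auto
qed

text \<open>From any point of a half-space a small step in the positive direction of any coordinate
  axis stays inside. One admissible approach along each basis direction already determines the
  derivative.\<close>

lemma coord_domain_derivative_unique:
  fixes V :: "(real ^ 'n::finite) set"
  assumes V: "coord_domain V" and x: "x \<in> V"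
    and D: "(f has_derivative D) (at x within V)" "(f has_derivative D') (at x within V)"
  shows "D = D'"
proof (rule frechet_derivative_unique_within[OF D])
  fix i :: "real ^ 'n" and e :: real assume i: "i \<in> Basis" and e: "e > 0"
  obtain H where H: "H = UNIV \<or> (\<exists>j. H = half_space j)" "openin (top_of_set H) V"
    using coord_domainE[OF V] by blast
  obtain T where T: "open T" "V = H \<inter> T" using H(2) by (auto simp: openin_open)
  obtain r where r: "r > 0" "ball x r \<subseteq> T" using T x openE by blast
  \<comment> \<open>Half the minimum, so that the step is strictly shorter than both
    \<open>r\<close> and \<open>e\<close>.\<close>
  define d where "d = min r e / 2"
  have d: "0 < d" "d < r" "d < e" using r e by (auto simp: d_def)
  obtain k where k: "i = axis k 1" using i by (auto simp: Basis_vec_def)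
  have "x + d *\<^sub>R i \<in> H" using H(1) T x d(1) k by (auto simp: half_space_def axis_def)
  moreover have "x + d *\<^sub>R i \<in> ball x r" using d i by (simp add: dist_norm)
  ultimately show "\<exists>d. 0 < \<bar>d\<bar> \<and> \<bar>d\<bar> < e \<and> x + d *\<^sub>R i \<in> V"
    using T r d by (intro exI[of _ d]) auto
qed

lemma coord_domain_frechet_derivative:
  "coord_domain V \<Longrightarrow> x \<in> V \<Longrightarrow> (f has_derivative D) (at x within V) \<Longrightarrow>
     frechet_derivative f (at x within V) = D"
  by (metis coord_domain_derivative_unique differentiable_def frechet_derivative_works)

text \<open>By uniqueness, the derivative within \<open>V\<close> coincides near each point with the
  derivative of a smooth extension, and that derivative is itself the required extension.\<close>

lemma smooth_on_derivative:
  fixes V :: "(real ^ 'n::finite) set"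
  assumes V: "coord_domain V" and f: "smooth_on V f"
  shows "smooth_on V (\<lambda>x. frechet_derivative f (at x within V) v)"
proof (rule smooth_onI)
  fix x assume "x \<in> V"
  then obtain W F where W: "open W" "x \<in> W" "Cinf W F" "\<And>y. y \<in> W \<inter> V \<Longrightarrow> F y = f y"
    using smooth_onE[OF f] by blast
  have "frechet_derivative f (at y within V) = frechet_derivative F (at y)" if y: "y \<in> W \<inter> V" for y
  proof (rule coord_domain_frechet_derivative[OF V])
    obtain d where d: "d > 0" "ball y d \<subseteq> W" using W(1) y openE by blast
    have "(F has_derivative frechet_derivative F (at y)) (at y within V)"
      using Cinf_has_derivative[OF W(3)] y has_derivative_at_withinI by blast
    then show "(f has_derivative frechet_derivative F (at y)) (at y within V)"
      by (rule has_derivative_transform_within[OF _ d(1)]) (use y d W(4) in \<open>auto simp: dist_commute subset_eq\<close>)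
  qed (use y in auto)
  then show "\<exists>W F. open W \<and> x \<in> W \<and> Cinf W F \<and> (\<forall>y\<in>W \<inter> V. F y = frechet_derivative f (at y within V) v)"
    using W Cinf_deriv by (intro exI[of _ W] exI[of _ "\<lambda>y. frechet_derivative F (at y) v"]) auto
qed

lemma coord_domain_deriv_add:
  "coord_domain V \<Longrightarrow> x \<in> V \<Longrightarrow> smooth_on V f \<Longrightarrow> smooth_on V h \<Longrightarrow>
   frechet_derivative (\<lambda>x. f x + h x) (at x within V) v =
   frechet_derivative f (at x within V) v + frechet_derivative h (at x within V) v"
  by (subst coord_domain_frechet_derivative[OF _ _ has_derivative_add[OF smooth_on_has_derivative smooth_on_has_derivative]]) auto

lemma coord_domain_deriv_mult:
  fixes f h :: "_ \<Rightarrow> real"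
  shows "coord_domain V \<Longrightarrow> x \<in> V \<Longrightarrow> smooth_on V f \<Longrightarrow> smooth_on V h \<Longrightarrow>
   frechet_derivative (\<lambda>x. f x * h x) (at x within V) v =
   f x * frechet_derivative h (at x within V) v + frechet_derivative f (at x within V) v * h x"
  by (subst coord_domain_frechet_derivative[OF _ _ has_derivative_mult[OF smooth_on_has_derivative smooth_on_has_derivative]]) auto

lemma coord_domain_deriv_cmult:
  fixes f :: "_ \<Rightarrow> real"
  shows "coord_domain V \<Longrightarrow> x \<in> V \<Longrightarrow> smooth_on V f \<Longrightarrow>
   frechet_derivative (\<lambda>x. c * f x) (at x within V) v = c * frechet_derivative f (at x within V) v"
  by (subst coord_domain_frechet_derivative[OF _ _ has_derivative_mult_right[OF smooth_on_has_derivative]]) auto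

lemma coord_domain_deriv_cong:
  assumes "coord_domain V" "x \<in> V" "smooth_on V f" "\<And>y. y \<in> V \<Longrightarrow> f y = h y"
  shows "frechet_derivative f (at x within V) = frechet_derivative h (at x within V)"
proof -
  have "(h has_derivative frechet_derivative f (at x within V)) (at x within V)"
    by (rule has_derivative_transform[OF _ _ smooth_on_has_derivative]) (use assms in auto)
  then show ?thesis using coord_domain_frechet_derivative[OF assms(1,2)] by metis
qed

lemma coord_domain_deriv_0:
  assumes "coord_domain V" "openin (top_of_set V) U" "x \<in> U" "\<And>y. y \<in> U \<Longrightarrow> f y = (0::real)"
  shows "frechet_derivative f (at x within V) v = 0"
proof -
  have "((\<lambda>_. 0) has_derivative (\<lambda>_. 0)) (at x within U)" by simp
  then have "(f has_derivative (\<lambda>_. 0)) (at x within U)"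
    by (rule has_derivative_transform[OF \<open>x \<in> U\<close>, rotated]) (use assms in auto)
  then have "(f has_derivative (\<lambda>_. 0)) (at x within V)"
    using at_within_openin[OF assms(2,3)] by simp
  then show ?thesis
    using coord_domain_frechet_derivative[OF assms(1)] openin_subset[OF assms(2)] assms(3) by fastforce
qed

lemma coord_domain_deriv_components:
  fixes V :: "(real ^ 'n::finite) set" and f :: "real ^ 'n \<Rightarrow> real"
  assumes "x \<in> V" "smooth_on V f"
  shows "frechet_derivative f (at x within V) v = (\<Sum>j\<in>UNIV. v $ j * frechet_derivative f (at x within V) (axis j 1))"
proof -
  have lin: "linear (frechet_derivative f (at x within V))"
    using smooth_on_differentiable[OF assms(2,1)] linear_frechet_derivative by blast
  have "frechet_derivative f (at x within V) v = frechet_derivative f (at x within V) (\<Sum>j\<in>UNIV. v $ j *\<^sub>R axis j 1)"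
    by (simp add: basis_expansion scalar_mult_eq_scaleR[symmetric])
  also have "\<dots> = (\<Sum>j\<in>UNIV. v $ j * frechet_derivative f (at x within V) (axis j 1))"
    by (simp add: linear_sum[OF lin] linear_scale[OF lin])
  finally show ?thesis .
qed

text \<open>A boundary point of a half-space is pushed inwards along the normal axis. The
  consequence of interest is that nonempty relatively open sets are not Lebesgue null.\<close>

lemma coord_domain_interior_nonempty:
  fixes V :: "(real ^ 'n::finite) set"
  assumes V: "coord_domain V" and N: "openin (top_of_set V) N" "N \<noteq> {}"
  shows "interior N \<noteq> {}"
proof -
  obtain x where x: "x \<in> N" using N by blast
  have "coord_domain N" using coord_domain_openin[OF V N(1)] .
  then obtain H where H: "H = UNIV \<or> (\<exists>j. H = half_space j)" "openin (top_of_set H) N"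
    using coord_domainE by blast
  obtain T where T: "open T" "N = H \<inter> T" using H(2) by (auto simp: openin_open)
  obtain r where r: "r > 0" "ball x r \<subseteq> T" using T x openE by blast
  show ?thesis
  proof (cases "H = UNIV")
    case True
    then show ?thesis using T x interior_open by auto
  next
    case False
    then obtain j where j: "H = half_space j" using H by blast
    define y where "y = x + (r/2) *\<^sub>R axis j 1"
    have "y \<in> ball x r" using r by (simp add: y_def dist_norm norm_axis_1)
    moreover have "y $ j > 0" using x T j r by (auto simp: y_def half_space_def axis_def)
    moreover have "open (ball x r \<inter> {z. z $ j > 0})"
      by (intro open_Int open_ball open_halfspace_component_gt_cart)
    moreover have "ball x r \<inter> {z. z $ j > 0} \<subseteq> N" using T r j by (auto simp: half_space_def)
    ultimately have "y \<in> interior N" by (intro interiorI[of "ball x r \<inter> {z. z $ j > 0}"]) auto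
    then show ?thesis by blast
  qed
qed

section \<open>The divergence theorem in coordinates\<close>

lemma AE_lborel_component_nonzero: "AE x :: real ^ 'n::finite in lborel. x $ i \<noteq> 0"
proof (rule AE_I')
  have "negligible {x :: real ^ 'n. x $ i = 0}"
    by (rule negligible_standard_hyperplane_cart)
  moreover have "{x :: real ^ 'n. x $ i = 0} \<in> sets lborel"
    by (simp add: closed_Collect_eq continuous_intros borel_closed)
  ultimately show "{x :: real ^ 'n. x $ i = 0} \<in> null_sets lborel"
    by (simp add: negligible_iff_null_sets null_sets_completion_iff)
qed auto

lemma integrable_indicator_cball: "integrable lborel (\<lambda>x. indicator (cball c r) x :: real)"
  using emeasure_lborel_cball_finite[of c r] by (intro integrable_real_indicator) (simp_all add: less_top)

text \<open>Translation invariance makes the integrals of the difference quotients vanish, and dominated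
  convergence passes to the limit. At the boundary of a half-space the extension of \<open>F\<close> by zero is
  still Lipschitz in the normal direction because \<open>F\<close> vanishes there.\<close>

lemma integral_derivative_eq_0:
  fixes V :: "(real ^ 'n::finite) set" and F :: "real ^ 'n \<Rightarrow> real"
  assumes V: "coord_domain V" and F: "smooth_on V F"
    and K: "compact K" "K \<subseteq> V" "\<And>x. x \<in> V - K \<Longrightarrow> F x = 0"
    and bd: "\<And>x. openin (top_of_set (half_space j)) V \<Longrightarrow> x \<in> V \<Longrightarrow> x $ j = 0 \<Longrightarrow> F x = 0"
  shows "(\<integral>x. indicator V x * frechet_derivative F (at x within V) (axis j 1) \<partial>lborel) = 0"
proof -
  obtain H where H: "H = UNIV \<or> (\<exists>i. H = half_space i)" "openin (top_of_set H) V"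
    using coord_domainE[OF V] by blast
  have VH: "V \<subseteq> H" using openin_imp_subset[OF H(2)] .
  have Hconv: "convex H" using H(1) convex_half_space by auto
  have Hclosed: "closed H" using H(1) closed_half_space by auto
  define e :: "real ^ 'n" where "e = axis j 1"
  have norm_e: "norm e = 1" by (simp add: e_def)
  define F0 where "F0 x = (if x \<in> V then F x else 0)" for x
  define F' where "F' x v = (if x \<in> V then frechet_derivative F (at x within V) v else 0)" for x v
  \<comment> \<open>Points of \<open>H\<close> outside \<open>V\<close> avoid the compact set
    \<open>K\<close>, so \<open>F0\<close> vanishes near them within \<open>H\<close>. Extending
    from \<open>V\<close> to \<open>H\<close> is thus harmless; a jump could occur only across the
    boundary of \<open>H\<close>.\<close>
  have F0_deriv: "(F0 has_derivative F' x) (at x within H)" if x: "x \<in> H" for x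
  proof (cases "x \<in> V")
    case True
    have "(F0 has_derivative frechet_derivative F (at x within V)) (at x within V)"
      by (rule has_derivative_transform[OF True _ smooth_on_has_derivative[OF F True]]) (simp add: F0_def)
    moreover have "F' x = frechet_derivative F (at x within V)" using True by (auto simp: F'_def)
    ultimately show ?thesis using at_within_openin[OF H(2) True] by simp
  next
    case False
    have op: "openin (top_of_set H) (H - K)"
      using openin_open_Int[OF open_Compl[OF compact_imp_closed[OF K(1)]], of H] by (simp add: Diff_eq)
    have xU: "x \<in> H - K" using x False K(2) by auto
    have "((\<lambda>_. 0) has_derivative (\<lambda>_. 0)) (at x within H - K)" by simp
    then have "(F0 has_derivative (\<lambda>_. 0)) (at x within H - K)"
      by (rule has_derivative_transform[OF xU, rotated]) (use K in \<open>auto simp: F0_def\<close>)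
    moreover have "F' x = (\<lambda>_. 0)" using False by (auto simp: F'_def)
    ultimately show ?thesis using at_within_openin[OF op xU] by simp
  qed
  obtain M where M: "M \<ge> 0" "\<And>x. \<bar>F' x e\<bar> \<le> M"
  proof -
    have "continuous_on K (\<lambda>x. frechet_derivative F (at x within V) e)"
      using smooth_on_continuous_on[OF smooth_on_derivative[OF V F]] K(2) continuous_on_subset by blast
    then have "bounded ((\<lambda>x. frechet_derivative F (at x within V) e) ` K)"
      using K(1) compact_continuous_image compact_imp_bounded by blast
    then obtain B where B: "\<And>x. x \<in> K \<Longrightarrow> \<bar>frechet_derivative F (at x within V) e\<bar> \<le> B"
      by (auto simp: bounded_iff)
    have "openin (top_of_set V) (V - K)"
      using openin_open_Int[OF open_Compl[OF compact_imp_closed[OF K(1)]], of V] by (simp add: Diff_eq)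
    then have "F' x e = 0" if "x \<notin> K" for x
      using coord_domain_deriv_0[OF V, of "V - K" x F e] K(3) that by (auto simp: F'_def)
    moreover have "\<bar>F' x e\<bar> \<le> B" if "x \<in> K" for x using B[OF that] K(2) that by (auto simp: F'_def)
    ultimately have "\<bar>F' x e\<bar> \<le> max B 0" for x by (cases "x \<in> K") fastforce+
    then show ?thesis using that[of "max B 0"] by auto
  qed
  have lip_H: "\<bar>F0 (x + t *\<^sub>R e) - F0 x\<bar> \<le> M * t" if t: "t \<ge> 0" and x: "x \<in> H" "x + t *\<^sub>R e \<in> H" for x t
  proof -
    have seg: "x + s *\<^sub>R e \<in> H" if s: "s \<in> {0..t}" for s
    proof (cases "t = 0")
      case False
      have "(1 - s / t) *\<^sub>R x + (s / t) *\<^sub>R (x + t *\<^sub>R e) \<in> H"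
        using s False by (intro convexD[OF Hconv x]) auto
      moreover have "(1 - s / t) *\<^sub>R x + (s / t) *\<^sub>R (x + t *\<^sub>R e) = x + s *\<^sub>R e"
        using False by (simp add: algebra_simps)
      ultimately show ?thesis by simp
    qed (use s x in auto)
    have "((\<lambda>s. F0 (x + s *\<^sub>R e)) has_field_derivative F' (x + s *\<^sub>R e) e) (at s within {0..t})"
      if s: "s \<in> {0..t}" for s
    proof -
      have 1: "((\<lambda>s. x + s *\<^sub>R e) has_derivative (\<lambda>h. h *\<^sub>R e)) (at s within {0..t})"
        by (auto intro!: derivative_eq_intros)
      have 2: "(F0 has_derivative F' (x + s *\<^sub>R e)) (at (x + s *\<^sub>R e) within (\<lambda>s. x + s *\<^sub>R e) ` {0..t})"
        using F0_deriv[OF seg[OF s]] by (rule has_derivative_subset) (use seg in auto)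
      have "((\<lambda>s. F0 (x + s *\<^sub>R e)) has_derivative (\<lambda>h. F' (x + s *\<^sub>R e) (h *\<^sub>R e))) (at s within {0..t})"
        using has_derivative_in_compose[OF 1 2] .
      moreover have "linear (F' (x + s *\<^sub>R e))"
        using F0_deriv[OF seg[OF s]] has_derivative_linear by blast
      ultimately show ?thesis
        unfolding has_field_derivative_def by (simp add: linear_scale mult_commute_abs)
    qed
    then have "norm (F0 (x + t *\<^sub>R e) - F0 (x + 0 *\<^sub>R e)) \<le> M * norm (t - 0)"
      by (rule field_differentiable_bound[rotated]) (use t M(2) in auto)
    then show ?thesis using t by simp
  qed
  have lip: "\<bar>F0 (x + t *\<^sub>R e) - F0 x\<bar> \<le> M * t" if t: "t \<ge> 0" for x t
  proof (cases "x \<in> H")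
    case True
    then have "x + t *\<^sub>R e \<in> H" using H(1) t by (auto simp: half_space_def e_def axis_def)
    then show ?thesis using lip_H t True by blast
  next
    case False
    show ?thesis
    proof (cases "x + t *\<^sub>R e \<in> H")
      case False
      then show ?thesis using \<open>x \<notin> H\<close> VH M(1) t by (auto simp: F0_def)
    next
      case True
      obtain i where i: "H = half_space i" using False H(1) by blast
      have "x $ i < 0" "0 \<le> (x + t *\<^sub>R e) $ i" using True False i by (auto simp: half_space_def)
      \<comment> \<open>Moving along \<open>e\<close> changes only the \<open>j\<close>-th
        coordinate, so the half-space can be entered only through a face normal to
        \<open>e\<close>.\<close>
      then have "i = j" by (auto simp: e_def axis_def split: if_splits)
      then have i: "H = half_space j" "x $ j < 0" "- x $ j \<le> t"
        using i \<open>x $ i < 0\<close> \<open>0 \<le> (x + t *\<^sub>R e) $ i\<close> by (auto simp: e_def axis_def)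
      \<comment> \<open>The point at which the segment from \<open>x\<close> crosses the face. There
        \<open>F\<close> vanishes by assumption, so only the part of the segment inside
        \<open>H\<close> contributes.\<close>
      define y where "y = x + (- x $ j) *\<^sub>R e"
      have y: "y $ j = 0" "y \<in> H" using i by (auto simp: y_def e_def half_space_def axis_def)
      have "F0 y = 0" using bd[of y] H(2) i(1) y(1) by (auto simp: F0_def)
      moreover have eq: "y + (t + x $ j) *\<^sub>R e = x + t *\<^sub>R e" by (simp add: y_def algebra_simps)
      have "\<bar>F0 (y + (t + x $ j) *\<^sub>R e) - F0 y\<bar> \<le> M * (t + x $ j)"
        by (rule lip_H) (use i y True eq in auto)
      moreover have "F0 x = 0" using \<open>x \<notin> H\<close> VH by (auto simp: F0_def)
      moreover have "M * (t + x $ j) \<le> M * t" using M(1) i(2) by (simp add: mult_left_mono)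
      ultimately show ?thesis unfolding eq by linarith
    qed
  qed
  obtain R where "\<forall>x\<in>K. norm x \<le> R"
    using compact_imp_bounded[OF K(1)] unfolding bounded_iff ..
  then have R: "K \<subseteq> cball 0 R" by auto
  have F0_supp: "F0 x = 0" if "norm x > R" for x
  proof -
    have "x \<notin> cball 0 R" using that by simp
    then have "x \<notin> K" using R by blast
    then show ?thesis using K(3) by (simp add: F0_def)
  qed
  have F0_meas[measurable]: "F0 \<in> borel_measurable borel"
  proof -
    have "(\<lambda>x. indicator V x *\<^sub>R F x) \<in> borel_measurable borel"
      by (intro borel_measurable_continuous_on_indicator coord_domain_borel V smooth_on_continuous_on F)
    moreover have "(\<lambda>x. indicator V x *\<^sub>R F x) = F0" by (auto simp: F0_def)
    ultimately show ?thesis by simp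
  qed
  have F0_int: "integrable lborel F0"
  proof -
    have "bounded (F ` K)"
      using K compact_continuous_image[OF continuous_on_subset[OF smooth_on_continuous_on[OF F] K(2)]]
        compact_imp_bounded by blast
    then obtain B where B: "\<And>x. x \<in> K \<Longrightarrow> \<bar>F x\<bar> \<le> B" by (auto simp: bounded_iff)
    show ?thesis
    proof (rule Bochner_Integration.integrable_bound[where f = "\<lambda>x. \<bar>B\<bar> * indicator (cball 0 R) x"])
      show "AE x in lborel. norm (F0 x) \<le> norm (\<bar>B\<bar> * indicator (cball 0 R) x)"
      proof (rule AE_I2)
        fix x show "norm (F0 x) \<le> norm (\<bar>B\<bar> * indicator (cball 0 R) x)"
        proof (cases "x \<in> K")
          case True
          then have "x \<in> cball 0 R" "x \<in> V" using R K(2) by blast+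
          then show ?thesis using B[OF True] by (simp add: F0_def)
        next
          case False
          then have "F0 x = 0" using K(3) by (simp add: F0_def)
          then show ?thesis by simp
        qed
      qed
      show "integrable lborel (\<lambda>x. \<bar>B\<bar> * indicator (cball (0 :: real ^ 'n) R) x)"
        by (intro integrable_mult_right integrable_indicator_cball)
    qed simp
  qed
  define q where "q m x = real (Suc m) * (F0 (x + inverse (real (Suc m)) *\<^sub>R e) - F0 x)" for m x
  have q_int0: "integral\<^sup>L lborel (q m) = 0" for m
  proof -
    have tr: "(\<lambda>x. F0 (c + x)) = F0 \<circ> (+) c" for c by auto
    have int: "integrable lborel (\<lambda>x. F0 (c + x))" and eq: "(\<integral>x. F0 (c + x) \<partial>lborel) = integral\<^sup>L lborel F0" for c
      using integrable_distr_eq[of "(+) c" lborel borel F0] integral_distr[of "(+) c" lborel borel F0] F0_int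
      by (simp_all add: lborel_distr_plus)
    have "integral\<^sup>L lborel (q m) =
        real (Suc m) * ((\<integral>x. F0 (inverse (real (Suc m)) *\<^sub>R e + x) \<partial>lborel) - integral\<^sup>L lborel F0)"
      unfolding q_def[abs_def] using int[of "inverse (real (Suc m)) *\<^sub>R e"] F0_int
      by (simp add: add.commute[of _ "_ *\<^sub>R e"] del: of_nat_Suc)
    then show ?thesis using eq by simp
  qed
  have q_lim: "AE x in lborel. (\<lambda>m. q m x) \<longlonglongrightarrow> F' x e"
  proof -
    \<comment> \<open>Off the boundary of \<open>H\<close> the extension has a two-sided derivative.
      The points left out lie on a hyperplane, which is null.\<close>
    have lim: "(\<lambda>m. q m x) \<longlonglongrightarrow> F' x e" if x: "x \<in> interior H \<or> x \<notin> H" for x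
    proof -
      have D: "(F0 has_derivative F' x) (at x)"
      proof (cases "x \<in> interior H")
        case True
        then show ?thesis using F0_deriv[of x] at_within_interior[OF True] interior_subset by auto
      next
        case False
        then have x: "x \<in> - H" using x by auto
        have "((\<lambda>_. 0) has_derivative (\<lambda>_. 0)) (at x)" by simp
        then have "(F0 has_derivative (\<lambda>_. 0)) (at x)"
          by (rule has_derivative_transform_within_open[OF _ open_Compl[OF Hclosed] x]) (use VH in \<open>auto simp: F0_def\<close>)
        moreover have "x \<notin> V" using x VH by blast
        then have "F' x = (\<lambda>_. 0)" by (simp add: F'_def fun_eq_iff)
        ultimately show ?thesis by simp
      qed
      have 1: "((\<lambda>s::real. x + s *\<^sub>R e) has_derivative (\<lambda>h. h *\<^sub>R e)) (at 0)"
        by (auto intro!: derivative_eq_intros)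
      have "((\<lambda>s. F0 (x + s *\<^sub>R e)) has_derivative (\<lambda>h. F' x (h *\<^sub>R e))) (at 0)"
        using has_derivative_compose[OF 1, of F0 "F' x"] D by simp
      moreover have "linear (F' x)" using D has_derivative_linear by blast
      ultimately have "DERIV (\<lambda>s. F0 (x + s *\<^sub>R e)) 0 :> F' x e"
        unfolding has_field_derivative_def by (simp add: linear_scale mult_commute_abs)
      then have L: "(\<lambda>h. (F0 (x + h *\<^sub>R e) - F0 x) / h) \<midarrow>0\<rightarrow> F' x e"
        by (simp add: DERIV_def)
      have "((\<lambda>h. (F0 (x + h *\<^sub>R e) - F0 x) / h) \<circ> (\<lambda>m. inverse (real (Suc m)))) \<longlonglongrightarrow> F' x e"
        using L[unfolded tendsto_at_iff_sequentially] LIMSEQ_inverse_real_of_nat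
        by (auto simp del: of_nat_Suc)
      moreover have "((\<lambda>h. (F0 (x + h *\<^sub>R e) - F0 x) / h) \<circ> (\<lambda>m. inverse (real (Suc m)))) = (\<lambda>m. q m x)"
        by (auto simp: q_def field_simps)
      ultimately show ?thesis by simp
    qed
    show ?thesis
    proof (cases "H = UNIV")
      case True then show ?thesis using lim by simp
    next
      case False
      then obtain i where i: "H = half_space i" using H by blast
      have "x \<in> interior H \<or> x \<notin> H" if "x $ i \<noteq> 0" for x
      proof (cases "x $ i > 0")
        case True
        then show ?thesis
          by (intro disjI1 interiorI[of "{x. x $ i > 0}"]) (auto simp: i half_space_def open_halfspace_component_gt_cart)
      qed (use that i in \<open>auto simp: half_space_def\<close>)
      with AE_lborel_component_nonzero[of i] lim show ?thesis by (auto elim!: eventually_mono)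
    qed
  qed
  \<comment> \<open>The shifts have length at most 1, so all quotients vanish outside the ball of
    radius \<open>R + 1\<close>; the Lipschitz constant \<open>M\<close> bounds them inside.\<close>
  have "(\<lambda>m. integral\<^sup>L lborel (q m)) \<longlonglongrightarrow> (\<integral>x. F' x e \<partial>lborel)"
  proof (rule integral_dominated_convergence[where w = "\<lambda>x. M * indicator (cball 0 (R + 1)) x"])
    show "(\<lambda>x. F' x e) \<in> borel_measurable lborel"
    proof -
      have "(\<lambda>x. indicator V x *\<^sub>R frechet_derivative F (at x within V) e) \<in> borel_measurable borel"
        by (intro borel_measurable_continuous_on_indicator coord_domain_borel V smooth_on_continuous_on
              smooth_on_derivative F)
      moreover have "(\<lambda>x. indicator V x *\<^sub>R frechet_derivative F (at x within V) e) = (\<lambda>x. F' x e)"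
        by (auto simp: F'_def)
      ultimately show ?thesis by simp
    qed
    show "integrable lborel (\<lambda>x. M * indicator (cball (0 :: real ^ 'n) (R + 1)) x)"
      by (intro integrable_mult_right integrable_indicator_cball)
    show "AE x in lborel. norm (q m x) \<le> M * indicator (cball 0 (R + 1)) x" for m
    proof (rule AE_I2)
      fix x
      have "\<bar>q m x\<bar> = real (Suc m) * \<bar>F0 (x + inverse (real (Suc m)) *\<^sub>R e) - F0 x\<bar>"
        by (simp add: q_def abs_mult del: of_nat_Suc)
      also have "\<dots> \<le> real (Suc m) * (M * inverse (real (Suc m)))"
        by (intro mult_left_mono lip) auto
      finally have "\<bar>q m x\<bar> \<le> M" by (simp add: field_simps del: of_nat_Suc)
      moreover have "q m x = 0" if x: "norm x > R + 1"
      proof -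
        have "norm (inverse (real (Suc m)) *\<^sub>R e) \<le> 1" by (simp add: norm_e field_simps)
        then have "norm (x + inverse (real (Suc m)) *\<^sub>R e) > R"
          using x norm_diff_ineq[of x "inverse (real (Suc m)) *\<^sub>R e"] by linarith
        then show ?thesis using x F0_supp by (simp add: q_def)
      qed
      ultimately show "norm (q m x) \<le> M * indicator (cball 0 (R + 1)) x"
        by (cases "norm x > R + 1") auto
    qed
    show "q m \<in> borel_measurable lborel" for m unfolding q_def[abs_def] by measurable
    show "AE x in lborel. (\<lambda>m. q m x) \<longlonglongrightarrow> F' x e" by (rule q_lim)
  qed
  then have "(\<integral>x. F' x e \<partial>lborel) = 0" by (simp add: q_int0 LIMSEQ_const_iff)
  moreover have "F' x e = indicator V x * frechet_derivative F (at x within V) (axis j 1)" for x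
    by (auto simp: F'_def e_def)
  ultimately show ?thesis by simp
qed

section \<open>Operators in the space of square-integrable functions\<close>

text \<open>The discriminant criterion for a nonnegative quadratic polynomial with no sign assumed
  for \<open>c\<close>. It yields Cauchy-Schwarz for square-integrable functions and for the metric,
  and, with \<open>a = 0\<close>, the vanishing of a first variation.\<close>

lemma discriminant_le:
  fixes a b c :: real
  assumes "\<And>t. 0 \<le> a - 2 * t * b + t\<^sup>2 * c"
  shows "b\<^sup>2 \<le> a * c"
proof (cases "c = 0")
  case True
  have "b = 0"
  proof (rule ccontr)
    assume "b \<noteq> 0"
    \<comment> \<open>For this \<open>t\<close> the linear polynomial \<open>a - 2 * t * b\<close>
      takes the value -1.\<close>
    then show False using assms[of "(a + 1) / (2 * b)"] True by simp
  qed
  then show ?thesis using True by simp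
next
  case False
  have "c \<ge> 0"
  proof (rule ccontr)
    assume c: "\<not> c \<ge> 0"
    \<comment> \<open>Chosen so that \<open>t \<ge> 1\<close> and
      \<open>t * c \<le> - (\<bar>a\<bar> + 2 * \<bar>b\<bar> + 1)\<close>: the quadratic term then
      outweighs both lower ones.\<close>
    define t where "t = (\<bar>a\<bar> + 2 * \<bar>b\<bar> + 1) / (- c) + 1"
    have t: "t \<ge> 1" using c by (auto simp: t_def field_simps)
    have tc: "t * c = - (\<bar>a\<bar> + 2 * \<bar>b\<bar> + 1) + c" using c by (simp add: t_def field_simps)
    have "t\<^sup>2 * c = t * (t * c)" by (simp add: power2_eq_square)
    also have "\<dots> \<le> t * (- (\<bar>a\<bar> + 2 * \<bar>b\<bar> + 1))"
      unfolding tc using c t by (intro mult_left_mono) auto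
    finally have "a - 2 * t * b + t\<^sup>2 * c \<le> a - 2 * t * b - t * \<bar>a\<bar> - 2 * (t * \<bar>b\<bar>) - t"
      by (simp add: algebra_simps)
    moreover have "t * - b \<le> t * \<bar>b\<bar>" using t by (intro mult_left_mono) auto
    then have "- 2 * t * b \<le> 2 * (t * \<bar>b\<bar>)" by (simp add: algebra_simps)
    moreover have "\<bar>a\<bar> \<le> t * \<bar>a\<bar>" using t mult_right_mono[of 1 t "\<bar>a\<bar>"] by simp
    ultimately show False using assms[of t] t by linarith
  qed
  then have c: "c > 0" using False by simp
  have "0 \<le> c * (a - 2 * (b / c) * b + (b / c)\<^sup>2 * c)"
    using assms[of "b / c"] c by (intro mult_nonneg_nonneg) auto
  also have "\<dots> = a * c - b\<^sup>2" using c by (simp add: power2_eq_square field_simps)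
  finally show ?thesis by simp
qed

context
  fixes M :: "'a measure"
begin

lemma l2_measurable [measurable_dest]: "f \<in> l2_space M \<Longrightarrow> f \<in> borel_measurable M"
  by (simp add: l2_space_def)

lemma l2_integrable_mult:
  assumes "f \<in> l2_space M" "h \<in> l2_space M"
  shows "integrable M (\<lambda>x. f x * h x)"
proof (rule Bochner_Integration.integrable_bound)
  show "integrable M (\<lambda>x. (f x)\<^sup>2 + (h x)\<^sup>2)" using assms by (auto simp: l2_space_def)
  show "(\<lambda>x. f x * h x) \<in> borel_measurable M" using assms by measurable
  show "AE x in M. norm (f x * h x) \<le> norm ((f x)\<^sup>2 + (h x)\<^sup>2)"
  proof (rule AE_I2)
    fix x
    have "2 * \<bar>f x * h x\<bar> \<le> (f x)\<^sup>2 + (h x)\<^sup>2"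
      using sum_squares_bound[of "\<bar>f x\<bar>" "\<bar>h x\<bar>"] by (simp add: abs_mult)
    then show "norm (f x * h x) \<le> norm ((f x)\<^sup>2 + (h x)\<^sup>2)" by simp
  qed
qed

lemma l2_add:
  assumes "f \<in> l2_space M" "h \<in> l2_space M"
  shows "(\<lambda>x. f x + h x) \<in> l2_space M"
proof -
  have "(\<lambda>x. (f x + h x)\<^sup>2) = (\<lambda>x. (f x)\<^sup>2 + (h x)\<^sup>2 + 2 * (f x * h x))"
    by (auto simp: power2_sum)
  then show ?thesis using assms l2_integrable_mult[OF assms] by (auto simp: l2_space_def)
qed

lemma l2_scale: "f \<in> l2_space M \<Longrightarrow> (\<lambda>x. c * f x) \<in> l2_space M"
  by (auto simp: l2_space_def power_mult_distrib)

lemma l2_diff: "f \<in> l2_space M \<Longrightarrow> h \<in> l2_space M \<Longrightarrow> (\<lambda>x. f x - h x) \<in> l2_space M"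
  using l2_add[of f "\<lambda>x. - 1 * h x"] l2_scale[of h "- 1"] by simp

lemma l2_0: "(\<lambda>_. 0) \<in> l2_space M" by (simp add: l2_space_def)

lemma l2_inner_commute: "l2_inner M f h = l2_inner M h f"
  by (simp add: l2_inner_def mult.commute)

lemma l2_inner_scale: "l2_inner M (\<lambda>x. c * f x) k = c * l2_inner M f k"
  unfolding l2_inner_def by (simp add: mult.assoc)

lemma l2_inner_diff:
  "f \<in> l2_space M \<Longrightarrow> h \<in> l2_space M \<Longrightarrow> k \<in> l2_space M \<Longrightarrow>
   l2_inner M (\<lambda>x. f x - h x) k = l2_inner M f k - l2_inner M h k"
  unfolding l2_inner_def using l2_integrable_mult[of f k] l2_integrable_mult[of h k]
  by (simp add: left_diff_distrib)

lemma l2_inner_self_nonneg: "0 \<le> l2_inner M f f"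
  by (simp add: l2_inner_def)

lemma l2_norm_nonneg: "0 \<le> l2_norm M f"
  by (simp add: l2_norm_def l2_inner_self_nonneg)

lemma l2_norm_power2: "(l2_norm M f)\<^sup>2 = l2_inner M f f"
  by (simp add: l2_norm_def l2_inner_self_nonneg)

lemma l2_norm_diff_scale:
  assumes "f \<in> l2_space M" "h \<in> l2_space M"
  shows "(l2_norm M (\<lambda>x. f x - c * h x))\<^sup>2 = (l2_norm M f)\<^sup>2 - 2 * c * l2_inner M f h + c\<^sup>2 * (l2_norm M h)\<^sup>2"
proof -
  define w where "w = (\<lambda>x. f x - c * h x)"
  have w: "w \<in> l2_space M" unfolding w_def by (intro l2_diff l2_scale assms)
  have ip: "l2_inner M w k = l2_inner M f k - c * l2_inner M h k" if "k \<in> l2_space M" for k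
    unfolding w_def using assms that by (simp add: l2_inner_diff l2_inner_scale l2_scale)
  have "l2_inner M w w = l2_inner M f w - c * l2_inner M h w" by (rule ip[OF w])
  also have "\<dots> = l2_inner M w f - c * l2_inner M w h"
    by (simp only: l2_inner_commute[of f w] l2_inner_commute[of h w])
  also have "\<dots> = (l2_inner M f f - c * l2_inner M h f) - c * (l2_inner M f h - c * l2_inner M h h)"
    by (simp only: ip assms)
  finally show ?thesis unfolding l2_norm_power2 w_def[symmetric] using l2_inner_commute[of h f]
    by (simp add: power2_eq_square algebra_simps)
qed

lemma l2_Cauchy_Schwarz:
  assumes "f \<in> l2_space M" "h \<in> l2_space M"
  shows "\<bar>l2_inner M f h\<bar> \<le> l2_norm M f * l2_norm M h"
proof -
  have "(l2_inner M f h)\<^sup>2 \<le> (l2_norm M f)\<^sup>2 * (l2_norm M h)\<^sup>2"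
    by (rule discriminant_le) (metis l2_norm_diff_scale[OF assms] zero_le_power2)
  then have "sqrt ((l2_inner M f h)\<^sup>2) \<le> sqrt ((l2_norm M f * l2_norm M h)\<^sup>2)"
    by (intro real_sqrt_le_mono) (simp add: power_mult_distrib)
  then show ?thesis by (simp add: l2_norm_nonneg)
qed

lemma l2_norm_triangle:
  assumes "f \<in> l2_space M" "h \<in> l2_space M"
  shows "l2_norm M (\<lambda>x. f x + h x) \<le> l2_norm M f + l2_norm M h"
proof (rule power2_le_imp_le)
  have "(l2_norm M (\<lambda>x. f x + h x))\<^sup>2 = (l2_norm M f)\<^sup>2 + 2 * l2_inner M f h + (l2_norm M h)\<^sup>2"
    using l2_norm_diff_scale[OF assms, of "- 1"] by simp
  also have "\<dots> \<le> (l2_norm M f + l2_norm M h)\<^sup>2"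
    using l2_Cauchy_Schwarz[OF assms] by (simp add: power2_sum)
  finally show "(l2_norm M (\<lambda>x. f x + h x))\<^sup>2 \<le> (l2_norm M f + l2_norm M h)\<^sup>2" .
qed (simp add: l2_norm_nonneg)

lemma l2_norm_minus_commute: "l2_norm M (\<lambda>x. f x - h x) = l2_norm M (\<lambda>x. h x - f x)"
proof -
  have "(\<lambda>x. (f x - h x) * (f x - h x)) = (\<lambda>x. (h x - f x) * (h x - f x))"
    by (rule ext) algebra
  then show ?thesis unfolding l2_norm_def l2_inner_def by (rule arg_cong)
qed

lemma l2_norm_triangle_diff:
  assumes "f \<in> l2_space M" "h \<in> l2_space M" "k \<in> l2_space M"
  shows "l2_norm M (\<lambda>x. f x - k x) \<le> l2_norm M (\<lambda>x. f x - h x) + l2_norm M (\<lambda>x. h x - k x)"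
  using l2_norm_triangle[OF l2_diff[OF assms(1,2)] l2_diff[OF assms(2,3)]] by simp

lemma l2_norm_cong_AE:
  assumes "f \<in> borel_measurable M" "h \<in> borel_measurable M" "AE x in M. f x = h x"
  shows "l2_norm M f = l2_norm M h"
proof -
  have "(\<integral>x. f x * f x \<partial>M) = (\<integral>x. h x * h x \<partial>M)"
    by (rule integral_cong_AE) (use assms in auto)
  then show ?thesis by (simp add: l2_norm_def l2_inner_def)
qed

lemma l2_norm_eq_0: "f \<in> l2_space M \<Longrightarrow> l2_norm M f = 0 \<Longrightarrow> AE x in M. f x = 0"
  using integral_nonneg_eq_0_iff_AE[of M "\<lambda>x. f x * f x"] l2_integrable_mult[of f f]
  by (auto simp: l2_norm_def l2_inner_def)

lemma l2_inner_tendsto: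
  assumes "\<And>n. F n \<in> l2_space M" "f \<in> l2_space M" "k \<in> l2_space M"
    and "(\<lambda>n. l2_norm M (\<lambda>x. F n x - f x)) \<longlonglongrightarrow> 0"
  shows "(\<lambda>n. l2_inner M (F n) k) \<longlonglongrightarrow> l2_inner M f k"
proof (rule Lim_null[THEN iffD2], rule Lim_null_comparison)
  show "(\<lambda>n. l2_norm M (\<lambda>x. F n x - f x) * l2_norm M k) \<longlonglongrightarrow> 0"
    using tendsto_mult_right[OF assms(4), of "l2_norm M k"] by simp
  show "\<forall>\<^sub>F n in sequentially. norm (l2_inner M (F n) k - l2_inner M f k)
      \<le> l2_norm M (\<lambda>x. F n x - f x) * l2_norm M k"
    using l2_Cauchy_Schwarz[OF l2_diff[OF assms(1,2)] assms(3)] by (simp add: l2_inner_diff assms)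
qed

lemma l2_nn_integral: "f \<in> l2_space M \<Longrightarrow> (\<integral>\<^sup>+x. ennreal ((f x)\<^sup>2) \<partial>M) = ennreal ((l2_norm M f)\<^sup>2)"
  unfolding l2_norm_power2 l2_inner_def
  by (subst nn_integral_eq_integral) (auto simp: l2_space_def power2_eq_square)

text \<open>Along the subsequence, the series of \<open>4\<^sup>k\<close> times the squared increments is integrable, hence
  finite almost everywhere, which forces geometric decay of the increments.\<close>

lemma l2_complete:
  assumes F: "\<And>n::nat. F n \<in> l2_space M"
    and Cauchy: "\<And>e. 0 < e \<Longrightarrow> \<exists>N. \<forall>m\<ge>N. \<forall>n\<ge>N. l2_norm M (\<lambda>x. F m x - F n x) < e"
  shows "\<exists>f\<in>l2_space M. (\<lambda>n. l2_norm M (\<lambda>x. F n x - f x)) \<longlonglongrightarrow> 0"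
proof -
  have Fm[measurable]: "F n \<in> borel_measurable M" for n using F by (rule l2_measurable)
  \<comment> \<open>The base 8 is dictated by the weights \<open>4^k\<close>: since
    \<open>e k \<le> 1\<close>, the weighted squared increments are at most
    \<open>4^k * 8^(-k) = 2^(-k)\<close>, which is summable.\<close>
  define e where "e k = (1 / 8 :: real) ^ k" for k :: nat
  have e: "e k > 0" for k by (simp add: e_def)
  obtain N where N: "\<And>k m n. m \<ge> N k \<Longrightarrow> n \<ge> N k \<Longrightarrow> l2_norm M (\<lambda>x. F m x - F n x) < e k"
    using Cauchy[OF e] by metis
  \<comment> \<open>The sum dominates every \<open>N i\<close> with \<open>i \<le> k\<close>, so
    consecutive indices both exceed \<open>N k\<close>; the summand \<open>k\<close> makes the
    indices unbounded.\<close>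
  define r where "r k = (\<Sum>i\<le>k. N i) + k" for k
  have rN: "r k \<ge> N k" for k
    unfolding r_def by (simp add: trans_le_add1 member_le_sum)
  have r_Suc: "r (Suc k) \<ge> N k" for k
    using rN[of k] by (simp add: r_def)
  have r_ge: "r k \<ge> k" for k by (simp add: r_def)
  define d where "d k x = F (r (Suc k)) x - F (r k) x" for k x
  have d: "d k \<in> l2_space M" for k unfolding d_def[abs_def] by (intro l2_diff F)
  have dm[measurable]: "d k \<in> borel_measurable M" for k using d by (rule l2_measurable)
  have d_norm: "l2_norm M (d k) \<le> e k" for k
    unfolding d_def[abs_def] using N[OF r_Suc rN] by (simp add: less_imp_le)
  have "(\<integral>\<^sup>+x. (\<Sum>k. ennreal (4 ^ k * (d k x)\<^sup>2)) \<partial>M) = (\<Sum>k. \<integral>\<^sup>+x. ennreal (4 ^ k * (d k x)\<^sup>2) \<partial>M)"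
    by (rule nn_integral_suminf) measurable
  also have "\<dots> \<le> (\<Sum>k. ennreal ((1 / 2) ^ k))"
  proof (intro suminf_le)
    fix k :: nat
    have "(\<integral>\<^sup>+x. ennreal (4 ^ k * (d k x)\<^sup>2) \<partial>M) = ennreal (4 ^ k) * ennreal ((l2_norm M (d k))\<^sup>2)"
      by (subst l2_nn_integral[OF d, symmetric], subst nn_integral_cmult[symmetric]) (auto simp: ennreal_mult')
    also have "\<dots> = ennreal (4 ^ k * (l2_norm M (d k))\<^sup>2)" by (simp add: ennreal_mult')
    also have "\<dots> \<le> ennreal ((1 / 2) ^ k)"
    proof (rule ennreal_leI)
      have "(l2_norm M (d k))\<^sup>2 \<le> e k * e k"
        using d_norm[of k] l2_norm_nonneg[of "d k"] unfolding power2_eq_square by (intro mult_mono) (auto simp: e_def)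
      also have "\<dots> \<le> e k" by (simp add: e_def power_le_one mult_left_le)
      finally have "4 ^ k * (l2_norm M (d k))\<^sup>2 \<le> 4 ^ k * e k" by simp
      also have "\<dots> = (1 / 2) ^ k" by (simp add: e_def flip: power_mult_distrib)
      finally show "4 ^ k * (l2_norm M (d k))\<^sup>2 \<le> (1 / 2) ^ k" .
    qed
    finally show "(\<integral>\<^sup>+x. ennreal (4 ^ k * (d k x)\<^sup>2) \<partial>M) \<le> ennreal ((1 / 2) ^ k)" .
  qed auto
  also have "\<dots> = ennreal 2"
    by (rule suminf_ennreal_eq) (use geometric_sums[of "1/2 :: real"] in auto)
  finally have fin: "(\<integral>\<^sup>+x. (\<Sum>k. ennreal (4 ^ k * (d k x)\<^sup>2)) \<partial>M) \<noteq> \<infinity>"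
    by (metis ennreal_neq_top top.extremum_uniqueI infinity_ennreal_def)
  have AE_fin: "AE x in M. (\<Sum>k. ennreal (4 ^ k * (d k x)\<^sup>2)) \<noteq> \<infinity>"
    by (rule nn_integral_PInf_AE[OF _ fin]) measurable
  have conv: "convergent (\<lambda>k. F (r k) x)" if x: "(\<Sum>k. ennreal (4 ^ k * (d k x)\<^sup>2)) \<noteq> \<infinity>" for x
  proof -
    define Z where "Z = (\<Sum>k. ennreal (4 ^ k * (d k x)\<^sup>2))"
    obtain B where B: "Z = ennreal B" "B \<ge> 0"
      using x unfolding Z_def[symmetric] by (cases Z) auto
    have bound: "\<bar>d k x\<bar> \<le> sqrt B * (1 / 2) ^ k" for k
    proof -
      have "ennreal (4 ^ k * (d k x)\<^sup>2) \<le> Z"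
        unfolding Z_def by (rule order_trans[OF _ sum_le_suminf[of _ "{k}"]]) auto
      then have "4 ^ k * (d k x)\<^sup>2 \<le> B" using B by (simp add: ennreal_le_iff)
      moreover have "((2 :: real) ^ k)\<^sup>2 = 4 ^ k" by (simp add: power2_eq_square flip: power_mult_distrib)
      ultimately have "sqrt ((2 ^ k * d k x)\<^sup>2) \<le> sqrt B"
        by (intro real_sqrt_le_mono) (simp add: power_mult_distrib)
      then have "2 ^ k * \<bar>d k x\<bar> \<le> sqrt B" by (simp add: abs_mult)
      then show ?thesis by (simp add: power_divide pos_le_divide_eq mult.commute)
    qed
    have "summable (\<lambda>k. d k x)"
      by (rule summable_comparison_test'[of "\<lambda>k. sqrt B * (1 / 2) ^ k" 0])
         (use bound in \<open>auto intro!: summable_mult summable_geometric\<close>)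
    then have "(\<lambda>n. \<Sum>k<n. d k x) \<longlonglongrightarrow> (\<Sum>k. d k x)" by (rule summable_LIMSEQ)
    moreover have "(\<Sum>k<n. d k x) = F (r n) x - F (r 0) x" for n
      unfolding d_def by (rule sum_lessThan_telescope)
    ultimately have "(\<lambda>n. F (r n) x - F (r 0) x + F (r 0) x) \<longlonglongrightarrow> (\<Sum>k. d k x) + F (r 0) x"
      by (intro tendsto_add) auto
    then show ?thesis by (auto simp: convergent_def)
  qed
  define f where "f x = lim (\<lambda>k. F (r k) x)" for x
  have fm[measurable]: "f \<in> borel_measurable M" unfolding f_def[abs_def] by measurable
  have AE_lim: "AE x in M. (\<lambda>k. F (r k) x) \<longlonglongrightarrow> f x"
    using AE_fin by eventually_elim (use conv in \<open>auto simp: f_def convergent_LIMSEQ_iff\<close>)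
  \<comment> \<open>Fatou's lemma along the subsequence bounds the distance of every late
    \<open>F m\<close> to the limit, so the full sequence converges and not only the
    subsequence.\<close>
  have est: "(\<integral>\<^sup>+x. ennreal ((F m x - f x)\<^sup>2) \<partial>M) \<le> ennreal ((e k)\<^sup>2)" if m: "m \<ge> N k" for m k
  proof -
    have "(\<integral>\<^sup>+x. ennreal ((F m x - f x)\<^sup>2) \<partial>M) = (\<integral>\<^sup>+x. liminf (\<lambda>n. ennreal ((F m x - F (r n) x)\<^sup>2)) \<partial>M)"
    proof (rule nn_integral_cong_AE, use AE_lim in eventually_elim)
      fix x assume "(\<lambda>k. F (r k) x) \<longlonglongrightarrow> f x"
      then have "(\<lambda>n. ennreal ((F m x - F (r n) x)\<^sup>2)) \<longlonglongrightarrow> ennreal ((F m x - f x)\<^sup>2)"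
        by (intro tendsto_ennrealI tendsto_intros)
      then show "ennreal ((F m x - f x)\<^sup>2) = liminf (\<lambda>n. ennreal ((F m x - F (r n) x)\<^sup>2))"
        using lim_imp_Liminf[of sequentially] by (metis trivial_limit_sequentially)
    qed
    also have "\<dots> \<le> liminf (\<lambda>n. \<integral>\<^sup>+x. ennreal ((F m x - F (r n) x)\<^sup>2) \<partial>M)"
      by (rule nn_integral_liminf) measurable
    also have "\<dots> \<le> liminf (\<lambda>n. ennreal ((e k)\<^sup>2))"
    proof (rule Liminf_mono, rule eventually_sequentiallyI[of "N k"])
      fix n assume n: "N k \<le> n"
      have "l2_norm M (\<lambda>x. F m x - F (r n) x) < e k"
        by (rule N) (use m n r_ge[of n] in auto)
      then have "(l2_norm M (\<lambda>x. F m x - F (r n) x))\<^sup>2 \<le> (e k)\<^sup>2"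
        using l2_norm_nonneg by (intro power_mono) auto
      then show "(\<integral>\<^sup>+x. ennreal ((F m x - F (r n) x)\<^sup>2) \<partial>M) \<le> ennreal ((e k)\<^sup>2)"
        using l2_nn_integral[OF l2_diff[OF F F]] by (simp add: ennreal_leI)
    qed
    also have "\<dots> = ennreal ((e k)\<^sup>2)" by (simp add: Liminf_const)
    finally show ?thesis .
  qed
  have diff: "(\<lambda>x. F m x - f x) \<in> l2_space M" if "m \<ge> N k" for m k
    using est[OF that] unfolding l2_space_def
    by (auto intro!: integrableI_bounded simp: le_less_trans)
  have "f \<in> l2_space M"
    using l2_diff[OF F[of "N 0"] diff[of 0 "N 0"]] by simp
  moreover have "(\<lambda>n. l2_norm M (\<lambda>x. F n x - f x)) \<longlonglongrightarrow> 0"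
  proof (rule LIMSEQ_I)
    fix c :: real assume "c > 0"
    then obtain k where k: "e k < c" unfolding e_def using real_arch_pow_inv[of c "1/8"] by auto
    have "l2_norm M (\<lambda>x. F n x - f x) < c" if n: "n \<ge> N k" for n
    proof -
      have "ennreal ((l2_norm M (\<lambda>x. F n x - f x))\<^sup>2) \<le> ennreal ((e k)\<^sup>2)"
        using est[OF n] l2_nn_integral[OF diff[OF n]] by simp
      then have "(l2_norm M (\<lambda>x. F n x - f x))\<^sup>2 \<le> (e k)\<^sup>2" by (simp add: ennreal_le_iff)
      then show ?thesis using k e[of k] by (meson le_less_trans less_imp_le power2_le_imp_le)
    qed
    then show "\<exists>no. \<forall>n\<ge>no. norm (l2_norm M (\<lambda>x. F n x - f x) - 0) < c"
      using l2_norm_nonneg by (intro exI[of _ "N k"]) auto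
  qed
  ultimately show ?thesis by blast
qed

text \<open>The orthogonal projection of \<open>f\<close> onto the closure of the subspace
  \<open>S\<close>, with the closure represented by a sequence in \<open>S\<close>. A minimising
  sequence is Cauchy by the parallelogram law, and its limit \<open>k\<close> leaves an orthogonal
  remainder.\<close>

lemma l2_projection:
  assumes f: "f \<in> l2_space M" and S: "S \<subseteq> l2_space M" "S \<noteq> {}"
    and lin: "\<And>u v c. u \<in> S \<Longrightarrow> v \<in> S \<Longrightarrow> (\<lambda>x. u x + c * v x) \<in> S"
  shows "\<exists>s k. (\<forall>n::nat. s n \<in> S) \<and> k \<in> l2_space M \<and> (\<lambda>n. l2_norm M (\<lambda>x. s n x - k x)) \<longlonglongrightarrow> 0 \<and>
           (\<forall>u\<in>S. l2_inner M u (\<lambda>x. f x - k x) = 0)"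
proof -
  define D where "D = (\<lambda>u. (l2_norm M (\<lambda>x. f x - u x))\<^sup>2) ` S"
  define d where "d = Inf D"
  have D: "D \<noteq> {}" "bdd_below D" using S(2) by (auto simp: D_def intro: bdd_belowI[of _ 0])
  have d_le: "d \<le> (l2_norm M (\<lambda>x. f x - u x))\<^sup>2" if "u \<in> S" for u
    unfolding d_def by (rule cInf_lower[OF _ D(2)]) (use that in \<open>auto simp: D_def\<close>)
  have "\<exists>u\<in>S. (l2_norm M (\<lambda>x. f x - u x))\<^sup>2 < d + 1 / real (Suc n)" for n
    using cInf_lessD[OF D(1), of "d + 1 / real (Suc n)"] by (auto simp: d_def D_def)
  then obtain s where s: "\<And>n. s n \<in> S" "\<And>n. (l2_norm M (\<lambda>x. f x - s n x))\<^sup>2 < d + 1 / real (Suc n)"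
    by metis
  have sL: "s n \<in> l2_space M" for n using s(1) S(1) by blast
  \<comment> \<open>The midpoint of \<open>s m\<close> and \<open>s n\<close> lies in
    \<open>S\<close> and so has squared distance at least \<open>d\<close> from \<open>f\<close>. In
    the parallelogram identity this leaves only the excesses \<open>1 / Suc m\<close> and
    \<open>1 / Suc n\<close>.\<close>
  have par: "(l2_norm M (\<lambda>x. s m x - s n x))\<^sup>2 \<le> 2 / real (Suc m) + 2 / real (Suc n)" for m n
  proof -
    define a where "a x = f x - s m x" for x
    define b where "b x = f x - s n x" for x
    have ab: "a \<in> l2_space M" "b \<in> l2_space M" unfolding a_def[abs_def] b_def[abs_def] by (intro l2_diff f sL)+
    \<comment> \<open>The assumption on \<open>S\<close> scales only the second summand, hence
      \<open>s m\<close> is halved as \<open>s m - s m / 2\<close>.\<close>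
    have mid: "(\<lambda>x. (1/2) * s m x + (1/2) * s n x) \<in> S"
      using lin[OF lin[OF s(1)[of m] s(1)[of m], of "- (1/2)"] s(1)[of n], of "1/2"] by simp
    have eq: "(\<lambda>x. f x - ((1/2) * s m x + (1/2) * s n x)) = (\<lambda>x. (1/2) * (a x + b x))"
      by (auto simp: a_def b_def field_simps)
    have "d \<le> (l2_norm M (\<lambda>x. (1/2) * (a x + b x)))\<^sup>2" using d_le[OF mid] unfolding eq .
    also have "\<dots> = 1/4 * (l2_norm M (\<lambda>x. a x - (- 1) * b x))\<^sup>2"
      unfolding l2_norm_power2 by (simp add: l2_inner_scale l2_inner_commute[of _ "\<lambda>x. _ * (a x + b x)"] del: times_divide_eq_left times_divide_eq_right)
    finally have "4 * d \<le> (l2_norm M (\<lambda>x. a x - (- 1) * b x))\<^sup>2" by simp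
    moreover have "(l2_norm M (\<lambda>x. a x - 1 * b x))\<^sup>2 + (l2_norm M (\<lambda>x. a x - (- 1) * b x))\<^sup>2
        = 2 * (l2_norm M a)\<^sup>2 + 2 * (l2_norm M b)\<^sup>2"
      unfolding l2_norm_diff_scale[OF ab] by simp
    moreover have "l2_norm M (\<lambda>x. a x - 1 * b x) = l2_norm M (\<lambda>x. s m x - s n x)"
      by (subst l2_norm_minus_commute) (simp add: a_def b_def)
    moreover have "(l2_norm M a)\<^sup>2 < d + 1 / real (Suc m)" "(l2_norm M b)\<^sup>2 < d + 1 / real (Suc n)"
      using s(2) by (simp_all add: a_def[abs_def] b_def[abs_def])
    ultimately show ?thesis by simp
  qed
  have "\<exists>N. \<forall>m\<ge>N. \<forall>n\<ge>N. l2_norm M (\<lambda>x. s m x - s n x) < e" if e: "e > 0" for e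
  proof -
    obtain N where N: "N > 0" "inverse (real N) < e\<^sup>2 / 4"
      using ex_inverse_of_nat_less[of "e\<^sup>2 / 4"] e by auto
    have "l2_norm M (\<lambda>x. s m x - s n x) < e" if "m \<ge> N" "n \<ge> N" for m n
    proof -
      have "2 / real (Suc k) < 2 * (e\<^sup>2 / 4)" if "k \<ge> N" for k
      proof -
        have "1 / real (Suc k) \<le> inverse (real N)" using that N(1) by (simp add: field_simps)
        then show ?thesis using N(2) by simp
      qed
      from this[OF \<open>m \<ge> N\<close>] this[OF \<open>n \<ge> N\<close>] have "(l2_norm M (\<lambda>x. s m x - s n x))\<^sup>2 < e\<^sup>2"
        using par[of m n] by simp
      then show ?thesis using e by (simp add: power2_less_imp_less)
    qed
    then show ?thesis by blast
  qed
  then have "\<exists>k\<in>l2_space M. (\<lambda>n. l2_norm M (\<lambda>x. s n x - k x)) \<longlonglongrightarrow> 0"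
    by (rule l2_complete[OF sL])
  then obtain k where k: "k \<in> l2_space M" "(\<lambda>n. l2_norm M (\<lambda>x. s n x - k x)) \<longlonglongrightarrow> 0" ..
  have fk: "(\<lambda>x. f x - k x) \<in> l2_space M" by (intro l2_diff f k)
  have "l2_inner M (\<lambda>x. f x - k x) u = 0" if u: "u \<in> S" for u
  proof -
    have uL: "u \<in> l2_space M" using u S by blast
    \<comment> \<open>First variation: \<open>s n + t u\<close> competes with the infimum
      \<open>d\<close>. In the limit the constant term of the quadratic in \<open>t\<close> is zero,
      which forces its linear coefficient to vanish.\<close>
    have "0 \<le> 0 - 2 * t * l2_inner M (\<lambda>x. f x - k x) u + t\<^sup>2 * (l2_norm M u)\<^sup>2" for t
    proof -
      define w where "w n x = f x - s n x" for n x
      have w: "w n \<in> l2_space M" for n unfolding w_def[abs_def] by (intro l2_diff f sL)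
      have lim: "(\<lambda>n. l2_inner M (w n) u) \<longlonglongrightarrow> l2_inner M (\<lambda>x. f x - k x) u"
      proof (rule l2_inner_tendsto[OF w fk uL])
        show "(\<lambda>n. l2_norm M (\<lambda>x. w n x - (f x - k x))) \<longlonglongrightarrow> 0"
          using k(2) by (subst l2_norm_minus_commute) (simp add: w_def)
      qed
      have ineq: "0 \<le> 1 / real (Suc n) - 2 * t * l2_inner M (w n) u + t\<^sup>2 * (l2_norm M u)\<^sup>2" for n
      proof -
        have "d \<le> (l2_norm M (\<lambda>x. f x - (s n x + t * u x)))\<^sup>2" by (rule d_le[OF lin[OF s(1) u]])
        also have "(\<lambda>x. f x - (s n x + t * u x)) = (\<lambda>x. w n x - t * u x)" by (auto simp: w_def)
        finally show ?thesis using s(2)[of n] unfolding l2_norm_diff_scale[OF w uL] by (simp add: w_def[abs_def])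
      qed
      have "(\<lambda>n. 1 / real (Suc n) - 2 * t * l2_inner M (w n) u + t\<^sup>2 * (l2_norm M u)\<^sup>2)
          \<longlonglongrightarrow> 0 - 2 * t * l2_inner M (\<lambda>x. f x - k x) u + t\<^sup>2 * (l2_norm M u)\<^sup>2"
        using LIMSEQ_inverse_real_of_nat by (intro tendsto_intros lim) (simp add: inverse_eq_divide)
      then show ?thesis using ineq by (intro LIMSEQ_le_const) auto
    qed
    from discriminant_le[OF this] show ?thesis by simp
  qed
  then show ?thesis using s(1) k
    by (intro exI[of _ s] exI[of _ k] conjI allI ballI) (simp_all add: l2_inner_commute[of _ "\<lambda>x. f x - k x"])
qed

section \<open>Adjoints, closures and a criterion for essential self-adjointness\<close>

text \<open>Both sides of the defining identity are continuous along approximating pairs. Hence,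
  once the closure is self-adjoint, every element of the adjoint of \<open>A\<close> is itself a
  limit of elements of \<open>A\<close>.\<close>

lemma l2_adjoint_closure:
  assumes A: "A \<subseteq> l2_space M \<times> l2_space M" and fh: "(f, h) \<in> l2_adjoint M A"
  shows "(f, h) \<in> l2_adjoint M (l2_closure M A)"
proof -
  have L: "f \<in> l2_space M" "h \<in> l2_space M" using fh by (auto simp: l2_adjoint_def)
  have "l2_inner M v f = l2_inner M u h" if uv: "(u, v) \<in> l2_closure M A" for u v
  proof -
    obtain U V where UV: "\<And>n. (U n, V n) \<in> A" "(\<lambda>n. l2_norm M (\<lambda>x. U n x - u x)) \<longlonglongrightarrow> 0"
        "(\<lambda>n. l2_norm M (\<lambda>x. V n x - v x)) \<longlonglongrightarrow> 0" and uL: "u \<in> l2_space M" "v \<in> l2_space M"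
      using uv by (auto simp: l2_closure_def)
    have UL: "U n \<in> l2_space M" "V n \<in> l2_space M" for n using UV(1)[of n] A by auto
    have "l2_inner M (V n) f = l2_inner M (U n) h" for n
      using UV(1)[of n] fh by (auto simp: l2_adjoint_def)
    then show ?thesis
      using LIMSEQ_unique[OF l2_inner_tendsto[OF UL(2) uL(2) L(1) UV(3)]]
        l2_inner_tendsto[OF UL(1) uL(1) L(2) UV(2)] by simp
  qed
  then show ?thesis using L by (auto simp: l2_adjoint_def)
qed

text \<open>Why surjectivity settles the matter: if \<open>(f, h)\<close> is in the adjoint, pick
  \<open>w\<close> in the domain of the closure with the same image \<open>h\<close>. By symmetry
  \<open>f - w\<close> is orthogonal to the range, hence to everything, so \<open>f = w\<close>
  almost everywhere. The last two assumptions say that the ranges of \<open>A\<close> and of its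
  first projection have no nontrivial orthogonal complement.\<close>

lemma essentially_self_adjointI:
  assumes A: "A \<subseteq> l2_space M \<times> l2_space M" "A \<noteq> {}"
    and lin: "\<And>u v u' v' c. (u, v) \<in> A \<Longrightarrow> (u', v') \<in> A \<Longrightarrow> (\<lambda>x. u x + c * u' x, \<lambda>x. v x + c * v' x) \<in> A"
    and sym: "\<And>u v u' v'. (u, v) \<in> A \<Longrightarrow> (u', v') \<in> A \<Longrightarrow> l2_inner M v u' = l2_inner M u v'"
    and pos: "strictly_positive M A"
    and ker: "\<And>f. (f, \<lambda>_. 0) \<in> l2_adjoint M A \<Longrightarrow> AE x in M. f x = 0"
    and dense: "\<And>f. f \<in> l2_space M \<Longrightarrow> (\<And>u v. (u, v) \<in> A \<Longrightarrow> l2_inner M u f = 0) \<Longrightarrow> AE x in M. f x = 0"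
  shows "essentially_self_adjoint M A"
proof -
  have closure_L: "u \<in> l2_space M" "v \<in> l2_space M" if "(u, v) \<in> l2_closure M A" for u v
    using that by (auto simp: l2_closure_def)
  have surj: "\<exists>w. (w, h) \<in> l2_closure M A" if h: "h \<in> l2_space M" for h
  proof -
    have "\<exists>s k. (\<forall>n::nat. s n \<in> snd ` A) \<and> k \<in> l2_space M \<and> (\<lambda>n. l2_norm M (\<lambda>x. s n x - k x)) \<longlonglongrightarrow> 0 \<and>
           (\<forall>u\<in>snd ` A. l2_inner M u (\<lambda>x. h x - k x) = 0)"
    proof (rule l2_projection[OF h])
      fix u v c assume "u \<in> snd ` A" "v \<in> snd ` A"
      then obtain u' v' where "(u', u) \<in> A" "(v', v) \<in> A" by auto
      from lin[OF this, of c] show "(\<lambda>x. u x + c * v x) \<in> snd ` A" by force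
    qed (use A in auto)
    then obtain s k where s: "\<And>n::nat. s n \<in> snd ` A" and k: "k \<in> l2_space M"
        "(\<lambda>n. l2_norm M (\<lambda>x. s n x - k x)) \<longlonglongrightarrow> 0" "\<And>u. u \<in> snd ` A \<Longrightarrow> l2_inner M u (\<lambda>x. h x - k x) = 0"
      by blast
    have "\<forall>n. \<exists>u. (u, s n) \<in> A" using s by (metis imageE prod.collapse)
    then obtain U where U: "\<And>n. (U n, s n) \<in> A" by metis
    have UL: "U n \<in> l2_space M" and sL: "s n \<in> l2_space M" for n using U[of n] A by auto
    \<comment> \<open>The part of \<open>h\<close> not reached by limits of images is orthogonal to
      all images, that is, it lies in the kernel of the adjoint.\<close>
    have "(\<lambda>x. h x - k x, \<lambda>_. 0) \<in> l2_adjoint M A"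
      using k(3) by (force simp: l2_adjoint_def l2_0 l2_diff h k l2_inner_def)
    then have hk: "AE x in M. h x - k x = 0" by (rule ker)
    have s_lim: "(\<lambda>n. l2_norm M (\<lambda>x. s n x - h x)) \<longlonglongrightarrow> 0"
    proof -
      have "l2_norm M (\<lambda>x. s n x - h x) = l2_norm M (\<lambda>x. s n x - k x)" for n
        using hk by (intro l2_norm_cong_AE l2_measurable l2_diff sL h k) auto
      then show ?thesis using k(2) by simp
    qed
    obtain C where C: "C > 0" "\<And>u v. (u, v) \<in> A \<Longrightarrow> C * (l2_norm M u)\<^sup>2 \<le> l2_inner M v u"
      using pos by (auto simp: strictly_positive_def)
    \<comment> \<open>Strict positivity and Cauchy-Schwarz bound \<open>u\<close> by its image; by
      linearity, preimages of a Cauchy sequence are again Cauchy.\<close>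
    have bound: "l2_norm M u \<le> l2_norm M v / C" if uv: "(u, v) \<in> A" for u v
    proof (cases "l2_norm M u = 0")
      case False
      have "C * (l2_norm M u)\<^sup>2 \<le> l2_norm M v * l2_norm M u"
        using C(2)[OF uv] l2_Cauchy_Schwarz[of v u] uv A(1) by fastforce
      then have "C * l2_norm M u \<le> l2_norm M v"
        using False l2_norm_nonneg[of u] by (simp add: power2_eq_square mult.assoc[symmetric])
      then show ?thesis using C(1) by (simp add: field_simps)
    qed (use C(1) l2_norm_nonneg in auto)
    have "\<exists>N. \<forall>m\<ge>N. \<forall>n\<ge>N. l2_norm M (\<lambda>x. U m x - U n x) < e" if e: "e > 0" for e
    proof -
      have "e * C / 2 > 0" using e C by simp
      then obtain N where N: "\<And>n. n \<ge> N \<Longrightarrow> l2_norm M (\<lambda>x. s n x - h x) < e * C / 2"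
        using LIMSEQ_D[OF s_lim, of "e * C / 2"] by fastforce
      have "l2_norm M (\<lambda>x. U m x - U n x) < e" if mn: "m \<ge> N" "n \<ge> N" for m n
      proof -
        have "(\<lambda>x. U m x - U n x, \<lambda>x. s m x - s n x) \<in> A" using lin[OF U[of m] U[of n], of "- 1"] by simp
        from bound[OF this] have "l2_norm M (\<lambda>x. U m x - U n x) \<le> l2_norm M (\<lambda>x. s m x - s n x) / C" .
        also have "\<dots> \<le> (l2_norm M (\<lambda>x. s m x - h x) + l2_norm M (\<lambda>x. s n x - h x)) / C"
          using l2_norm_triangle_diff[OF sL[of m] h sL[of n]] l2_norm_minus_commute[of h "s n"] C(1)
          by (intro divide_right_mono) auto
        also have "\<dots> < (e * C / 2 + e * C / 2) / C"
          using C(1) N[OF mn(1)] N[OF mn(2)] by (intro divide_strict_right_mono add_strict_mono)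
        finally show ?thesis using C(1) by simp
      qed
      then show ?thesis by blast
    qed
    then have "\<exists>w\<in>l2_space M. (\<lambda>n. l2_norm M (\<lambda>x. U n x - w x)) \<longlonglongrightarrow> 0"
      by (rule l2_complete[OF UL])
    then obtain w where "w \<in> l2_space M" "(\<lambda>n. l2_norm M (\<lambda>x. U n x - w x)) \<longlonglongrightarrow> 0" ..
    then show ?thesis using U s_lim h by (auto simp: l2_closure_def)
  qed
  have dd: "densely_defined M (l2_closure M A)"
    unfolding densely_defined_def
  proof (intro ballI allI impI)
    fix f and e :: real assume f: "f \<in> l2_space M" and e: "e > 0"
    have "\<exists>s k. (\<forall>n::nat. s n \<in> fst ` A) \<and> k \<in> l2_space M \<and> (\<lambda>n. l2_norm M (\<lambda>x. s n x - k x)) \<longlonglongrightarrow> 0 \<and>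
           (\<forall>u\<in>fst ` A. l2_inner M u (\<lambda>x. f x - k x) = 0)"
    proof (rule l2_projection[OF f])
      fix u v c assume "u \<in> fst ` A" "v \<in> fst ` A"
      then obtain u' v' where "(u, u') \<in> A" "(v, v') \<in> A" by auto
      from lin[OF this, of c] show "(\<lambda>x. u x + c * v x) \<in> fst ` A" by force
    qed (use A in auto)
    then obtain s k where s: "\<And>n::nat. s n \<in> fst ` A" and k: "k \<in> l2_space M"
        "(\<lambda>n. l2_norm M (\<lambda>x. s n x - k x)) \<longlonglongrightarrow> 0" "\<And>u. u \<in> fst ` A \<Longrightarrow> l2_inner M u (\<lambda>x. f x - k x) = 0"
      by blast
    have sL: "s n \<in> l2_space M" for n using s[of n] A by auto
    have "AE x in M. f x - k x = 0"
      by (rule dense) (use k in \<open>force simp: l2_diff f\<close>)+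
    then have "l2_norm M (\<lambda>x. s n x - f x) = l2_norm M (\<lambda>x. s n x - k x)" for n
      by (intro l2_norm_cong_AE l2_measurable l2_diff sL f k) auto
    then obtain n where n: "l2_norm M (\<lambda>x. s n x - f x) < e"
      using LIMSEQ_D[OF k(2) e] l2_norm_nonneg by fastforce
    obtain v where v: "(s n, v) \<in> A" using s[of n] by auto
    \<comment> \<open>Constant sequences show that \<open>A\<close> is contained in its
      closure.\<close>
    have "(s n, v) \<in> l2_closure M A"
      unfolding l2_closure_def mem_Collect_eq prod.case using v sL[of n] subsetD[OF A(1) v]
      by (intro conjI exI[of _ "\<lambda>_. s n"] exI[of _ "\<lambda>_. v"]) (simp_all add: l2_norm_def l2_inner_def)
    then show "\<exists>u\<in>Domain (l2_closure M A). l2_norm M (\<lambda>x. u x - f x) < e" using n by blast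
  qed
  have sym1: "A \<subseteq> l2_adjoint M A" using A(1) sym by (fastforce simp: l2_adjoint_def)
  have sym2: "l2_inner M v f = l2_inner M u h" if "(u, v) \<in> A" "(f, h) \<in> l2_closure M A" for u v f h
  proof -
    have "(u, v) \<in> l2_adjoint M (l2_closure M A)" using l2_adjoint_closure[OF A(1)] sym1 that(1) by blast
    then show ?thesis using that(2) by (auto simp: l2_adjoint_def l2_inner_commute)
  qed
  have sym3: "l2_closure M A \<subseteq> l2_adjoint M (l2_closure M A)"
  proof
    fix p assume p: "p \<in> l2_closure M A"
    obtain f h where fh: "p = (f, h)" by force
    have "(f, h) \<in> l2_adjoint M A" using p fh sym2 closure_L by (auto simp: l2_adjoint_def)
    then show "p \<in> l2_adjoint M (l2_closure M A)" using l2_adjoint_closure[OF A(1)] fh by blast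
  qed
  moreover have "l2_adjoint M (l2_closure M A) \<subseteq> l2_closure M A"
  proof
    fix p assume p: "p \<in> l2_adjoint M (l2_closure M A)"
    obtain f h where fh: "p = (f, h)" by force
    have L: "f \<in> l2_space M" "h \<in> l2_space M" using p fh by (auto simp: l2_adjoint_def)
    obtain w where w: "(w, h) \<in> l2_closure M A" using surj[OF L(2)] by blast
    have wL: "w \<in> l2_space M" using closure_L w by blast
    define k where "k x = f x - w x" for x
    have kL: "k \<in> l2_space M" unfolding k_def[abs_def] by (intro l2_diff L wL)
    \<comment> \<open>Taking a preimage of \<open>k = f - w\<close> itself tests \<open>k\<close>
      against \<open>k\<close>.\<close>
    obtain z where z: "(z, k) \<in> l2_closure M A" using surj[OF kL] by blast
    have "l2_inner M k f = l2_inner M z h" using p fh z by (auto simp: l2_adjoint_def)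
    also have "\<dots> = l2_inner M k w"
      using sym3 w z by (force simp: l2_adjoint_def)
    finally have "l2_inner M f k = l2_inner M w k" by (simp add: l2_inner_commute)
    then have "l2_inner M (\<lambda>x. f x - w x) k = 0" by (simp add: l2_inner_diff L wL kL)
    moreover have "(\<lambda>x. f x - w x) = k" by (simp add: k_def fun_eq_iff)
    ultimately have "l2_inner M k k = 0" by simp
    then have "AE x in M. k x = 0" using l2_norm_eq_0[OF kL] by (simp add: l2_norm_def)
    then have "AE x in M. f x = w x" by (auto simp: k_def)
    \<comment> \<open>The functions \<open>f\<close> and \<open>w\<close> agree only almost
      everywhere, but the sequence approximating \<open>w\<close> approximates \<open>f\<close> just
      as well, so the pair \<open>(f, h)\<close> literally belongs to the closure.\<close>
    then have "l2_norm M (\<lambda>x. F x - f x) = l2_norm M (\<lambda>x. F x - w x)" if "F \<in> l2_space M" for F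
      using that by (intro l2_norm_cong_AE l2_measurable l2_diff L wL) auto
    moreover obtain U V where UV: "\<And>n. (U n, V n) \<in> A" "(\<lambda>n. l2_norm M (\<lambda>x. U n x - w x)) \<longlonglongrightarrow> 0"
        "(\<lambda>n. l2_norm M (\<lambda>x. V n x - h x)) \<longlonglongrightarrow> 0"
      using w by (auto simp: l2_closure_def)
    moreover have "U n \<in> l2_space M" for n using UV(1)[of n] A by auto
    ultimately have "(\<lambda>n. l2_norm M (\<lambda>x. U n x - f x)) \<longlonglongrightarrow> 0" by simp
    then show "p \<in> l2_closure M A" unfolding fh l2_closure_def using UV L by blast
  qed
  ultimately show ?thesis using dd by (auto simp: essentially_self_adjoint_def self_adjoint_def)
qed

end

section \<open>Charts and the Riemannian measure\<close>

lemma posdef_invertible: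
  fixes G :: "real ^ 'n::finite ^ 'n"
  assumes "\<And>v. v \<noteq> 0 \<Longrightarrow> 0 < v \<bullet> (G *v v)"
  shows "invertible G"
proof -
  have "\<forall>x. G *v x = 0 \<longrightarrow> x = 0" using assms by (metis inner_zero_right less_irrefl)
  then show ?thesis by (simp add: invertible_left_inverse matrix_left_invertible_ker)
qed

text \<open>The determinant does not vanish on the segment from the identity to \<open>G\<close>.\<close>

lemma posdef_det_pos:
  fixes G :: "real ^ 'n::finite ^ 'n"
  assumes "\<And>v. v \<noteq> 0 \<Longrightarrow> 0 < v \<bullet> (G *v v)"
  shows "0 < det G"
proof (rule ccontr)
  assume neg: "\<not> 0 < det G"
  define P where "P t = (1 - t) *\<^sub>R mat 1 + t *\<^sub>R G" for t :: real
  have "det (P t) \<noteq> 0" if t: "0 \<le> t" "t \<le> 1" for t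
  proof -
    have "0 < v \<bullet> (P t *v v)" if v: "v \<noteq> 0" for v
    proof -
      have "v \<bullet> (P t *v v) = (1 - t) * (v \<bullet> v) + t * (v \<bullet> (G *v v))"
        by (simp add: P_def matrix_vector_mult_add_rdistrib scaleR_matrix_vector_assoc[symmetric] inner_add_right)
      moreover have "0 < v \<bullet> v" using v by simp
      ultimately show ?thesis using assms[OF v] t
        by (cases "t = 0") (auto intro: add_nonneg_pos)
    qed
    then show ?thesis using posdef_invertible invertible_det_nz by blast
  qed
  moreover have "continuous_on {0..1} (\<lambda>t. det (P t))"
    unfolding det_def P_def by (intro continuous_intros)
  moreover have "det (P 0) = 1" "det (P 1) = det G" by (simp_all add: P_def)
  ultimately show False
    using IVT2'[of "\<lambda>t. det (P t)" 1 0 0] neg by force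
qed

lemma matrix_inv_right:
  fixes G :: "real ^ 'n::finite ^ 'n"
  assumes "invertible G"
  shows "G ** matrix_inv G = mat 1"
  using assms unfolding invertible_def matrix_inv_def by (metis (mono_tags, lifting) someI_ex)

text \<open>Exhibits the solution as a quotient of determinants, from which smooth dependence on the
  entries of \<open>G\<close> and \<open>b\<close> is immediate.\<close>

lemma matrix_inv_cramer:
  fixes G :: "real ^ 'n::finite ^ 'n"
  assumes "invertible G"
  shows "(matrix_inv G *v b) $ k = det (\<chi> i j. if j = k then b $ i else G $ i $ j) / det G"
proof -
  have "G *v (matrix_inv G *v b) = b"
    by (simp add: matrix_vector_mul_assoc matrix_inv_right[OF assms])
  then have "matrix_inv G *v b = (\<chi> k. det (\<chi> i j. if j = k then b $ i else G $ i $ j) / det G)"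
    using cramer[of G] assms invertible_det_nz by blast
  then show ?thesis by simp
qed

locale riemannian =
  fixes \<A> :: "('a::{t2_space, second_countable_topology}, 'n::finite) chart set"
    and g :: "('a, 'n) metric"
    and \<mu> :: "'a measure"
  assumes mfd: "riemannian_manifold \<A> g" and meas: "riemannian_measure \<A> g \<mu>"
begin

lemma atlas: "smooth_atlas \<A>" and metric: "riemannian_metric \<A> g"
  using mfd by (auto simp: riemannian_manifold_def)

lemma sets_mu [measurable_cong, simp]: "sets \<mu> = sets borel"
  using meas by (simp add: riemannian_measure_def)

lemma space_mu [simp]: "space \<mu> = UNIV"
  using sets_eq_imp_space_eq[OF sets_mu] by simp

lemma chart_cover: "\<exists>c\<in>\<A>. p \<in> chart_dom c"
  using atlas by (auto simp: smooth_atlas_def)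

context
  fixes c assumes c: "c \<in> \<A>"
begin

lemma chart: "is_chart c"
  using atlas c by (auto simp: smooth_atlas_def)

lemma chart_open: "open (chart_dom c)"
  using chart by (simp add: is_chart_def)

lemma chart_homeo: "homeomorphism (chart_dom c) (chart_img c) (chart_map c) (chart_inv c)"
  using chart by (simp add: is_chart_def)

lemma chart_coord_domain: "coord_domain (chart_img c)"
  using chart by (simp add: is_chart_def coord_domain_def)

lemma chart_inv_map [simp]: "p \<in> chart_dom c \<Longrightarrow> chart_inv c (chart_map c p) = p"
  and chart_map_inv [simp]: "x \<in> chart_img c \<Longrightarrow> chart_map c (chart_inv c x) = x"
  and chart_map_in [simp]: "p \<in> chart_dom c \<Longrightarrow> chart_map c p \<in> chart_img c"
  and chart_inv_in [simp]: "x \<in> chart_img c \<Longrightarrow> chart_inv c x \<in> chart_dom c"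
  and chart_map_cont: "continuous_on (chart_dom c) (chart_map c)"
  and chart_inv_cont: "continuous_on (chart_img c) (chart_inv c)"
  using chart_homeo by (auto simp: homeomorphism_def)

lemma chart_image_eq: "N \<subseteq> chart_dom c \<Longrightarrow> chart_map c ` N = chart_img c \<inter> chart_inv c -` N"
  by (force simp: image_iff)

lemma chart_image_openin: "open N \<Longrightarrow> openin (top_of_set (chart_img c)) (chart_map c ` (N \<inter> chart_dom c))"
  using openin_open_Int[of N "chart_dom c"]
  by (intro homeomorphism_imp_open_map[OF chart_homeo]) (simp add: Int_commute)

lemma chart_preimage_open:
  assumes "openin (top_of_set (chart_img c)) W"
  shows "open {p \<in> chart_dom c. chart_map c p \<in> W}"
proof -
  obtain T where T: "open T" "W = chart_img c \<inter> T" using assms by (auto simp: openin_open)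
  have "open (chart_dom c \<inter> chart_map c -` T)"
    using continuous_open_preimage[OF chart_map_cont chart_open T(1)] .
  moreover have "chart_dom c \<inter> chart_map c -` T = {p \<in> chart_dom c. chart_map c p \<in> W}"
    using T(2) by auto
  ultimately show ?thesis by simp
qed

lemma metric_sym: "x \<in> chart_img c \<Longrightarrow> transpose (g c x) = g c x"
  and metric_pos: "x \<in> chart_img c \<Longrightarrow> v \<noteq> 0 \<Longrightarrow> 0 < v \<bullet> (g c x *v v)"
  and metric_smooth: "smooth_on (chart_img c) (g c)"
  using metric c by (auto simp: riemannian_metric_def)

lemma metric_invertible: "x \<in> chart_img c \<Longrightarrow> invertible (g c x)"
  using posdef_invertible metric_pos by blast

lemma metric_det_pos: "x \<in> chart_img c \<Longrightarrow> 0 < det (g c x)"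
  using posdef_det_pos metric_pos by blast

lemma metric_entry_smooth: "smooth_on (chart_img c) (\<lambda>x. g c x $ i $ j)"
  by (rule smooth_on_bounded_linear[OF smooth_on_bounded_linear[OF metric_smooth]])
     (rule bounded_linear_vec_nth)+

lemma vol_pos: "x \<in> chart_img c \<Longrightarrow> 0 < vol_density g c x"
  using metric_det_pos by (simp add: vol_density_def)

lemma vol_smooth: "smooth_on (chart_img c) (vol_density g c)"
  unfolding vol_density_def[abs_def]
  by (intro smooth_on_sqrt smooth_on_det metric_entry_smooth metric_det_pos)

lemma vol_cont: "continuous_on (chart_img c) (vol_density g c)"
  using smooth_on_continuous_on[OF vol_smooth] .

lemma chart_img_borel [measurable]: "chart_img c \<in> sets borel"
  using coord_domain_borel chart_coord_domain by blast

lemma chart_dom_borel [measurable]: "chart_dom c \<in> sets borel"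
  using chart_open by simp

text \<open>The density of the measure in coordinates, extended by zero so that coordinate integrals
  run over all of \<open>lborel\<close>.\<close>

definition chart_weight :: "real ^ 'n \<Rightarrow> real" where
  "chart_weight x = indicator (chart_img c) x * vol_density g c x"

lemma chart_weight_measurable [measurable]: "chart_weight \<in> borel_measurable borel"
  unfolding chart_weight_def[abs_def]
  using borel_measurable_continuous_on_indicator[OF chart_img_borel vol_cont] by simp

lemma chart_weight_nonneg: "0 \<le> chart_weight x"
  using vol_pos[of x] by (auto simp: chart_weight_def indicator_def)

text \<open>Outside the chart image the values of \<open>chart_inv\<close> are uncontrolled. A
  constant value there gives a Borel function on the whole space, as \<open>distr\<close>
  requires.\<close>

definition chart_ext :: "real ^ 'n \<Rightarrow> 'a" where
  "chart_ext x = (if x \<in> chart_img c then chart_inv c x else undefined)"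

lemma chart_ext_measurable [measurable]: "chart_ext \<in> borel_measurable borel"
  unfolding chart_ext_def[abs_def]
  by (intro borel_measurable_continuous_on_if chart_inv_cont continuous_intros) measurable

text \<open>The formula that characterises the measure of sets, restated as an equality of measures.
  Nonnegative integrals, integrability and signed integrals all transfer from it.\<close>

lemma chart_measure_eq:
  "density \<mu> (\<lambda>p. ennreal (indicator (chart_dom c) p)) =
   distr (density lborel (\<lambda>x. ennreal (chart_weight x))) borel chart_ext"
proof (rule measure_eqI)
  fix B assume "B \<in> sets (density \<mu> (\<lambda>p. ennreal (indicator (chart_dom c) p)))"
  then have B[measurable]: "B \<in> sets borel" by simp
  have BD: "B \<inter> chart_dom c \<in> sets borel" by measurable
  have img: "chart_map c ` (B \<inter> chart_dom c) = chart_img c \<inter> chart_inv c -` (B \<inter> chart_dom c)"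
    by (rule chart_image_eq) auto
  have "emeasure (density \<mu> (\<lambda>p. ennreal (indicator (chart_dom c) p))) B = emeasure \<mu> (B \<inter> chart_dom c)"
    by (simp add: emeasure_density ennreal_indicator Int_commute flip: indicator_inter_arith)
  also have "\<dots> = (\<integral>\<^sup>+x\<in>chart_map c ` (B \<inter> chart_dom c). ennreal (vol_density g c x) \<partial>lborel)"
    using meas c BD by (auto simp: riemannian_measure_def)
  also have "\<dots> = (\<integral>\<^sup>+x. ennreal (chart_weight x) * indicator (chart_ext -` B) x \<partial>lborel)"
    by (rule nn_integral_cong) (auto simp: img chart_weight_def chart_ext_def indicator_def)
  also have "\<dots> = emeasure (distr (density lborel (\<lambda>x. ennreal (chart_weight x))) borel chart_ext) B"
    using measurable_sets[OF chart_ext_measurable B]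
    by (simp add: emeasure_distr emeasure_density)
  finally show "emeasure (density \<mu> (\<lambda>p. ennreal (indicator (chart_dom c) p))) B =
      emeasure (distr (density lborel (\<lambda>x. ennreal (chart_weight x))) borel chart_ext) B" .
qed simp

lemma chart_nn_integral:
  assumes [measurable]: "f \<in> borel_measurable borel"
  shows "(\<integral>\<^sup>+p. indicator (chart_dom c) p * f p \<partial>\<mu>) =
         (\<integral>\<^sup>+x. ennreal (chart_weight x) * f (chart_inv c x) \<partial>lborel)"
proof -
  have "(\<integral>\<^sup>+p. indicator (chart_dom c) p * f p \<partial>\<mu>)
      = integral\<^sup>N (density \<mu> (\<lambda>p. ennreal (indicator (chart_dom c) p))) f"
    by (subst nn_integral_density) (auto simp: ennreal_indicator)
  also have "\<dots> = (\<integral>\<^sup>+x. ennreal (chart_weight x) * f (chart_ext x) \<partial>lborel)"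
    unfolding chart_measure_eq by (simp add: nn_integral_distr nn_integral_density)
  also have "\<dots> = (\<integral>\<^sup>+x. ennreal (chart_weight x) * f (chart_inv c x) \<partial>lborel)"
    by (rule nn_integral_cong) (auto simp: chart_weight_def chart_ext_def)
  finally show ?thesis .
qed

lemma chart_integral:
  fixes f :: "'a \<Rightarrow> real"
  assumes f [measurable]: "f \<in> borel_measurable borel" and supp: "\<And>p. p \<notin> chart_dom c \<Longrightarrow> f p = 0"
  shows "integrable \<mu> f \<longleftrightarrow> integrable lborel (\<lambda>x. chart_weight x * f (chart_inv c x))"
    and "integral\<^sup>L \<mu> f = (\<integral>x. chart_weight x * f (chart_inv c x) \<partial>lborel)"
proof -
  have eq: "indicator (chart_dom c) p * f p = f p" for p using supp by (auto simp: indicator_def)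
  have eq2: "chart_weight x * f (chart_ext x) = chart_weight x * f (chart_inv c x)" for x
    by (auto simp: chart_weight_def chart_ext_def)
  have "integrable \<mu> f \<longleftrightarrow> integrable (density \<mu> (\<lambda>p. ennreal (indicator (chart_dom c) p))) f"
    by (subst integrable_density) (auto simp: eq)
  also have "\<dots> \<longleftrightarrow> integrable lborel (\<lambda>x. chart_weight x * f (chart_inv c x))"
    unfolding chart_measure_eq
    by (simp add: integrable_distr_eq integrable_density chart_weight_nonneg eq2)
  finally show "integrable \<mu> f \<longleftrightarrow> integrable lborel (\<lambda>x. chart_weight x * f (chart_inv c x))" .
  have "integral\<^sup>L \<mu> f = integral\<^sup>L (density \<mu> (\<lambda>p. ennreal (indicator (chart_dom c) p))) f"
    by (subst integral_density) (auto simp: eq)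
  also have "\<dots> = (\<integral>x. chart_weight x * f (chart_inv c x) \<partial>lborel)"
    unfolding chart_measure_eq
    by (simp add: integral_distr integral_density chart_weight_nonneg eq2)
  finally show "integral\<^sup>L \<mu> f = (\<integral>x. chart_weight x * f (chart_inv c x) \<partial>lborel)" .
qed

text \<open>At a boundary point the box sticks out of the half-space \<open>H\<close>; it is taken
  so small that \<open>H \<inter> cbox a b\<close> lies inside the image of \<open>N\<close>. As an
  intersection of closed convex sets, one of them bounded, \<open>K\<close> is compact and convex;
  segments between its points therefore stay in the chart.\<close>

lemma coord_box:
  assumes N: "open N" "p \<in> N" "p \<in> chart_dom c"
  obtains a b K where "chart_map c p \<in> box a b" "\<And>i. a $ i < b $ i" "compact K"
    "K \<subseteq> chart_map c ` (N \<inter> chart_dom c)" "chart_img c \<inter> cbox a b = K" "convex K"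
proof -
  obtain H where H: "H = UNIV \<or> (\<exists>i. H = half_space i)" "openin (top_of_set H) (chart_img c)"
    using coord_domainE[OF chart_coord_domain] by blast
  have "openin (top_of_set H) (chart_map c ` (N \<inter> chart_dom c))"
    using openin_trans[OF chart_image_openin[OF N(1)] H(2)] .
  then obtain T where T: "open T" "chart_map c ` (N \<inter> chart_dom c) = H \<inter> T" by (auto simp: openin_open)
  have x: "chart_map c p \<in> T" using T N by blast
  obtain a b where ab: "cbox a b \<subseteq> T" "chart_map c p \<in> box a b" "\<forall>i\<in>Basis. a \<bullet> i < b \<bullet> i"
    using open_contains_cbox[OF T(1) x] by blast
  have sub: "H \<inter> cbox a b \<subseteq> chart_map c ` (N \<inter> chart_dom c)" using ab(1) T(2) by blast
  show ?thesis
  proof (rule that[OF ab(2), of "H \<inter> cbox a b"])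
    show "a $ i < b $ i" for i using ab(3) by (auto simp: Basis_vec_def cart_eq_inner_axis)
    have "convex H" using H(1) convex_half_space by auto
    then show "convex (H \<inter> cbox a b)" by (intro convex_Int convex_box)
    have "closed H" using H(1) closed_half_space by auto
    then show "compact (H \<inter> cbox a b)" by (rule closed_Int_compact[OF _ compact_cbox])
    show "chart_img c \<inter> cbox a b = H \<inter> cbox a b"
      using sub openin_imp_subset[OF H(2)] by (auto simp: chart_img_def)
  qed (use sub in auto)
qed

end

section \<open>Local finiteness and compactly supported continuous functions\<close>

text \<open>The volume density is bounded on the compact part of a coordinate box, and the box has
  finite Lebesgue measure.\<close>

lemma finite_measure_nhd: "\<exists>N. open N \<and> p \<in> N \<and> emeasure \<mu> N < \<infinity>"
proof -
  obtain c where c: "c \<in> \<A>" "p \<in> chart_dom c" using chart_cover by blast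
  obtain a b K where ab: "chart_map c p \<in> box a b" "\<And>i. a $ i < b $ i" "compact K"
    "K \<subseteq> chart_map c ` (UNIV \<inter> chart_dom c)" "chart_img c \<inter> cbox a b = K" "convex K"
    using coord_box[OF c(1) open_UNIV UNIV_I c(2)] by blast
  define N where "N = {q \<in> chart_dom c. chart_map c q \<in> chart_img c \<inter> box a b}"
  have N: "open N" unfolding N_def
    by (rule chart_preimage_open[OF c(1)]) (rule openin_open_Int, rule open_box)
  have "bounded (vol_density g c ` K)"
    using compact_continuous_image[OF continuous_on_subset[OF vol_cont[OF c(1)]] ab(3)] ab(5)
    by (auto intro!: compact_imp_bounded)
  then obtain B where B: "\<And>x. x \<in> K \<Longrightarrow> \<bar>vol_density g c x\<bar> \<le> B" by (auto simp: bounded_iff)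
  have "emeasure \<mu> N = (\<integral>\<^sup>+x\<in>chart_map c ` N. ennreal (vol_density g c x) \<partial>lborel)"
    using meas c(1) N by (auto simp: riemannian_measure_def N_def)
  also have "\<dots> \<le> (\<integral>\<^sup>+x. ennreal B * indicator (cbox a b) x \<partial>lborel)"
  proof (rule nn_integral_mono)
    fix x
    have "vol_density g c x \<le> B" if "x \<in> chart_map c ` N"
      using B[of x] that ab(5) box_subset_cbox[of a b] by (force simp: N_def)
    then show "ennreal (vol_density g c x) * indicator (chart_map c ` N) x \<le> ennreal B * indicator (cbox a b) x"
      using box_subset_cbox[of a b] by (force simp: indicator_def N_def intro: ennreal_leI)
  qed
  also have "\<dots> = ennreal B * emeasure lborel (cbox a b)"
    by (rule nn_integral_cmult_indicator) simp
  also have "\<dots> < \<infinity>"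
    using emeasure_lborel_cbox_finite[of a b] by (auto simp: ennreal_mult_less_top)
  finally show ?thesis using N c(2) ab(1) c(1) by (intro exI[of _ N]) (auto simp: N_def)
qed

lemma compact_finite_measure:
  assumes "compact K"
  shows "emeasure \<mu> K < \<infinity>"
proof -
  obtain N where N: "\<And>p. open (N p)" "\<And>p. p \<in> N p" "\<And>p. emeasure \<mu> (N p) < \<infinity>"
    using finite_measure_nhd by metis
  obtain F where F: "F \<subseteq> K" "finite F" "K \<subseteq> (\<Union>p\<in>F. N p)"
    by (rule compactE_image[OF assms, of K N]) (use N in auto)
  have "emeasure \<mu> K \<le> emeasure \<mu> (\<Union>p\<in>F. N p)"
    using F N(1) by (intro emeasure_mono) auto
  also have "\<dots> \<le> (\<Sum>p\<in>F. emeasure \<mu> (N p))"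
    using F N(1) by (intro emeasure_subadditive_finite) auto
  also have "\<dots> < \<infinity>" using N(3) F(2) by simp
  finally show ?thesis .
qed

lemma integrable_continuous_compact:
  fixes f :: "'a \<Rightarrow> real"
  assumes f: "continuous_on UNIV f" and K: "compact K" "\<And>p. p \<notin> K \<Longrightarrow> f p = 0"
  shows "integrable \<mu> f"
proof -
  have "bounded (f ` K)"
    using compact_continuous_image[OF continuous_on_subset[OF f] K(1)] compact_imp_bounded by auto
  then obtain B where B: "\<And>x. x \<in> K \<Longrightarrow> \<bar>f x\<bar> \<le> B" by (auto simp: bounded_iff)
  have Kb[measurable]: "K \<in> sets borel" using K(1) compact_imp_closed borel_closed by blast
  have fb: "f \<in> borel_measurable borel" using f by (rule borel_measurable_continuous_onI)
  show ?thesis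
  proof (rule Bochner_Integration.integrable_bound[of _ "\<lambda>p. \<bar>B\<bar> * indicator K p"])
    show "integrable \<mu> (\<lambda>p. \<bar>B\<bar> * indicator K p)"
      by (intro integrable_mult_right integrable_real_indicator) (use compact_finite_measure[OF K(1)] in auto)
    show "AE p in \<mu>. norm (f p) \<le> norm (\<bar>B\<bar> * indicator K p)"
    proof (rule AE_I2)
      fix p show "norm (f p) \<le> norm (\<bar>B\<bar> * indicator K p)"
        using B[of p] K(2)[of p] by (cases "p \<in> K") auto
    qed
  qed (use fb in simp)
qed

lemma l2_continuous_compact:
  fixes f :: "'a \<Rightarrow> real"
  assumes "continuous_on UNIV f" "compact K" "\<And>p. p \<notin> K \<Longrightarrow> f p = 0"
  shows "f \<in> l2_space \<mu>"
  unfolding l2_space_def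
proof (intro CollectI conjI)
  show "f \<in> borel_measurable \<mu>"
    using borel_measurable_continuous_onI[OF assms(1)] by simp
  show "integrable \<mu> (\<lambda>x. (f x)\<^sup>2)"
    by (rule integrable_continuous_compact[OF _ assms(2)]) (use assms in \<open>auto intro!: continuous_intros\<close>)
qed

end

section \<open>Gradients and test functions\<close>

lemma inner_symmetric_matrix:
  fixes A :: "real ^ 'n::finite ^ 'n"
  assumes "transpose A = A"
  shows "(A *v x) \<bullet> y = x \<bullet> (A *v y)"
  using dot_lmul_matrix[of x A y] transpose_matrix_vector[of A x] assms by simp

lemma open_subset_half_space_pos:
  fixes S :: "(real ^ 'n::finite) set"
  assumes "open S" "S \<subseteq> half_space i" "x \<in> S"
  shows "0 < x $ i"
proof -
  obtain r where r: "r > 0" "ball x r \<subseteq> S" using assms(1,3) openE by blast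
  have "x - (r/2) *\<^sub>R axis i 1 \<in> ball x r" using r(1) by (simp add: dist_norm)
  then have "x - (r/2) *\<^sub>R axis i 1 \<in> half_space i" using r(2) assms(2) by blast
  then show ?thesis using r(1) by (simp add: half_space_def)
qed

context riemannian
begin

lemma smooth_funD: "smooth_fun \<A> u \<Longrightarrow> c \<in> \<A> \<Longrightarrow> smooth_on (chart_img c) (u \<circ> chart_inv c)"
  by (simp add: smooth_fun_def)

lemma smooth_fun_const: "smooth_fun \<A> (\<lambda>_. k)"
  by (simp add: smooth_fun_def o_def smooth_on_const)

lemma smooth_fun_add: "smooth_fun \<A> u \<Longrightarrow> smooth_fun \<A> v \<Longrightarrow> smooth_fun \<A> (\<lambda>p. u p + v p)"
  by (simp add: smooth_fun_def o_def smooth_on_add)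

lemma smooth_fun_mult: "smooth_fun \<A> u \<Longrightarrow> smooth_fun \<A> v \<Longrightarrow> smooth_fun \<A> (\<lambda>p. u p * v p)"
  by (simp add: smooth_fun_def o_def smooth_on_mult)

lemma smooth_fun_sum:
  "finite I \<Longrightarrow> (\<And>i. i \<in> I \<Longrightarrow> smooth_fun \<A> (u i)) \<Longrightarrow> smooth_fun \<A> (\<lambda>p. \<Sum>i\<in>I. u i p)"
  by (simp add: smooth_fun_def o_def smooth_on_sum)

lemma continuous_on_charts:
  fixes f :: "'a \<Rightarrow> real"
  assumes "\<And>c. c \<in> \<A> \<Longrightarrow> continuous_on (chart_img c) (f \<circ> chart_inv c)"
  shows "continuous_on UNIV f"
proof -
  have "continuous_on (\<Union>c\<in>\<A>. chart_dom c) f"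
  proof (rule continuous_on_open_UN)
    fix c assume c: "c \<in> \<A>"
    show "open (chart_dom c)" using chart_open[OF c] .
    have "continuous_on (chart_map c ` chart_dom c) (f \<circ> chart_inv c)"
      using assms[OF c] by (simp only: chart_img_def)
    then have "continuous_on (chart_dom c) ((f \<circ> chart_inv c) \<circ> chart_map c)"
      by (rule continuous_on_compose[OF chart_map_cont[OF c]])
    then show "continuous_on (chart_dom c) f"
      by (rule continuous_on_eq) (use c in auto)
  qed
  moreover have "(\<Union>c\<in>\<A>. chart_dom c) = UNIV" using chart_cover by blast
  ultimately show ?thesis by simp
qed

lemma smooth_fun_continuous: "smooth_fun \<A> u \<Longrightarrow> continuous_on UNIV u"
  by (rule continuous_on_charts) (use smooth_on_continuous_on smooth_funD in blast)

text \<open>The coordinates of the differential \<open>du\<close>. Unlike the gradient it does not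
  involve the metric, so it transforms by the chain rule alone.\<close>

definition dgrad :: "('a, 'n) chart \<Rightarrow> ('a \<Rightarrow> real) \<Rightarrow> real ^ 'n \<Rightarrow> real ^ 'n" where
  "dgrad c u x = (\<chi> j. partial_deriv c j (u \<circ> chart_inv c) x)"

text \<open>This is \<open>du (grad v)\<close>, the coordinate expression of
  \<open>g(grad u, grad v)\<close>.\<close>

definition gam :: "('a, 'n) chart \<Rightarrow> ('a \<Rightarrow> real) \<Rightarrow> ('a \<Rightarrow> real) \<Rightarrow> real ^ 'n \<Rightarrow> real" where
  "gam c u v x = dgrad c u x \<bullet> grad_in g c v x"

lemma grad_eq_dgrad: "grad_in g c u x = matrix_inv (g c x) *v dgrad c u x"
  by (simp add: grad_in_def dgrad_def)

context
  fixes c assumes c: "c \<in> \<A>"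
begin

lemma metric_grad: "x \<in> chart_img c \<Longrightarrow> g c x *v grad_in g c u x = dgrad c u x"
  by (simp add: grad_in_def dgrad_def matrix_vector_mul_assoc matrix_inv_right metric_invertible[OF c])

lemma gam_eq: "x \<in> chart_img c \<Longrightarrow> gam c u v x = grad_in g c u x \<bullet> (g c x *v grad_in g c v x)"
  unfolding gam_def metric_grad[symmetric] using metric_sym[OF c] by (simp add: inner_symmetric_matrix)

lemma gam_commute: "x \<in> chart_img c \<Longrightarrow> gam c u v x = gam c v u x"
  using inner_symmetric_matrix[OF metric_sym[OF c], of x "grad_in g c v x" "grad_in g c u x"]
  by (simp add: gam_eq inner_commute)

lemma gam_nonneg: "x \<in> chart_img c \<Longrightarrow> 0 \<le> gam c u u x"
  using metric_pos[OF c, of x "grad_in g c u x"]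
  by (cases "grad_in g c u x = 0") (auto simp: gam_eq)

text \<open>Cauchy-Schwarz for the inner product given by the metric at \<open>x\<close>, because
  \<open>dgrad c u x \<bullet> h\<close> is the inner product of the gradient with
  \<open>h\<close>.\<close>

lemma dgrad_le_gam:
  assumes x: "x \<in> chart_img c"
  shows "(dgrad c u x \<bullet> h)\<^sup>2 \<le> gam c u u x * (h \<bullet> (g c x *v h))"
proof (rule discriminant_le)
  fix t :: real
  let ?X = "grad_in g c u x"
  have "0 \<le> (?X - t *\<^sub>R h) \<bullet> (g c x *v (?X - t *\<^sub>R h))"
    using metric_pos[OF c x, of "?X - t *\<^sub>R h"] by (cases "?X - t *\<^sub>R h = 0") auto
  also have "\<dots> = ?X \<bullet> (g c x *v ?X) - t * (?X \<bullet> (g c x *v h)) - t * (h \<bullet> (g c x *v ?X)) + t\<^sup>2 * (h \<bullet> (g c x *v h))"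
    by (simp add: matrix_vector_mult_diff_distrib matrix_vector_mult_scaleR inner_diff_left inner_diff_right
        algebra_simps power2_eq_square)
  also have "?X \<bullet> (g c x *v h) = h \<bullet> (g c x *v ?X)"
    using inner_symmetric_matrix[OF metric_sym[OF c x], of ?X h] by (simp add: inner_commute)
  also have "h \<bullet> (g c x *v ?X) = dgrad c u x \<bullet> h" by (simp add: metric_grad[OF x] inner_commute)
  finally show "0 \<le> gam c u u x - 2 * t * (dgrad c u x \<bullet> h) + t\<^sup>2 * (h \<bullet> (g c x *v h))"
    by (simp add: gam_eq[OF x])
qed

lemma partial_smooth: "smooth_on (chart_img c) f \<Longrightarrow> smooth_on (chart_img c) (partial_deriv c j f)"
  unfolding partial_deriv_def[abs_def] by (rule smooth_on_derivative[OF chart_coord_domain[OF c]])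

lemma dgrad_smooth: "smooth_fun \<A> u \<Longrightarrow> smooth_on (chart_img c) (\<lambda>x. dgrad c u x $ j)"
  using partial_smooth smooth_funD[OF _ c] by (simp add: dgrad_def)

lemma grad_smooth:
  assumes u: "smooth_fun \<A> u"
  shows "smooth_on (chart_img c) (\<lambda>x. grad_in g c u x $ k)"
proof -
  have "smooth_on (chart_img c) (\<lambda>x. det (\<chi> i j. if j = k then dgrad c u x $ i else g c x $ i $ j) / det (g c x))"
  proof (intro smooth_on_divide smooth_on_det)
    fix i j
    show "smooth_on (chart_img c) (\<lambda>x. (\<chi> i j. if j = k then dgrad c u x $ i else g c x $ i $ j) $ i $ j)"
      using dgrad_smooth[OF u] metric_entry_smooth[OF c] by (cases "j = k") simp_all
    show "smooth_on (chart_img c) (\<lambda>x. g c x $ i $ j)" by (rule metric_entry_smooth[OF c])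
  qed (use metric_det_pos[OF c] in force)
  then show ?thesis
    by (rule smooth_on_cong) (simp add: grad_eq_dgrad matrix_inv_cramer metric_invertible[OF c])
qed

lemma gam_smooth:
  assumes "smooth_fun \<A> u" "smooth_fun \<A> v"
  shows "smooth_on (chart_img c) (gam c u v)"
  unfolding gam_def[abs_def] inner_vec_def inner_real_def
  by (intro smooth_on_sum smooth_on_mult dgrad_smooth grad_smooth assms) auto

lemma dgrad_inner:
  assumes "x \<in> chart_img c" "smooth_fun \<A> u"
  shows "frechet_derivative (u \<circ> chart_inv c) (at x within chart_img c) h = dgrad c u x \<bullet> h"
  by (rule trans[OF coord_domain_deriv_components[OF assms(1) smooth_funD[OF assms(2) c]]])
     (simp add: dgrad_def partial_deriv_def inner_vec_def mult.commute)

lemma dgrad_add: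
  assumes "x \<in> chart_img c" "smooth_fun \<A> u" "smooth_fun \<A> v"
  shows "dgrad c (\<lambda>p. u p + v p) x = dgrad c u x + dgrad c v x"
  using coord_domain_deriv_add[OF chart_coord_domain[OF c] assms(1) smooth_funD[OF assms(2) c] smooth_funD[OF assms(3) c]]
  by (simp add: dgrad_def partial_deriv_def vec_eq_iff o_def)

lemma dgrad_cmult:
  assumes "x \<in> chart_img c" "smooth_fun \<A> u"
  shows "dgrad c (\<lambda>p. k * u p) x = k *\<^sub>R dgrad c u x"
  using coord_domain_deriv_cmult[OF chart_coord_domain[OF c] assms(1) smooth_funD[OF assms(2) c]]
  by (simp add: dgrad_def partial_deriv_def vec_eq_iff o_def)

lemma dgrad_locally_0:
  assumes N: "open N" "\<And>p. p \<in> N \<Longrightarrow> u p = 0" and p: "p \<in> N" "p \<in> chart_dom c"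
  shows "dgrad c u (chart_map c p) = 0"
proof -
  have "frechet_derivative (u \<circ> chart_inv c) (at (chart_map c p) within chart_img c) v = 0" for v
    by (rule coord_domain_deriv_0[OF chart_coord_domain[OF c] chart_image_openin[OF c N(1)]])
       (use p c N(2) in auto)
  then show ?thesis by (simp add: dgrad_def partial_deriv_def vec_eq_iff)
qed

end

text \<open>\<open>D\<close> is the derivative of the coordinate change at \<open>p\<close>: the
  third claim is the tensor rule for the metric, the fourth the chain rule for differentials.
  Invertibility comes from the tensor rule: a vector in the kernel of \<open>D\<close> would have
  zero length in the chart \<open>c\<close>.\<close>

lemma transition_properties:
  assumes c: "c \<in> \<A>" and c': "c' \<in> \<A>" and p: "p \<in> chart_dom c" "p \<in> chart_dom c'"
  obtains D where "linear D" "surj D"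
    "g c (chart_map c p) = transpose (matrix D) ** g c' (chart_map c' p) ** matrix D"
    "\<And>u h. smooth_fun \<A> u \<Longrightarrow> dgrad c u (chart_map c p) \<bullet> h = dgrad c' u (chart_map c' p) \<bullet> D h"
proof -
  define x where "x = chart_map c p"
  define O' where "O' = overlap c c'"
  have O': "openin (top_of_set (chart_img c)) O'"
    using chart_image_openin[OF c chart_open[OF c']] by (simp add: O'_def overlap_def Int_commute)
  have xO: "x \<in> O'" using p by (auto simp: x_def O'_def overlap_def)
  have xV: "x \<in> chart_img c" using p(1) c by (simp add: x_def)
  have tx: "transition c c' x = chart_map c' p" using p c by (simp add: x_def transition_def)
  have "smooth_on O' (transition c c')" using atlas c c' by (auto simp: smooth_atlas_def O'_def)
  then obtain D where D: "(transition c c' has_derivative D) (at x within O')"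
    using smooth_on_has_derivative_ex xO by blast
  have lin: "linear D" using D has_derivative_linear by blast
  have gD: "g c x = transpose (matrix D) ** g c' (chart_map c' p) ** matrix D"
    using metric c c' xO D tx unfolding riemannian_metric_def O'_def by metis
  have tO: "transition c c' y \<in> chart_img c'" "(u \<circ> chart_inv c) y = (u \<circ> chart_inv c') (transition c c' y)"
    if "y \<in> O'" for y and u :: "'a \<Rightarrow> real"
    using that c c' by (auto simp: O'_def overlap_def transition_def)
  have chain: "dgrad c u x \<bullet> h = dgrad c' u (chart_map c' p) \<bullet> D h" if u: "smooth_fun \<A> u" for u h
  proof -
    let ?E = "frechet_derivative (u \<circ> chart_inv c') (at (chart_map c' p) within chart_img c')"
    have p'V: "chart_map c' p \<in> chart_img c'" using p(2) c' by simp
    have "(u \<circ> chart_inv c' has_derivative ?E) (at (transition c c' x) within chart_img c')"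
      unfolding tx by (rule smooth_on_has_derivative[OF smooth_funD[OF u c'] p'V])
    then have "(u \<circ> chart_inv c' has_derivative ?E) (at (transition c c' x) within transition c c' ` O')"
      by (rule has_derivative_subset) (use tO(1) in blast)
    from diff_chain_within[OF D this]
    have "((u \<circ> chart_inv c') \<circ> transition c c' has_derivative ?E \<circ> D) (at x within O')" .
    then have "(u \<circ> chart_inv c has_derivative ?E \<circ> D) (at x within O')"
      by (rule has_derivative_transform[OF xO, rotated]) (use tO(2) in simp)
    then have "(u \<circ> chart_inv c has_derivative ?E \<circ> D) (at x within chart_img c)"
      using at_within_openin[OF O' xO] by simp
    then have "frechet_derivative (u \<circ> chart_inv c) (at x within chart_img c) = ?E \<circ> D"
      by (rule coord_domain_frechet_derivative[OF chart_coord_domain[OF c] xV])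
    then show ?thesis
      using dgrad_inner[OF c xV u, of h] dgrad_inner[OF c' p'V u, of "D h"] by simp
  qed
  have "inj D"
    unfolding linear_injective_0[OF lin]
  proof (intro allI impI, rule ccontr)
    fix v assume v: "D v = 0" "v \<noteq> 0"
    have "g c x *v v = transpose (matrix D) *v (g c' (chart_map c' p) *v (matrix D *v v))"
      unfolding gD by (simp add: matrix_vector_mul_assoc matrix_mul_assoc)
    also have "matrix D *v v = 0" using v(1) matrix_works[of D] lin by (simp add: linear_matrix_vector_mul_eq)
    finally have "g c x *v v = 0" by simp
    then show False using metric_pos[OF c xV v(2)] by simp
  qed
  then have "surj D" using linear_injective_imp_surjective[OF lin] by blast
  then show ?thesis using that lin gD chain unfolding x_def by blast
qed

text \<open>The map \<open>D\<close> carries the gradient in \<open>c\<close> to the gradient in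
  \<open>c'\<close>, as both represent the same differential through metrics related by the tensor
  rule. Applying the differential of \<open>u\<close> to them gives the claim.\<close>

lemma gam_invariant:
  assumes c: "c \<in> \<A>" and c': "c' \<in> \<A>" and p: "p \<in> chart_dom c" "p \<in> chart_dom c'"
    and u: "smooth_fun \<A> u" and v: "smooth_fun \<A> v"
  shows "gam c u v (chart_map c p) = gam c' u v (chart_map c' p)"
proof -
  obtain D where D: "linear D" "surj D"
    "g c (chart_map c p) = transpose (matrix D) ** g c' (chart_map c' p) ** matrix D"
    "\<And>u h. smooth_fun \<A> u \<Longrightarrow> dgrad c u (chart_map c p) \<bullet> h = dgrad c' u (chart_map c' p) \<bullet> D h"
    using transition_properties[OF c c' p] by blast
  define X where "X = grad_in g c v (chart_map c p)"
  define X' where "X' = grad_in g c' v (chart_map c' p)"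
  define G' where "G' = g c' (chart_map c' p)"
  have xV: "chart_map c p \<in> chart_img c" and xV': "chart_map c' p \<in> chart_img c'"
    using c c' p by auto
  have mD: "matrix D *v h = D h" for h using D(1) by (simp add: matrix_works)
  \<comment> \<open>Surjectivity of \<open>D\<close> allows every test vector to be written as
    \<open>D h\<close>, where the two chain rules can be compared.\<close>
  have "(G' *v (D X) - G' *v X') \<bullet> w = 0" for w
  proof -
    obtain h where h: "w = D h" using D(2) by (metis surjD)
    have "dgrad c v (chart_map c p) \<bullet> h = (g c (chart_map c p) *v X) \<bullet> h"
      by (simp add: X_def metric_grad[OF c xV])
    also have "\<dots> = (transpose (matrix D) *v (G' *v (D X))) \<bullet> h"
      unfolding D(3) G'_def by (simp add: matrix_vector_mul_assoc mD[symmetric] matrix_mul_assoc)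
    also have "\<dots> = (G' *v (D X)) \<bullet> D h"
      by (simp add: transpose_matrix_vector dot_lmul_matrix mD)
    finally have "(G' *v (D X)) \<bullet> D h = dgrad c' v (chart_map c' p) \<bullet> D h" using D(4)[OF v] by simp
    also have "dgrad c' v (chart_map c' p) = G' *v X'" by (simp add: X'_def G'_def metric_grad[OF c' xV'])
    finally show ?thesis by (simp add: h inner_diff_left)
  qed
  then have "G' *v (D X) - G' *v X' = 0" by (metis inner_eq_zero_iff)
  then have "G' *v (D X) = G' *v X'" by simp
  then have "D X = X'"
    using inj_matrix_vector_mult[OF metric_invertible[OF c' xV']] by (simp add: G'_def inj_eq)
  then show ?thesis using D(4)[OF u, of X] by (simp add: gam_def X_def[symmetric] X'_def[symmetric])
qed

section \<open>Transporting coordinate functions to the manifold\<close>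

definition lift :: "('a, 'n) chart \<Rightarrow> (real ^ 'n \<Rightarrow> real) \<Rightarrow> 'a \<Rightarrow> real" where
  "lift c f p = (if p \<in> chart_dom c then f (chart_map c p) else 0)"

context
  fixes c and f :: "real ^ 'n \<Rightarrow> real" and K
  assumes c: "c \<in> \<A>" and f: "smooth_on (chart_img c) f"
    and K: "compact K" "K \<subseteq> chart_img c" "\<And>x. x \<in> chart_img c - K \<Longrightarrow> f x = 0"
begin

lemma compact_chart_inv_image: "compact (chart_inv c ` K)"
  by (rule compact_continuous_image[OF continuous_on_subset[OF chart_inv_cont[OF c] K(2)] K(1)])

lemma lift_eq_0: "p \<notin> chart_inv c ` K \<Longrightarrow> lift c f p = 0"
  using K c by (force simp: lift_def image_iff)

lemma supp_lift: "supp (lift c f) \<subseteq> chart_inv c ` K"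
  unfolding supp_def
  by (rule closure_minimal) (use lift_eq_0 compact_chart_inv_image compact_imp_closed in blast)+

lemma compact_supp_lift: "compact (supp (lift c f))"
proof -
  have "supp (lift c f) = chart_inv c ` K \<inter> supp (lift c f)" using supp_lift by blast
  then show ?thesis
    using compact_Int_closed[OF compact_chart_inv_image, of "supp (lift c f)"] by (simp add: supp_def)
qed

text \<open>At a point of the chart domain, the transition map reduces the claim to smoothness of
  \<open>f\<close>. At any other point the function vanishes nearby, since the image of
  \<open>K\<close> is compact and hence closed in a Hausdorff space.\<close>

lemma smooth_lift: "smooth_fun \<A> (lift c f)"
  unfolding smooth_fun_def
proof
  fix c' assume c': "c' \<in> \<A>"
  show "smooth_on (chart_img c') (lift c f \<circ> chart_inv c')"
  proof (rule smooth_on_local)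
    fix x assume x: "x \<in> chart_img c'"
    define p where "p = chart_inv c' x"
    have p: "p \<in> chart_dom c'" "chart_map c' p = x" using x c' by (auto simp: p_def)
    show "\<exists>U. open U \<and> x \<in> U \<and> smooth_on (chart_img c' \<inter> U) (lift c f \<circ> chart_inv c')"
    proof (cases "p \<in> chart_dom c")
      case True
      have "openin (top_of_set (chart_img c')) (chart_map c' ` (chart_dom c \<inter> chart_dom c'))"
        by (rule chart_image_openin[OF c' chart_open[OF c]])
      then obtain U where U: "open U" "chart_map c' ` (chart_dom c \<inter> chart_dom c') = chart_img c' \<inter> U"
        by (auto simp: openin_open)
      have ov: "overlap c' c = chart_img c' \<inter> U" using U(2) by (simp add: overlap_def Int_commute)
      have "smooth_on (chart_img c' \<inter> U) (\<lambda>y. f (transition c' c y))"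
      proof (rule smooth_on_compose[OF _ _ f])
        show "smooth_on (chart_img c' \<inter> U) (transition c' c)"
          using atlas c c' ov unfolding smooth_atlas_def by metis
        show "transition c' c y \<in> chart_img c" if "y \<in> chart_img c' \<inter> U" for y
          using that c c' unfolding ov[symmetric] by (auto simp: overlap_def transition_def)
      qed
      then have "smooth_on (chart_img c' \<inter> U) (lift c f \<circ> chart_inv c')"
        by (rule smooth_on_cong)
           (use c c' in \<open>auto simp: ov[symmetric] overlap_def transition_def lift_def\<close>)
      moreover have "x \<in> U" using U(2) p True by blast
      ultimately show ?thesis using U(1) by blast
    next
      case False
      then have pK: "p \<notin> chart_inv c ` K" using K(2) c by auto
      have op: "open (- (chart_inv c ` K))" using compact_chart_inv_image compact_imp_closed by blast
      obtain U where U: "open U" "chart_map c' ` (- (chart_inv c ` K) \<inter> chart_dom c') = chart_img c' \<inter> U"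
        using chart_image_openin[OF c' op] by (auto simp: openin_open)
      have "smooth_on (chart_img c' \<inter> U) (lift c f \<circ> chart_inv c')"
        by (rule smooth_on_cong[OF smooth_on_const[of _ 0]])
           (use c' lift_eq_0 in \<open>auto simp: U(2)[symmetric]\<close>)
      moreover have "x \<in> U" using U(2) p pK by blast
      ultimately show ?thesis using U(1) by blast
    qed
  qed
qed

end

text \<open>A box bump read in the chart. At a boundary point the box crosses the face of the
  half-space and the bump is positive there, so these functions also cover the boundary.\<close>

lemma bump_exists:
  assumes c: "c \<in> \<A>" and N: "open N" "p \<in> N" "p \<in> chart_dom c"
  obtains w where "smooth_fun \<A> w" "compact (supp w)" "supp w \<subseteq> N" "supp w \<subseteq> chart_dom c"
    "\<And>q. 0 \<le> w q" "0 < w p"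
proof -
  obtain a b K where ab: "chart_map c p \<in> box a b" "\<And>i. a $ i < b $ i" "compact K"
    "K \<subseteq> chart_map c ` (N \<inter> chart_dom c)" "chart_img c \<inter> cbox a b = K" "convex K"
    using coord_box[OF c N] by blast
  let ?f = "box_bump a b 1"
  have f: "smooth_on (chart_img c) ?f" by (rule Cinf_imp_smooth_on[OF open_UNIV Cinf_box_bump]) simp
  have K: "K \<subseteq> chart_img c" using ab(5) by blast
  have f0: "?f x = 0" if "x \<in> chart_img c - K" for x
    by (rule box_bump_eq_0) (use that ab(2,5) box_subset_cbox[of a b] in auto)
  have sub: "chart_inv c ` K \<subseteq> N \<inter> chart_dom c" using ab(4) c by force
  show ?thesis
  proof (rule that[of "lift c ?f"])
    show "smooth_fun \<A> (lift c ?f)" by (rule smooth_lift[OF c f ab(3) K f0])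
    show "compact (supp (lift c ?f))" by (rule compact_supp_lift[OF c f ab(3) K f0])
    show "supp (lift c ?f) \<subseteq> N" "supp (lift c ?f) \<subseteq> chart_dom c"
      using supp_lift[OF c f ab(3) K f0] sub by blast+
    show "0 \<le> lift c ?f q" for q by (simp add: lift_def box_bump_nonneg)
    show "0 < lift c ?f p" using N(3) ab(1) by (simp add: lift_def box_bump_pos)
  qed
qed

text \<open>This is invariance of domain for the transition map.\<close>

lemma interior_chart_change:
  assumes c: "c \<in> \<A>" and c': "c' \<in> \<A>" and p: "p \<in> chart_dom c" "p \<in> chart_dom c'"
    and int: "chart_map c p \<in> interior (chart_img c)"
    and half: "openin (top_of_set (half_space i)) (chart_img c')"
  shows "chart_map c' p $ i \<noteq> 0"
proof -
  obtain T where T: "open T" "chart_map c ` (chart_dom c' \<inter> chart_dom c) = chart_img c \<inter> T"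
    using chart_image_openin[OF c chart_open[OF c']] by (auto simp: openin_open)
  \<comment> \<open>Restricting to the interior makes \<open>W\<close> open in the full space, as
    invariance of domain requires.\<close>
  define W where "W = interior (chart_img c) \<inter> T"
  have W: "open W" using T(1) by (auto simp: W_def)
  have WO: "W \<subseteq> chart_map c ` (chart_dom c' \<inter> chart_dom c)"
    using T(2) interior_subset by (auto simp: W_def)
  have WV: "W \<subseteq> chart_img c" using interior_subset by (auto simp: W_def)
  have W': "chart_inv c ` W \<subseteq> chart_dom c'" using WO c by force
  have xW: "chart_map c p \<in> W" using int T(2) p by (auto simp: W_def)
  define \<tau> where "\<tau> = chart_map c' \<circ> chart_inv c"
  have "continuous_on W \<tau>"
    unfolding \<tau>_def using continuous_on_subset[OF chart_inv_cont[OF c] WV]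
      continuous_on_subset[OF chart_map_cont[OF c'] W'] by (rule continuous_on_compose)
  moreover have "inj_on \<tau> W"
  proof (rule inj_onI)
    fix x y assume xy: "x \<in> W" "y \<in> W" "\<tau> x = \<tau> y"
    then have "chart_inv c x \<in> chart_dom c'" "chart_inv c y \<in> chart_dom c'" using W' by auto
    then have "chart_inv c' (\<tau> x) = chart_inv c x" "chart_inv c' (\<tau> y) = chart_inv c y"
      by (simp_all add: \<tau>_def chart_inv_map[OF c'])
    then have "chart_inv c x = chart_inv c y" using xy by simp
    then show "x = y" using xy WV chart_map_inv[OF c] by (metis subsetD)
  qed
  ultimately have "open (\<tau> ` W)" using invariance_of_domain W by blast
  moreover have "\<tau> ` W \<subseteq> half_space i"
  proof -
    have "\<tau> ` W \<subseteq> chart_img c'" using W' c' by (auto simp: \<tau>_def)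
    then show ?thesis using openin_imp_subset[OF half] by blast
  qed
  moreover have "chart_map c' p \<in> \<tau> ` W" using xW p(1) c by (force simp: \<tau>_def)
  ultimately show ?thesis using open_subset_half_space_pos by fastforce
qed

section \<open>Chart independence of the Laplacian\<close>

lemma vol_grad_smooth:
  assumes c: "c \<in> \<A>" and v: "smooth_fun \<A> v"
  shows "smooth_on (chart_img c) (\<lambda>y. vol_density g c y * grad_in g c v y $ j)"
  by (intro smooth_on_mult vol_smooth[OF c] grad_smooth[OF c v])

text \<open>The Laplacian in a fixed chart, before it is known that the choice made in
  \<open>laplacian\<close> is immaterial.\<close>

definition lap :: "('a, 'n) chart \<Rightarrow> ('a \<Rightarrow> real) \<Rightarrow> real ^ 'n \<Rightarrow> real" where
  "lap c v x = - div_in g c (grad_in g c v) x"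

lemma lap_smooth:
  assumes c: "c \<in> \<A>" and v: "smooth_fun \<A> v"
  shows "smooth_on (chart_img c) (lap c v)"
  unfolding lap_def[abs_def] div_in_def
  by (intro smooth_on_minus smooth_on_divide smooth_on_sum partial_smooth[OF c] vol_grad_smooth[OF c v]
        vol_smooth[OF c] finite) (use vol_pos[OF c] in force)

lemma lap_cont: "c \<in> \<A> \<Longrightarrow> smooth_fun \<A> v \<Longrightarrow> continuous_on (chart_img c) (lap c v)"
  using lap_smooth smooth_on_continuous_on by blast

lemma gam_cont: "c \<in> \<A> \<Longrightarrow> smooth_fun \<A> u \<Longrightarrow> smooth_fun \<A> v \<Longrightarrow> continuous_on (chart_img c) (gam c u v)"
  using gam_smooth smooth_on_continuous_on by blast

text \<open>The field \<open>sqrt (det g) * w * grad v\<close> has integral of its coordinate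
  divergence equal to zero, and the product rule splits that divergence into the two integrands; the
  density cancels the denominator of \<open>div_in\<close>. The disjunction in the boundary
  assumption serves two uses: \<open>v\<close> satisfying the Neumann condition, and test functions
  supported away from the boundary.\<close>

lemma green_coordinates:
  assumes c: "c \<in> \<A>" and v: "smooth_fun \<A> v" and w: "smooth_fun \<A> w"
    and K: "compact K" "K \<subseteq> chart_dom c" "\<And>p. p \<notin> K \<Longrightarrow> w p = 0"
    and bd: "\<And>i x. openin (top_of_set (half_space i)) (chart_img c) \<Longrightarrow> x \<in> chart_img c \<Longrightarrow> x $ i = 0 \<Longrightarrow>
               w (chart_inv c x) = 0 \<or> grad_in g c v x $ i = 0"
  shows "(\<integral>x. chart_weight c x * (w (chart_inv c x) * lap c v x) \<partial>lborel) =
         (\<integral>x. chart_weight c x * gam c w v x \<partial>lborel)"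
proof -
  let ?V = "chart_img c"
  define K' where "K' = chart_map c ` K"
  have K': "compact K'" "K' \<subseteq> ?V"
    using compact_continuous_image[OF continuous_on_subset[OF chart_map_cont[OF c] K(2)] K(1)] K(2)
    by (auto simp: K'_def chart_img_def)
  have w0: "w (chart_inv c x) = 0" if "x \<in> ?V - K'" for x
    using that K(3) c by (force simp: K'_def)
  define W where "W = w \<circ> chart_inv c"
  define X where "X j y = vol_density g c y * grad_in g c v y $ j" for j y
  have Ws: "smooth_on ?V W" unfolding W_def by (rule smooth_funD[OF w c])
  have Xs: "smooth_on ?V (X j)" for j unfolding X_def[abs_def] by (rule vol_grad_smooth[OF c v])
  have integr: "integrable lborel (\<lambda>x. chart_weight c x * h x)"
    if h: "continuous_on ?V h" "\<And>x. x \<in> ?V - K' \<Longrightarrow> h x = 0" for h :: "real ^ 'n \<Rightarrow> real"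
  proof -
    have "continuous_on K' (\<lambda>x. vol_density g c x * h x)"
      using K'(2) by (intro continuous_intros continuous_on_subset[OF h(1)] continuous_on_subset[OF vol_cont[OF c]])
    from borel_integrable_compact[OF K'(1) this]
    have "integrable lborel (\<lambda>x. indicator K' x *\<^sub>R (vol_density g c x * h x))" .
    moreover have eq: "indicator K' x *\<^sub>R (vol_density g c x * h x) = chart_weight c x * h x" for x
      using h(2)[of x] K'(2) by (auto simp: chart_weight_def[OF c] indicator_def)
    ultimately show ?thesis unfolding eq by simp
  qed
  have gam0: "gam c w v x = 0" if x: "x \<in> ?V - K'" for x
  proof -
    have "dgrad c w (chart_map c (chart_inv c x)) = 0"
      by (rule dgrad_locally_0[OF c, of "- K"]) (use x K c compact_imp_closed in \<open>force simp: K'_def\<close>)+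
    then show ?thesis using x c by (simp add: gam_def)
  qed
  have int1: "integrable lborel (\<lambda>x. chart_weight c x * (W x * lap c v x))"
    by (rule integr) (use w0 in \<open>auto simp: W_def intro!: continuous_intros lap_cont c v
          smooth_on_continuous_on[OF Ws[unfolded W_def o_def]]\<close>)
  have int2: "integrable lborel (\<lambda>x. chart_weight c x * gam c w v x)"
    by (rule integr[OF gam_cont[OF c w v] gam0])
  have zero: "(\<integral>x. indicator ?V x * partial_deriv c j (\<lambda>y. W y * X j y) x \<partial>lborel) = 0" for j
    unfolding partial_deriv_def
  proof (rule integral_derivative_eq_0[OF chart_coord_domain[OF c] _ K'])
    show "smooth_on ?V (\<lambda>y. W y * X j y)" by (intro smooth_on_mult Ws Xs)
    show "W x * X j x = 0" if "x \<in> ?V - K'" for x using w0[OF that] by (simp add: W_def)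
    show "W x * X j x = 0" if "openin (top_of_set (half_space j)) ?V" "x \<in> ?V" "x $ j = 0" for x
      using bd[OF that] by (auto simp: W_def X_def)
  qed
  have ptw: "(\<Sum>j\<in>UNIV. indicator ?V x * partial_deriv c j (\<lambda>y. W y * X j y) x) =
      chart_weight c x * gam c w v x - chart_weight c x * (W x * lap c v x)" for x
  proof (cases "x \<in> ?V")
    case True
    have "partial_deriv c j (\<lambda>y. W y * X j y) x = W x * partial_deriv c j (X j) x + partial_deriv c j W x * X j x" for j
      unfolding partial_deriv_def by (rule coord_domain_deriv_mult[OF chart_coord_domain[OF c] True Ws Xs])
    then have "(\<Sum>j\<in>UNIV. partial_deriv c j (\<lambda>y. W y * X j y) x) =
        W x * (\<Sum>j\<in>UNIV. partial_deriv c j (X j) x) + (\<Sum>j\<in>UNIV. partial_deriv c j W x * X j x)"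
      by (simp add: sum.distrib sum_distrib_left)
    also have "(\<Sum>j\<in>UNIV. partial_deriv c j (X j) x) = - (vol_density g c x * lap c v x)"
      using vol_pos[OF c True] by (simp add: lap_def div_in_def X_def[abs_def])
    also have "(\<Sum>j\<in>UNIV. partial_deriv c j W x * X j x) = vol_density g c x * gam c w v x"
      by (simp add: gam_def dgrad_def inner_vec_def W_def X_def sum_distrib_left algebra_simps)
    finally show ?thesis using True
      by (simp add: chart_weight_def[OF c] sum_distrib_left[symmetric] algebra_simps)
  qed (simp add: chart_weight_def[OF c])
  have int3: "integrable lborel (\<lambda>x. indicator ?V x * partial_deriv c j (\<lambda>y. W y * X j y) x)" for j
  proof -
    have sm: "smooth_on ?V (partial_deriv c j (\<lambda>y. W y * X j y))"
      by (intro partial_smooth[OF c] smooth_on_mult Ws Xs)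
    have "partial_deriv c j (\<lambda>y. W y * X j y) x = 0" if x: "x \<in> ?V - K'" for x
      unfolding partial_deriv_def
      by (rule coord_domain_deriv_0[OF chart_coord_domain[OF c], of "?V - K'"])
         (use x w0 openin_open_Int[OF open_Compl[OF compact_imp_closed[OF K'(1)]], of ?V] in \<open>auto simp: W_def Diff_eq\<close>)
    then have eq: "indicator K' x *\<^sub>R partial_deriv c j (\<lambda>y. W y * X j y) x =
        indicator ?V x * partial_deriv c j (\<lambda>y. W y * X j y) x" for x
      using K'(2) by (auto simp: indicator_def)
    have "integrable lborel (\<lambda>x. indicator K' x *\<^sub>R partial_deriv c j (\<lambda>y. W y * X j y) x)"
      by (rule borel_integrable_compact[OF K'(1) continuous_on_subset[OF smooth_on_continuous_on[OF sm] K'(2)]])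
    then show ?thesis unfolding eq .
  qed
  have "(\<integral>x. chart_weight c x * gam c w v x \<partial>lborel) - (\<integral>x. chart_weight c x * (W x * lap c v x) \<partial>lborel)
      = (\<integral>x. (\<Sum>j\<in>UNIV. indicator ?V x * partial_deriv c j (\<lambda>y. W y * X j y) x) \<partial>lborel)"
    unfolding ptw by (rule Bochner_Integration.integral_diff[symmetric, OF int2 int1])
  also have "\<dots> = (\<Sum>j\<in>UNIV. \<integral>x. indicator ?V x * partial_deriv c j (\<lambda>y. W y * X j y) x \<partial>lborel)"
    by (rule Bochner_Integration.integral_sum) (rule int3)
  also have "\<dots> = 0" by (simp only: zero sum.neutral_const)
  finally show ?thesis by (simp add: W_def)
qed

lemma lift_measurable:
  assumes c: "c \<in> \<A>" and h: "continuous_on (chart_img c) h"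
  shows "lift c h \<in> borel_measurable borel"
proof -
  have "continuous_on (chart_dom c) (h \<circ> chart_map c)"
    using continuous_on_compose[OF chart_map_cont[OF c]] h by (simp add: chart_img_def)
  from borel_measurable_continuous_on_indicator[OF chart_dom_borel[OF c] this]
  have "(\<lambda>p. indicator (chart_dom c) p *\<^sub>R (h \<circ> chart_map c) p) \<in> borel_measurable borel" .
  moreover have "(\<lambda>p. indicator (chart_dom c) p *\<^sub>R (h \<circ> chart_map c) p) = lift c h"
    by (auto simp: lift_def)
  ultimately show ?thesis by simp
qed

lemma lift_integral:
  assumes c: "c \<in> \<A>" and h: "continuous_on (chart_img c) h"
  shows "integral\<^sup>L \<mu> (lift c h) = (\<integral>x. chart_weight c x * h x \<partial>lborel)"
proof -
  have "integral\<^sup>L \<mu> (lift c h) = (\<integral>x. chart_weight c x * lift c h (chart_inv c x) \<partial>lborel)"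
    by (rule chart_integral(2)[OF c lift_measurable[OF c h]]) (simp add: lift_def)
  also have "\<dots> = (\<integral>x. chart_weight c x * h x \<partial>lborel)"
    by (rule Bochner_Integration.integral_cong) (use c in \<open>auto simp: chart_weight_def lift_def indicator_def\<close>)
  finally show ?thesis .
qed

text \<open>Formulated with \<open>lift c (lap c v)\<close> instead of \<open>laplacian\<close>,
  because it is used to show that the latter has this expression in every chart.\<close>

lemma green_chart:
  assumes c: "c \<in> \<A>" and v: "smooth_fun \<A> v" and w: "smooth_fun \<A> w"
    and K: "compact K" "K \<subseteq> chart_dom c" "\<And>p. p \<notin> K \<Longrightarrow> w p = 0"
    and bd: "\<And>i x. openin (top_of_set (half_space i)) (chart_img c) \<Longrightarrow> x \<in> chart_img c \<Longrightarrow> x $ i = 0 \<Longrightarrow>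
               w (chart_inv c x) = 0 \<or> grad_in g c v x $ i = 0"
  shows "(\<integral>p. w p * lift c (lap c v) p \<partial>\<mu>) = (\<integral>p. lift c (gam c w v) p \<partial>\<mu>)"
proof -
  have 1: "(\<lambda>p. w p * lift c (lap c v) p) = lift c (\<lambda>x. w (chart_inv c x) * lap c v x)"
    using c by (auto simp: lift_def)
  have 2: "continuous_on (chart_img c) (\<lambda>x. w (chart_inv c x) * lap c v x)"
    using smooth_on_continuous_on[OF smooth_funD[OF w c]] by (intro continuous_intros lap_cont c v) (simp add: o_def)
  show ?thesis
    unfolding 1 lift_integral[OF c 2] lift_integral[OF c gam_cont[OF c w v]]
    by (rule green_coordinates[OF assms])
qed

text \<open>In a chart the set becomes relatively open, so it contains a genuine open set of
  coordinates if nonempty, and the volume density is positive there.\<close>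

lemma open_null_set_empty:
  assumes N: "open N" "emeasure \<mu> N = 0"
  shows "N = {}"
proof (rule ccontr)
  assume "N \<noteq> {}"
  then obtain p where p: "p \<in> N" by blast
  obtain c where c: "c \<in> \<A>" "p \<in> chart_dom c" using chart_cover by blast
  let ?W = "chart_map c ` (N \<inter> chart_dom c)"
  have W: "openin (top_of_set (chart_img c)) ?W" by (rule chart_image_openin[OF c(1) N(1)])
  have WV: "?W \<subseteq> chart_img c" using openin_imp_subset[OF W] .
  have [measurable]: "?W \<in> sets borel"
    using coord_domain_borel[OF coord_domain_openin[OF chart_coord_domain[OF c(1)] W]] .
  have "(\<integral>\<^sup>+x. ennreal (chart_weight c x) * indicator ?W x \<partial>lborel) = (\<integral>\<^sup>+x\<in>?W. ennreal (vol_density g c x) \<partial>lborel)"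
    by (rule nn_integral_cong) (use WV in \<open>auto simp: chart_weight_def[OF c(1)] indicator_def\<close>)
  also have "\<dots> = emeasure \<mu> (N \<inter> chart_dom c)"
    using meas c N chart_open[OF c(1)] by (auto simp: riemannian_measure_def)
  also have "\<dots> \<le> emeasure \<mu> N" using N by (intro emeasure_mono) auto
  finally have "(\<integral>\<^sup>+x. ennreal (chart_weight c x) * indicator ?W x \<partial>lborel) = 0" using N(2) by simp
  moreover have "(\<lambda>x. ennreal (chart_weight c x) * indicator ?W x) \<in> borel_measurable lborel"
    using chart_weight_measurable[OF c(1)] by measurable
  ultimately have "AE x in lborel. ennreal (chart_weight c x) * indicator ?W x = 0"
    by (simp add: nn_integral_0_iff_AE)
  then have "AE x in lborel. x \<notin> interior ?W"
  proof eventually_elim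
    fix x assume x: "ennreal (chart_weight c x) * indicator ?W x = 0"
    show "x \<notin> interior ?W"
    proof
      assume "x \<in> interior ?W"
      then have "x \<in> ?W" using interior_subset by blast
      then show False using x WV vol_pos[OF c(1), of x] by (auto simp: chart_weight_def[OF c(1)])
    qed
  qed
  then have "interior ?W \<in> null_sets lborel"
    by (simp add: AE_iff_null_sets[symmetric] borel_open)
  then have "negligible (interior ?W)"
    by (simp add: negligible_iff_null_sets null_sets_completionI)
  moreover have "interior ?W \<noteq> {}"
    by (rule coord_domain_interior_nonempty[OF chart_coord_domain[OF c(1)] W]) (use p c in blast)
  ultimately show False using open_not_negligible by blast
qed

text \<open>Otherwise the part of \<open>N\<close> where \<open>f\<close> is positive would be a
  nonempty open null set. Continuity is asked on \<open>N\<close> only, as the intended integrand is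
  a product whose second factor is meaningful just on a chart overlap.\<close>

lemma integral_continuous_eq_0:
  fixes f :: "'a \<Rightarrow> real"
  assumes f: "integrable \<mu> f" "\<And>p. 0 \<le> f p" "integral\<^sup>L \<mu> f = 0"
    and N: "open N" "continuous_on N f" "p \<in> N"
  shows "f p = 0"
proof (rule ccontr)
  assume "f p \<noteq> 0"
  then have fp: "f p > 0" using f(2)[of p] by simp
  have "AE q in \<mu>. f q = 0" using integral_nonneg_eq_0_iff_AE[OF f(1)] f by simp
  then have "AE q in \<mu>. q \<notin> N \<inter> f -` {0<..}" by eventually_elim auto
  moreover have op: "open (N \<inter> f -` {0<..})" using continuous_open_preimage[OF N(2,1)] by simp
  ultimately have "N \<inter> f -` {0<..} \<in> null_sets \<mu>"
    using AE_iff_null_sets[of "N \<inter> f -` {0<..}" \<mu>] by simp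
  then have "N \<inter> f -` {0<..} = {}" using open_null_set_empty[OF op] by auto
  then show False using fp N(3) by auto
qed

lemma closed_supp: "closed (supp w)"
  by (simp add: supp_def)

lemma supp_eq_0: "p \<notin> supp w \<Longrightarrow> w p = 0"
  using closure_subset[of "{p. w p \<noteq> 0}"] unfolding supp_def by blast

lemma gam_0_outside_supp:
  assumes c: "c \<in> \<A>" and p: "p \<in> chart_dom c" "p \<notin> supp w"
  shows "gam c w v (chart_map c p) = 0"
proof -
  have "dgrad c w (chart_map c p) = 0"
    by (rule dgrad_locally_0[OF c open_Compl[OF closed_supp]]) (use p supp_eq_0 in auto)
  then show ?thesis by (simp add: gam_def)
qed

text \<open>Both coordinate expressions satisfy Green's formula against test functions supported in the
  interior of the overlap, and the right-hand side does not depend on the chart.\<close>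

lemma lap_le:
  assumes c: "c \<in> \<A>" and c': "c' \<in> \<A>" and p: "p \<in> chart_dom c" "p \<in> chart_dom c'"
    and v: "smooth_fun \<A> v"
  shows "lap c v (chart_map c p) \<le> lap c' v (chart_map c' p)"
proof (rule ccontr)
  assume neg: "\<not> lap c v (chart_map c p) \<le> lap c' v (chart_map c' p)"
  define d where "d q = lap c v (chart_map c q) - lap c' v (chart_map c' q)" for q
  define U where "U = chart_dom c \<inter> chart_dom c'"
  have U: "open U" unfolding U_def by (rule open_Int[OF chart_open[OF c] chart_open[OF c']])
  have comp: "continuous_on (chart_dom k) (\<lambda>q. lap k v (chart_map k q))" if k: "k \<in> \<A>" for k
    using continuous_on_compose[OF chart_map_cont[OF k], of "lap k v"] lap_cont[OF k v]
    by (simp add: chart_img_def o_def)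
  have dcont: "continuous_on U d"
    unfolding d_def U_def by (intro continuous_intros continuous_on_subset[OF comp] c c') auto
  define N where "N = U \<inter> d -` {0<..}"
  have N: "open N" unfolding N_def using continuous_open_preimage[OF dcont U] by simp
  have pN: "p \<in> N" using neg p by (auto simp: N_def U_def d_def)
  have op: "openin (top_of_set (chart_img c)) (chart_map c ` (N \<inter> chart_dom c))"
    by (rule chart_image_openin[OF c N])
  have "interior (chart_map c ` (N \<inter> chart_dom c)) \<noteq> {}"
    by (rule coord_domain_interior_nonempty[OF chart_coord_domain[OF c] op]) (use pN p in blast)
  \<comment> \<open>The point \<open>p\<close> may lie on the boundary. The strict inequality
    persists on the open set \<open>N\<close>, so the argument moves to a nearby point
    \<open>q\<close> with interior coordinates.\<close>
  then obtain x where x: "x \<in> interior (chart_map c ` (N \<inter> chart_dom c))" by blast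
  then obtain q where q: "q \<in> N" "q \<in> chart_dom c" "x = chart_map c q" using interior_subset by blast
  have qint: "chart_map c q \<in> interior (chart_img c)"
    using x q(3) interior_mono[OF openin_imp_subset[OF op]] by blast
  \<comment> \<open>Test functions supported in \<open>N2\<close> vanish at boundary points in every
    chart by \<open>interior_chart_change\<close>, so Green's formula holds for \<open>v\<close>
    without a Neumann condition.\<close>
  define N2 where "N2 = N \<inter> {r \<in> chart_dom c. chart_map c r \<in> interior (chart_img c)}"
  have "openin (top_of_set (chart_img c)) (interior (chart_img c))"
    using openin_open_Int[of "interior (chart_img c)" "chart_img c"] interior_subset[of "chart_img c"]
    by (simp add: Int_absorb1)
  then have N2: "open N2" unfolding N2_def using N chart_preimage_open[OF c] by blast
  have qN2: "q \<in> N2" using q qint by (auto simp: N2_def)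
  obtain w where w: "smooth_fun \<A> w" "compact (supp w)" "supp w \<subseteq> N2" "supp w \<subseteq> chart_dom c"
    "\<And>r. 0 \<le> w r" "0 < w q"
    using bump_exists[OF c N2 qN2 q(2)] by blast
  note w0 = supp_eq_0[of _ w]
  have green: "(\<integral>r. w r * lift k (lap k v) r \<partial>\<mu>) = (\<integral>r. lift k (gam k w v) r \<partial>\<mu>)"
    if k: "k \<in> \<A>" "supp w \<subseteq> chart_dom k" for k
  proof (rule green_chart[OF k(1) v w(1) w(2) k(2) w0])
    fix i x assume i: "openin (top_of_set (half_space i)) (chart_img k)" "x \<in> chart_img k" "x $ i = 0"
    have "chart_inv k x \<notin> supp w"
    proof
      assume s: "chart_inv k x \<in> supp w"
      then have "chart_map c (chart_inv k x) \<in> interior (chart_img c)" "chart_inv k x \<in> chart_dom c"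
        using w(3) by (auto simp: N2_def)
      from interior_chart_change[OF c k(1) this(2) _ this(1) i(1)] show False
        using i k by simp
    qed
    then show "w (chart_inv k x) = 0 \<or> grad_in g k v x $ i = 0" using w0 by blast
  qed
  have s': "supp w \<subseteq> chart_dom c'" using w(3) by (auto simp: N2_def N_def U_def)
  have geq: "lift c (gam c w v) r = lift c' (gam c' w v) r" for r
  proof (cases "r \<in> supp w")
    case True
    then have "r \<in> chart_dom c" "r \<in> chart_dom c'" using w(4) s' by auto
    then show ?thesis using gam_invariant[OF c c' _ _ w(1) v] by (simp add: lift_def)
  next
    case False
    then show ?thesis using gam_0_outside_supp c c' by (simp add: lift_def)
  qed
  have wl_int: "integrable \<mu> (\<lambda>r. w r * lift k (lap k v) r)" if k: "k \<in> \<A>" "supp w \<subseteq> chart_dom k" for k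
  proof (rule integrable_continuous_compact[OF _ w(2)])
    \<comment> \<open>The product is continuous on the chart domain and zero off the support of
      \<open>w\<close>; these two open sets cover the manifold.\<close>
    have "continuous_on (\<Union>b\<in>{True, False}. if b then chart_dom k else - supp w) (\<lambda>r. w r * lift k (lap k v) r)"
    proof (rule continuous_on_open_UN)
      fix b assume "b \<in> {True, False}"
      show "open (if b then chart_dom k else - supp w)" using chart_open[OF k(1)] by (auto simp: supp_def)
      have "continuous_on (chart_dom k) (\<lambda>r. w r * lap k v (chart_map k r))"
        by (intro continuous_intros comp k(1) continuous_on_subset[OF smooth_fun_continuous[OF w(1)]]) auto
      then have 1: "continuous_on (chart_dom k) (\<lambda>r. w r * lift k (lap k v) r)"
        by (rule continuous_on_eq) (auto simp: lift_def)
      have 2: "continuous_on (- supp w) (\<lambda>r. w r * lift k (lap k v) r)"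
        by (rule continuous_on_eq[OF continuous_on_const[of _ 0]]) (use w0 in auto)
      show "continuous_on (if b then chart_dom k else - supp w) (\<lambda>r. w r * lift k (lap k v) r)"
        using 1 2 by auto
    qed
    moreover have "(\<Union>b\<in>{True, False}. if b then chart_dom k else - supp w) = UNIV" using k(2) by auto
    ultimately show "continuous_on UNIV (\<lambda>r. w r * lift k (lap k v) r)" by simp
  qed (use w0 in auto)
  have eq: "w r * lift c (lap c v) r - w r * lift c' (lap c' v) r = w r * d r" for r
  proof (cases "r \<in> supp w")
    case True
    then show ?thesis using w(4) s' by (auto simp: lift_def d_def right_diff_distrib)
  qed (simp add: w0)
  have int: "integrable \<mu> (\<lambda>r. w r * d r)"
    using Bochner_Integration.integrable_diff[OF wl_int[OF c w(4)] wl_int[OF c' s']] unfolding eq .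
  have "(\<integral>r. w r * d r \<partial>\<mu>) = (\<integral>r. w r * lift c (lap c v) r \<partial>\<mu>) - (\<integral>r. w r * lift c' (lap c' v) r \<partial>\<mu>)"
    using Bochner_Integration.integral_diff[OF wl_int[OF c w(4)] wl_int[OF c' s']] unfolding eq .
  also have "\<dots> = 0" using green[OF c w(4)] green[OF c' s'] geq by simp
  finally have zero: "(\<integral>r. w r * d r \<partial>\<mu>) = 0" .
  have nonneg: "0 \<le> w r * d r" for r
  proof (cases "r \<in> supp w")
    case True
    then have "d r > 0" using w(3) by (auto simp: N2_def N_def)
    then show ?thesis using w(5)[of r] by simp
  qed (simp add: w0)
  have "continuous_on U (\<lambda>r. w r * d r)"
    by (intro continuous_intros dcont continuous_on_subset[OF smooth_fun_continuous[OF w(1)]]) auto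
  then have "w q * d q = 0"
    by (rule integral_continuous_eq_0[where f = "\<lambda>r. w r * d r", OF int nonneg zero U])
       (use q in \<open>auto simp: N_def\<close>)
  moreover have "d q > 0" using q(1) by (auto simp: N_def)
  ultimately show False using w(6) by simp
qed

text \<open>Exchanging the roles of the two charts turns the one-sided comparison into equality with
  the expression in the selected chart.\<close>

lemma laplacian_eq:
  assumes c: "c \<in> \<A>" and p: "p \<in> chart_dom c" and v: "smooth_fun \<A> v"
  shows "laplacian \<A> g v p = lap c v (chart_map c p)"
proof -
  define c' where "c' = (SOME c. c \<in> \<A> \<and> p \<in> chart_dom c)"
  have c': "c' \<in> \<A> \<and> p \<in> chart_dom c'"
    unfolding c'_def by (rule someI[of _ c]) (use c p in blast)
  have "laplacian \<A> g v p = lap c' v (chart_map c' p)"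
    by (simp add: laplacian_def lap_def Let_def c'_def)
  then show ?thesis using lap_le[OF c] lap_le[of c'] c' c p v by (simp add: order_antisym)
qed

section \<open>Green's formula\<close>

text \<open>The carre du champ \<open>g(grad u, grad v)\<close> as a function on the manifold. For
  smooth arguments \<open>gam_invariant\<close> makes the chosen chart irrelevant.\<close>

definition carre :: "('a \<Rightarrow> real) \<Rightarrow> ('a \<Rightarrow> real) \<Rightarrow> 'a \<Rightarrow> real" where
  "carre u v p = (let c = (SOME c. c \<in> \<A> \<and> p \<in> chart_dom c) in gam c u v (chart_map c p))"

lemma carre_eq:
  assumes c: "c \<in> \<A>" and p: "p \<in> chart_dom c" and u: "smooth_fun \<A> u" and v: "smooth_fun \<A> v"
  shows "carre u v p = gam c u v (chart_map c p)"
proof -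
  define c' where "c' = (SOME c. c \<in> \<A> \<and> p \<in> chart_dom c)"
  have "c' \<in> \<A> \<and> p \<in> chart_dom c'"
    unfolding c'_def by (rule someI[of _ c]) (use c p in blast)
  then show ?thesis using gam_invariant[OF c _ p _ u v, of c'] by (simp add: carre_def Let_def c'_def)
qed

lemma carre_cont:
  assumes u: "smooth_fun \<A> u" and v: "smooth_fun \<A> v"
  shows "continuous_on UNIV (carre u v)"
proof (rule continuous_on_charts)
  fix c assume c: "c \<in> \<A>"
  show "continuous_on (chart_img c) (carre u v \<circ> chart_inv c)"
    by (rule continuous_on_eq[OF gam_cont[OF c u v]]) (use c in \<open>simp add: carre_eq u v\<close>)
qed

lemma laplacian_cont:
  assumes v: "smooth_fun \<A> v"
  shows "continuous_on UNIV (laplacian \<A> g v)"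
proof (rule continuous_on_charts)
  fix c assume c: "c \<in> \<A>"
  show "continuous_on (chart_img c) (laplacian \<A> g v \<circ> chart_inv c)"
    by (rule continuous_on_eq[OF lap_cont[OF c v]]) (use c in \<open>simp add: laplacian_eq v\<close>)
qed

lemma carre_commute:
  assumes "smooth_fun \<A> u" "smooth_fun \<A> v"
  shows "carre u v p = carre v u p"
proof -
  obtain c where c: "c \<in> \<A>" "p \<in> chart_dom c" using chart_cover by blast
  then show ?thesis using gam_commute[OF c(1)] assms by (simp add: carre_eq[of c])
qed

lemma carre_nonneg:
  assumes "smooth_fun \<A> u"
  shows "0 \<le> carre u u p"
proof -
  obtain c where c: "c \<in> \<A>" "p \<in> chart_dom c" using chart_cover by blast
  then show ?thesis using gam_nonneg[OF c(1)] assms by (simp add: carre_eq[of c])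
qed

lemma carre_add:
  assumes "smooth_fun \<A> u" "smooth_fun \<A> u'" "smooth_fun \<A> v"
  shows "carre (\<lambda>q. u q + u' q) v p = carre u v p + carre u' v p"
proof -
  obtain c where c: "c \<in> \<A>" "p \<in> chart_dom c" using chart_cover by blast
  then show ?thesis using assms
    by (simp add: carre_eq[of c] smooth_fun_add gam_def dgrad_add[OF c(1)] inner_add_left)
qed

lemma carre_supp:
  assumes "smooth_fun \<A> u" "smooth_fun \<A> v" "p \<notin> supp u"
  shows "carre u v p = 0"
proof -
  obtain c where c: "c \<in> \<A>" "p \<in> chart_dom c" using chart_cover by blast
  then show ?thesis using assms gam_0_outside_supp[OF c] by (simp add: carre_eq[of c])
qed

lemma carre_sum:
  assumes "finite I" "\<And>i. i \<in> I \<Longrightarrow> smooth_fun \<A> (w i)" and v: "smooth_fun \<A> v"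
  shows "carre (\<lambda>q. \<Sum>i\<in>I. w i q) v p = (\<Sum>i\<in>I. carre (w i) v p)"
  using assms(1,2)
proof (induction I rule: finite_induct)
  case empty
  have "carre (\<lambda>_. 0) v p = 0"
    by (rule carre_supp[OF smooth_fun_const v]) (simp add: supp_def)
  then show ?case by simp
next
  case (insert i I)
  have "carre (\<lambda>q. w i q + (\<Sum>i\<in>I. w i q)) v p = carre (w i) v p + carre (\<lambda>q. \<Sum>i\<in>I. w i q) v p"
    by (rule carre_add[OF _ _ v]) (use insert in \<open>auto intro!: smooth_fun_sum\<close>)
  then show ?case using insert by simp
qed

text \<open>The outward unit normal is the negative normalized gradient of the \<open>i\<close>-th coordinate.\<close>

lemma neumann_grad_eq_0:
  assumes c: "c \<in> \<A>" and v: "smooth_fun \<A> v" "neumann \<A> g v"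
    and half: "openin (top_of_set (half_space i)) (chart_img c)" and x: "x \<in> chart_img c" "x $ i = 0"
  shows "grad_in g c v x $ i = 0"
proof -
  define y where "y = matrix_inv (g c x) *v axis i 1"
  have Gy: "g c x *v y = axis i 1"
    by (simp add: y_def matrix_vector_mul_assoc matrix_inv_right metric_invertible[OF c x(1)])
  have y0: "y \<noteq> 0" using Gy by (auto simp: axis_eq_0_iff)
  \<comment> \<open>The component \<open>y $ i\<close> is also the squared length of
    \<open>y\<close>, which explains the normalising factor in \<open>\<nu>\<close>.\<close>
  have yi: "y $ i = y \<bullet> (g c x *v y)" by (simp add: Gy inner_axis)
  have pos: "0 < y $ i" unfolding yi by (rule metric_pos[OF c x(1) y0])
  define \<nu> where "\<nu> = (- (1 / sqrt (y $ i))) *\<^sub>R y"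
  have G\<nu>: "g c x *v \<nu> = (- (1 / sqrt (y $ i))) *\<^sub>R axis i 1"
    by (simp add: \<nu>_def matrix_vector_mult_scaleR Gy del: scaleR_minus_left)
  have "outward_unit_normal g c i x \<nu>"
    unfolding outward_unit_normal_def
  proof (intro conjI allI impI)
    fix w :: "real ^ 'n" assume "w $ i = 0"
    then show "w \<bullet> (g c x *v \<nu>) = 0" unfolding G\<nu> by (simp add: inner_axis)
  next
    show "\<nu> \<bullet> (g c x *v \<nu>) = 1" unfolding G\<nu> using pos by (simp add: \<nu>_def inner_axis)
    show "\<nu> $ i < 0" using pos by (simp add: \<nu>_def)
  qed
  then have "frechet_derivative (v \<circ> chart_inv c) (at x within chart_img c) \<nu> = 0"
    using v(2) c half x unfolding neumann_def by blast
  then have "dgrad c v x \<bullet> \<nu> = 0" using dgrad_inner[OF c x(1) v(1)] by simp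
  then have "dgrad c v x \<bullet> y = 0" using pos by (simp add: \<nu>_def)
  moreover have "dgrad c v x \<bullet> y = grad_in g c v x \<bullet> (g c x *v y)"
    unfolding metric_grad[OF c x(1), symmetric] by (rule inner_symmetric_matrix[OF metric_sym[OF c x(1)]])
  ultimately show ?thesis by (simp add: Gy inner_axis)
qed

lemma green_one_chart:
  assumes c: "c \<in> \<A>" and v: "smooth_fun \<A> v" "neumann \<A> g v" and w: "smooth_fun \<A> w"
    and s: "compact (supp w)" "supp w \<subseteq> chart_dom c"
  shows "(\<integral>p. w p * laplacian \<A> g v p \<partial>\<mu>) = (\<integral>p. carre w v p \<partial>\<mu>)"
proof -
  have "(\<integral>p. w p * lift c (lap c v) p \<partial>\<mu>) = (\<integral>p. lift c (gam c w v) p \<partial>\<mu>)"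
    by (rule green_chart[OF c v(1) w s]) (use supp_eq_0 neumann_grad_eq_0[OF c v] in auto)
  moreover have "w p * lift c (lap c v) p = w p * laplacian \<A> g v p" for p
  proof (cases "p \<in> supp w")
    case True
    then show ?thesis using s(2) laplacian_eq[OF c _ v(1)] by (auto simp: lift_def)
  qed (simp add: supp_eq_0)
  moreover have "lift c (gam c w v) p = carre w v p" for p
  proof (cases "p \<in> chart_dom c")
    case True
    then show ?thesis by (simp add: lift_def carre_eq[OF c _ w v(1)])
  next
    case False
    then have "p \<notin> supp w" using s(2) by blast
    then show ?thesis using False by (simp add: lift_def carre_supp w v)
  qed
  ultimately show ?thesis by simp
qed

section \<open>Partition of unity and the global Green formula\<close>

lemma smooth_fun_local:
  assumes "\<And>c p. c \<in> \<A> \<Longrightarrow> p \<in> chart_dom c \<Longrightarrow>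
      \<exists>N. open N \<and> p \<in> N \<and> smooth_on (chart_map c ` (N \<inter> chart_dom c)) (u \<circ> chart_inv c)"
  shows "smooth_fun \<A> u"
  unfolding smooth_fun_def
proof (intro ballI smooth_on_local)
  fix c x assume c: "c \<in> \<A>" and x: "x \<in> chart_img c"
  obtain N where N: "open N" "chart_inv c x \<in> N" "smooth_on (chart_map c ` (N \<inter> chart_dom c)) (u \<circ> chart_inv c)"
    using assms[OF c, of "chart_inv c x"] x c by auto
  obtain T where T: "open T" "chart_map c ` (N \<inter> chart_dom c) = chart_img c \<inter> T"
    using chart_image_openin[OF c N(1)] by (auto simp: openin_open)
  have "x \<in> chart_map c ` (N \<inter> chart_dom c)"
    using N(2) x c by (intro image_eqI[of _ _ "chart_inv c x"]) auto
  then show "\<exists>T. open T \<and> x \<in> T \<and> smooth_on (chart_img c \<inter> T) (u \<circ> chart_inv c)"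
    using T N(3) by auto
qed

lemma supp_subset: "closed K \<Longrightarrow> (\<And>p. p \<notin> K \<Longrightarrow> u p = 0) \<Longrightarrow> supp u \<subseteq> K"
  unfolding supp_def by (rule closure_minimal) auto

lemma compact_supp:
  fixes u :: "'a \<Rightarrow> real"
  assumes "compact K" "\<And>p. p \<notin> K \<Longrightarrow> u p = 0"
  shows "compact (supp u)"
proof -
  have "supp u \<subseteq> K" by (rule supp_subset[OF compact_imp_closed[OF assms(1)] assms(2)])
  then show ?thesis using compact_Int_closed[OF assms(1) closed_supp, of u] by (simp add: Int_absorb1)
qed

text \<open>Finitely many bumps cover the compact support of \<open>w\<close>. Their sum
  \<open>\<sigma>\<close> is positive there, and the pieces are
  \<open>\<theta> p * (w / \<sigma>)\<close>, so the quotients \<open>\<theta> p / \<sigma>\<close>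
  form a partition of unity on the support.\<close>

lemma partition:
  assumes w: "smooth_fun \<A> w" and s: "compact (supp w)"
  obtains I :: "'a set" and \<omega> where "finite I" "\<And>i. i \<in> I \<Longrightarrow> smooth_fun \<A> (\<omega> i)"
    "\<And>i. i \<in> I \<Longrightarrow> compact (supp (\<omega> i))" "\<And>i. i \<in> I \<Longrightarrow> \<exists>c\<in>\<A>. supp (\<omega> i) \<subseteq> chart_dom c"
    "\<And>q. w q = (\<Sum>i\<in>I. \<omega> i q)"
proof -
  have "\<exists>\<theta>. smooth_fun \<A> \<theta> \<and> compact (supp \<theta>) \<and> (\<exists>c\<in>\<A>. supp \<theta> \<subseteq> chart_dom c) \<and> (\<forall>q. 0 \<le> \<theta> q) \<and> 0 < \<theta> p" for p
  proof -
    obtain c where c: "c \<in> \<A>" "p \<in> chart_dom c" using chart_cover by blast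
    show ?thesis
      by (rule bump_exists[OF c(1) open_UNIV UNIV_I c(2)]) (use c(1) in blast)
  qed
  then obtain \<theta> where \<theta>: "\<And>p. smooth_fun \<A> (\<theta> p)" "\<And>p. compact (supp (\<theta> p))"
    "\<And>p. \<exists>c\<in>\<A>. supp (\<theta> p) \<subseteq> chart_dom c" "\<And>p q. 0 \<le> \<theta> p q" "\<And>p. 0 < \<theta> p p" by metis
  have op: "open {q. 0 < f q}" if "smooth_fun \<A> f" for f
    using open_Collect_less[OF continuous_on_const smooth_fun_continuous[OF that]] .
  obtain F where F: "F \<subseteq> supp w" "finite F" "supp w \<subseteq> (\<Union>p\<in>F. {q. 0 < \<theta> p q})"
    by (rule compactE_image[OF s, of "supp w" "\<lambda>p. {q. 0 < \<theta> p q}"]) (use op \<theta> in auto)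
  define \<sigma> where "\<sigma> q = (\<Sum>p\<in>F. \<theta> p q)" for q
  have \<sigma>s: "smooth_fun \<A> \<sigma>" unfolding \<sigma>_def[abs_def] by (rule smooth_fun_sum[OF F(2) \<theta>(1)])
  have \<sigma>pos: "0 < \<sigma> q" if q: "q \<in> supp w" for q
  proof -
    obtain p where "p \<in> F" "0 < \<theta> p q" using F(3) q by blast
    then show ?thesis unfolding \<sigma>_def using F(2) \<theta>(4) by (intro sum_pos2[of F p]) auto
  qed
  \<comment> \<open>Where \<open>\<sigma>\<close> vanishes so does \<open>w\<close>, and the
    quotient is 0. Smoothness is checked on two open sets: where \<open>\<sigma>\<close> is
    positive, and off the support of \<open>w\<close>.\<close>
  define w' where "w' q = w q / \<sigma> q" for q
  have w's: "smooth_fun \<A> w'"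
  proof (rule smooth_fun_local)
    fix c p assume c: "c \<in> \<A>" and p: "p \<in> chart_dom c"
    show "\<exists>N. open N \<and> p \<in> N \<and> smooth_on (chart_map c ` (N \<inter> chart_dom c)) (w' \<circ> chart_inv c)"
    proof (cases "p \<in> supp w")
      case True
      let ?U = "chart_map c ` ({q. 0 < \<sigma> q} \<inter> chart_dom c)"
      have "?U \<subseteq> chart_img c" using c by auto
      then have "smooth_on ?U (\<lambda>x. w (chart_inv c x) / \<sigma> (chart_inv c x))"
        using smooth_funD[OF w c] smooth_funD[OF \<sigma>s c] c
        by (intro smooth_on_divide) (auto intro: smooth_on_subset simp: o_def)
      then have "smooth_on ?U (w' \<circ> chart_inv c)" by (simp add: w'_def o_def)
      then show ?thesis using op[OF \<sigma>s] \<sigma>pos[OF True] by (intro exI[of _ "{q. 0 < \<sigma> q}"]) auto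
    next
      case False
      have "smooth_on (chart_map c ` (- supp w \<inter> chart_dom c)) (w' \<circ> chart_inv c)"
        by (rule smooth_on_cong[OF smooth_on_const[of _ 0]]) (use c in \<open>auto simp: w'_def supp_eq_0\<close>)
      then show ?thesis using False closed_supp by (intro exI[of _ "- supp w"]) auto
    qed
  qed
  show ?thesis
  proof (rule that[of F "\<lambda>p q. \<theta> p q * w' q"])
    show "finite F" by (rule F(2))
    show "smooth_fun \<A> (\<lambda>q. \<theta> p q * w' q)" for p by (intro smooth_fun_mult \<theta> w's)
    have sub: "\<theta> p q * w' q = 0" if "q \<notin> supp (\<theta> p)" for p q using supp_eq_0[OF that] by simp
    show "compact (supp (\<lambda>q. \<theta> p q * w' q))" for p by (rule compact_supp[OF \<theta>(2) sub])
    show "\<exists>c\<in>\<A>. supp (\<lambda>q. \<theta> p q * w' q) \<subseteq> chart_dom c" for p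
      using \<theta>(3)[of p] supp_subset[OF closed_supp, of "\<theta> p" "\<lambda>q. \<theta> p q * w' q"] sub by blast
    show "w q = (\<Sum>p\<in>F. \<theta> p q * w' q)" for q
    proof (cases "q \<in> supp w")
      case True
      have "(\<Sum>p\<in>F. \<theta> p q * w' q) = \<sigma> q * w' q" by (simp add: \<sigma>_def sum_distrib_right)
      then show ?thesis using \<sigma>pos[OF True] by (simp add: w'_def)
    qed (simp add: supp_eq_0 w'_def)
  qed
qed

text \<open>Only \<open>w\<close> is cut into pieces, while the boundary condition concerns
  \<open>v\<close>. The bumps of the partition therefore need not satisfy a Neumann
  condition.\<close>

lemma green:
  assumes v: "smooth_fun \<A> v" "neumann \<A> g v" and w: "smooth_fun \<A> w" "compact (supp w)"
  shows "(\<integral>p. w p * laplacian \<A> g v p \<partial>\<mu>) = (\<integral>p. carre w v p \<partial>\<mu>)"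
proof -
  obtain I :: "'a set" and \<omega> where I: "finite I" and \<omega>: "\<And>i. i \<in> I \<Longrightarrow> smooth_fun \<A> (\<omega> i)"
    "\<And>i. i \<in> I \<Longrightarrow> compact (supp (\<omega> i))" "\<And>i. i \<in> I \<Longrightarrow> \<exists>c\<in>\<A>. supp (\<omega> i) \<subseteq> chart_dom c"
    and sum: "\<And>q. w q = (\<Sum>i\<in>I. \<omega> i q)"
    using partition[OF w] by blast
  have weq: "w = (\<lambda>q. \<Sum>i\<in>I. \<omega> i q)" using sum by blast
  have int1: "integrable \<mu> (\<lambda>p. \<omega> i p * laplacian \<A> g v p)" if i: "i \<in> I" for i
    by (rule integrable_continuous_compact[OF continuous_on_mult[OF smooth_fun_continuous[OF \<omega>(1)[OF i]]
          laplacian_cont[OF v(1)]] \<omega>(2)[OF i]]) (simp add: supp_eq_0)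
  have int2: "integrable \<mu> (carre (\<omega> i) v)" if i: "i \<in> I" for i
    by (rule integrable_continuous_compact[OF carre_cont[OF \<omega>(1)[OF i] v(1)] \<omega>(2)[OF i]])
       (rule carre_supp[OF \<omega>(1)[OF i] v(1)])
  have "(\<integral>p. w p * laplacian \<A> g v p \<partial>\<mu>) = (\<integral>p. (\<Sum>i\<in>I. \<omega> i p * laplacian \<A> g v p) \<partial>\<mu>)"
    by (simp add: sum sum_distrib_right)
  also have "\<dots> = (\<Sum>i\<in>I. \<integral>p. \<omega> i p * laplacian \<A> g v p \<partial>\<mu>)"
    by (rule Bochner_Integration.integral_sum) (rule int1)
  also have "\<dots> = (\<Sum>i\<in>I. \<integral>p. carre (\<omega> i) v p \<partial>\<mu>)"
  proof (rule sum.cong[OF refl])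
    fix i assume i: "i \<in> I"
    obtain c where "c \<in> \<A>" "supp (\<omega> i) \<subseteq> chart_dom c" using \<omega>(3)[OF i] by blast
    then show "(\<integral>p. \<omega> i p * laplacian \<A> g v p \<partial>\<mu>) = (\<integral>p. carre (\<omega> i) v p \<partial>\<mu>)"
      using green_one_chart[OF _ v \<omega>(1)[OF i] \<omega>(2)[OF i]] by blast
  qed
  also have "\<dots> = (\<integral>p. (\<Sum>i\<in>I. carre (\<omega> i) v p) \<partial>\<mu>)"
    by (rule Bochner_Integration.integral_sum[symmetric]) (rule int2)
  also have "\<dots> = (\<integral>p. carre w v p \<partial>\<mu>)"
    unfolding weq by (simp add: carre_sum[OF I \<omega>(1) v(1)])
  finally show ?thesis .
qed

section \<open>The Laplacian as a symmetric operator\<close>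

definition laplace_dom :: "('a \<Rightarrow> real) set" where
  "laplace_dom = {u. smooth_fun \<A> u \<and> compact (supp u) \<and> neumann \<A> g u}"

lemma laplace_op_iff: "(u, v) \<in> laplace_op \<A> g \<longleftrightarrow> u \<in> laplace_dom \<and> v = laplacian \<A> g u"
  by (auto simp: laplace_op_def laplace_dom_def Cc_infty_def)

lemma laplacian_supp:
  assumes v: "smooth_fun \<A> v" and p: "p \<notin> supp v"
  shows "laplacian \<A> g v p = 0"
proof -
  obtain c where c: "c \<in> \<A>" "p \<in> chart_dom c" using chart_cover by blast
  let ?U = "chart_map c ` (- supp v \<inter> chart_dom c)"
  have U: "openin (top_of_set (chart_img c)) ?U"
    by (rule chart_image_openin[OF c(1)]) (simp add: closed_supp open_Compl)
  have "grad_in g c v x = 0" if "x \<in> ?U" for x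
  proof -
    obtain q where q: "x = chart_map c q" "q \<in> - supp v" "q \<in> chart_dom c" using \<open>x \<in> ?U\<close> by blast
    have "dgrad c v x = 0" unfolding q(1)
      by (rule dgrad_locally_0[OF c(1) _ _ q(2,3)]) (auto simp: closed_supp open_Compl supp_eq_0)
    then show ?thesis by (simp add: grad_eq_dgrad)
  qed
  then have "partial_deriv c i (\<lambda>y. vol_density g c y * grad_in g c v y $ i) (chart_map c p) = 0" for i
    unfolding partial_deriv_def
    by (intro coord_domain_deriv_0[OF chart_coord_domain[OF c(1)] U]) (use c p in auto)
  then show ?thesis by (simp add: laplacian_eq[OF c v] lap_def div_in_def)
qed

lemma laplacian_linear:
  assumes u: "smooth_fun \<A> u" and v: "smooth_fun \<A> v"
  shows "laplacian \<A> g (\<lambda>q. u q + k * v q) p = laplacian \<A> g u p + k * laplacian \<A> g v p"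
proof -
  obtain c where c: "c \<in> \<A>" "p \<in> chart_dom c" using chart_cover by blast
  let ?V = "chart_img c" and ?x = "chart_map c p"
  have x: "?x \<in> ?V" using c by simp
  have kv: "smooth_fun \<A> (\<lambda>q. k * v q)" by (rule smooth_fun_mult[OF smooth_fun_const v])
  have uv: "smooth_fun \<A> (\<lambda>q. u q + k * v q)" by (rule smooth_fun_add[OF u kv])
  define X where "X w i y = vol_density g c y * grad_in g c w y $ i" for w i y
  have Xs: "smooth_on ?V (X w i)" if "smooth_fun \<A> w" for w i
    unfolding X_def[abs_def] by (rule vol_grad_smooth[OF c(1) that])
  have grad: "grad_in g c (\<lambda>q. u q + k * v q) y = grad_in g c u y + k *\<^sub>R grad_in g c v y" if y: "y \<in> ?V" for y
    unfolding grad_eq_dgrad dgrad_add[OF c(1) y u kv] dgrad_cmult[OF c(1) y v]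
    by (simp add: matrix_vector_right_distrib matrix_vector_mult_scaleR)
  have "partial_deriv c i (X (\<lambda>q. u q + k * v q) i) ?x = partial_deriv c i (X u i) ?x + k * partial_deriv c i (X v i) ?x" for i
  proof -
    have "partial_deriv c i (X (\<lambda>q. u q + k * v q) i) ?x = partial_deriv c i (\<lambda>y. X u i y + k * X v i y) ?x"
      unfolding partial_deriv_def
      by (subst coord_domain_deriv_cong[OF chart_coord_domain[OF c(1)] x Xs[OF uv], where h = "\<lambda>y. X u i y + k * X v i y"])
         (auto simp: X_def grad algebra_simps)
    also have "\<dots> = partial_deriv c i (X u i) ?x + partial_deriv c i (\<lambda>y. k * X v i y) ?x"
      unfolding partial_deriv_def
      by (rule coord_domain_deriv_add[OF chart_coord_domain[OF c(1)] x Xs[OF u] smooth_on_mult[OF smooth_on_const Xs[OF v]]])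
    also have "partial_deriv c i (\<lambda>y. k * X v i y) ?x = k * partial_deriv c i (X v i) ?x"
      unfolding partial_deriv_def
      by (rule coord_domain_deriv_cmult[OF chart_coord_domain[OF c(1)] x Xs[OF v]])
    finally show ?thesis .
  qed
  then have "lap c (\<lambda>q. u q + k * v q) ?x = lap c u ?x + k * lap c v ?x"
    unfolding lap_def div_in_def X_def[abs_def]
    by (simp add: sum.distrib sum_distrib_left[symmetric] add_divide_distrib)
  then show ?thesis by (simp add: laplacian_eq[OF c] u v uv)
qed

lemma neumann_linear:
  assumes u: "smooth_fun \<A> u" "neumann \<A> g u" and v: "smooth_fun \<A> v" "neumann \<A> g v"
  shows "neumann \<A> g (\<lambda>q. u q + k * v q)"
  unfolding neumann_def
proof (intro ballI allI impI)
  fix c i x \<nu>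
  assume c: "c \<in> \<A>" and h: "openin (top_of_set (half_space i)) (chart_img c)" and x: "x \<in> chart_img c"
    and n: "x $ i = 0 \<and> outward_unit_normal g c i x \<nu>"
  have kv: "smooth_fun \<A> (\<lambda>q. k * v q)" by (rule smooth_fun_mult[OF smooth_fun_const v(1)])
  have "dgrad c u x \<bullet> \<nu> = 0" "dgrad c v x \<bullet> \<nu> = 0"
    using u(2) v(2) c h x n dgrad_inner[OF c x u(1)] dgrad_inner[OF c x v(1)]
    unfolding neumann_def by metis+
  then show "frechet_derivative ((\<lambda>q. u q + k * v q) \<circ> chart_inv c) (at x within chart_img c) \<nu> = 0"
    unfolding dgrad_inner[OF c x smooth_fun_add[OF u(1) kv]] dgrad_add[OF c x u(1) kv] dgrad_cmult[OF c x v(1)]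
    by (simp add: inner_add_left)
qed

lemma laplace_op_linear:
  assumes "(u, v) \<in> laplace_op \<A> g" "(u', v') \<in> laplace_op \<A> g"
  shows "(\<lambda>x. u x + k * u' x, \<lambda>x. v x + k * v' x) \<in> laplace_op \<A> g"
proof -
  have u: "smooth_fun \<A> u" "compact (supp u)" "neumann \<A> g u" "v = laplacian \<A> g u"
    and u': "smooth_fun \<A> u'" "compact (supp u')" "neumann \<A> g u'" "v' = laplacian \<A> g u'"
    using assms by (auto simp: laplace_op_iff laplace_dom_def)
  have "compact (supp (\<lambda>x. u x + k * u' x))"
    by (rule compact_supp[OF compact_Un[OF u(2) u'(2)]]) (simp add: supp_eq_0)
  moreover have "smooth_fun \<A> (\<lambda>x. u x + k * u' x)"
    by (intro smooth_fun_add smooth_fun_mult smooth_fun_const u u')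
  ultimately show ?thesis
    using neumann_linear[OF u(1,3) u'(1,3)] laplacian_linear[OF u(1) u'(1)]
    by (auto simp: laplace_op_iff laplace_dom_def u u')
qed

lemma laplace_op_l2: "laplace_op \<A> g \<subseteq> l2_space \<mu> \<times> l2_space \<mu>"
proof
  fix z assume "z \<in> laplace_op \<A> g"
  then obtain u where z: "z = (u, laplacian \<A> g u)" and u: "smooth_fun \<A> u" "compact (supp u)"
    by (auto simp: laplace_op_def Cc_infty_def)
  have "u \<in> l2_space \<mu>"
    by (rule l2_continuous_compact[OF smooth_fun_continuous[OF u(1)] u(2)]) (rule supp_eq_0)
  moreover have "laplacian \<A> g u \<in> l2_space \<mu>"
    by (rule l2_continuous_compact[OF laplacian_cont[OF u(1)] u(2) laplacian_supp[OF u(1)]])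
  ultimately show "z \<in> l2_space \<mu> \<times> l2_space \<mu>" using z by simp
qed

lemma laplace_op_energy:
  assumes "(u, v) \<in> laplace_op \<A> g"  "(u', v') \<in> laplace_op \<A> g"
  shows "l2_inner \<mu> u v' = (\<integral>p. carre u u' p \<partial>\<mu>)"
  using assms green[of u' u] by (auto simp: laplace_op_iff laplace_dom_def l2_inner_def)

lemma laplace_op_symmetric:
  assumes "(u, v) \<in> laplace_op \<A> g"  "(u', v') \<in> laplace_op \<A> g"
  shows "l2_inner \<mu> v u' = l2_inner \<mu> u v'"
proof -
  have "smooth_fun \<A> u" "smooth_fun \<A> u'" using assms by (auto simp: laplace_op_iff laplace_dom_def)
  then have "carre u' u = carre u u'" using carre_commute by blast
  then show ?thesis
    using laplace_op_energy[OF assms] laplace_op_energy[OF assms(2,1)] l2_inner_commute[of \<mu> v u'] by simp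
qed

lemma laplace_op_nonempty: "laplace_op \<A> g \<noteq> {}"
proof -
  have "frechet_derivative ((\<lambda>_. 0 :: real) \<circ> chart_inv c) (at x within chart_img c) \<nu> = 0"
    if "c \<in> \<A>" "x \<in> chart_img c" for c x \<nu>
    by (rule coord_domain_deriv_0[OF chart_coord_domain[OF that(1)] _ that(2)]) auto
  then have "neumann \<A> g (\<lambda>_. 0)" unfolding neumann_def by blast
  moreover have "supp (\<lambda>_ :: 'a. 0) = {}" by (simp add: supp_def)
  ultimately have "(\<lambda>_. 0) \<in> laplace_dom" using smooth_fun_const by (simp add: laplace_dom_def)
  then show ?thesis using laplace_op_iff by blast
qed

end

section \<open>Local constancy and local vanishing\<close>

lemma nn_integral_lborel_translate:
  fixes G :: "'e::euclidean_space \<Rightarrow> ennreal"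
  assumes [measurable]: "G \<in> borel_measurable borel"
  shows "(\<integral>\<^sup>+x. G (x + a) \<partial>lborel) = (\<integral>\<^sup>+x. G x \<partial>lborel)"
proof -
  have "(\<integral>\<^sup>+x. G x \<partial>lborel) = (\<integral>\<^sup>+x. G x \<partial>distr lborel borel ((+) a))"
    by (simp add: lborel_distr_plus)
  also have "\<dots> = (\<integral>\<^sup>+x. G (a + x) \<partial>lborel)"
    by (rule nn_integral_distr) measurable
  finally show ?thesis by (simp add: add.commute)
qed

text \<open>The increment of \<open>U\<close> over \<open>h\<close> is the integral of its derivative along the segment; by Tonelli
  and translation invariance each point of the segment contributes the same integral.\<close>

lemma nn_integral_increment_le:
  fixes U :: "'e::euclidean_space \<Rightarrow> real"
  assumes K: "compact K" "convex K" and V: "K \<subseteq> V"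
    and U: "\<And>x. x \<in> V \<Longrightarrow> (U has_derivative U' x) (at x within V)"
    and cont: "continuous_on V (\<lambda>x. U' x h)"
  shows "(\<integral>\<^sup>+x. indicator K x * indicator K (x + h) * ennreal \<bar>U (x + h) - U x\<bar> \<partial>lborel)
       \<le> (\<integral>\<^sup>+x. indicator K x * ennreal \<bar>U' x h\<bar> \<partial>lborel)"
proof -
  define G where "G x = ennreal \<bar>indicator K x *\<^sub>R U' x h\<bar>" for x
  have Kb[measurable]: "K \<in> sets borel" using borel_compact[OF K(1)] .
  have "(\<lambda>x. indicator K x *\<^sub>R U' x h) \<in> borel_measurable borel"
    by (rule borel_measurable_continuous_on_indicator[OF Kb continuous_on_subset[OF cont V]])
  from measurable_compose[OF borel_measurable_abs[OF this] measurable_ennreal]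
  have Gm[measurable]: "G \<in> borel_measurable borel" unfolding G_def[abs_def] .
  have seg: "x + t *\<^sub>R h \<in> K" if "x \<in> K" "x + h \<in> K" "t \<in> {0..1}" for x t
  proof -
    have "(1 - t) *\<^sub>R x + t *\<^sub>R (x + h) \<in> K" using that by (intro convexD[OF K(2)]) auto
    then show ?thesis by (simp add: algebra_simps)
  qed
  have ptw: "indicator K x * indicator K (x + h) * ennreal \<bar>U (x + h) - U x\<bar>
      \<le> (\<integral>\<^sup>+t. indicator {0..1::real} t * G (x + t *\<^sub>R h) \<partial>lborel)" for x
  proof (cases "x \<in> K \<and> x + h \<in> K")
    case True
    have sub: "(\<lambda>t. x + t *\<^sub>R h) ` {0..1} \<subseteq> V" using seg True V by blast
    have D: "((\<lambda>t. U (x + t *\<^sub>R h)) has_vector_derivative U' (x + t *\<^sub>R h) h) (at t within {0..1})" if t: "t \<in> {0..1}" for t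
    proof -
      have 1: "((\<lambda>t. x + t *\<^sub>R h) has_derivative (\<lambda>s. s *\<^sub>R h)) (at t within {0..1})"
        by (auto intro!: derivative_eq_intros)
      have xV: "x + t *\<^sub>R h \<in> V" using sub t by blast
      have 2: "(U has_derivative U' (x + t *\<^sub>R h)) (at (x + t *\<^sub>R h) within (\<lambda>t. x + t *\<^sub>R h) ` {0..1})"
        using U[OF xV] sub by (rule has_derivative_subset)
      have "((\<lambda>t. U (x + t *\<^sub>R h)) has_derivative (\<lambda>s. U' (x + t *\<^sub>R h) (s *\<^sub>R h))) (at t within {0..1})"
        using has_derivative_in_compose[OF 1 2] .
      moreover have "linear (U' (x + t *\<^sub>R h))" using U[OF xV] has_derivative_linear by blast
      ultimately show ?thesis unfolding has_vector_derivative_def by (simp add: linear_scale)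
    qed
    have c: "continuous_on {0..1} (\<lambda>t. U' (x + t *\<^sub>R h) h)"
    proof (rule continuous_on_compose2[OF cont _ sub])
      show "continuous_on {0..1} (\<lambda>t. x + t *\<^sub>R h)" by (intro continuous_intros)
    qed
    have B: "has_bochner_integral lborel (\<lambda>t. indicator {0..1} t *\<^sub>R U' (x + t *\<^sub>R h) h) (U (x + 1 *\<^sub>R h) - U (x + 0 *\<^sub>R h))"
      by (rule has_bochner_integral_FTC_Icc[OF _ D c]) auto
    have "ennreal \<bar>U (x + h) - U x\<bar> \<le> (\<integral>\<^sup>+t. norm (indicator {0..1} t *\<^sub>R U' (x + t *\<^sub>R h) h) \<partial>lborel)"
      using integral_norm_bound_ennreal[of lborel "\<lambda>t. indicator {0..1} t *\<^sub>R U' (x + t *\<^sub>R h) h"] B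
      by (simp add: has_bochner_integral_iff)
    also have "\<dots> = (\<integral>\<^sup>+t. indicator {0..1::real} t * G (x + t *\<^sub>R h) \<partial>lborel)"
      by (rule nn_integral_cong) (use seg True in \<open>auto simp: G_def indicator_def\<close>)
    finally show ?thesis using True by simp
  qed auto
  have "(\<integral>\<^sup>+x. indicator K x * indicator K (x + h) * ennreal \<bar>U (x + h) - U x\<bar> \<partial>lborel)
      \<le> (\<integral>\<^sup>+x. \<integral>\<^sup>+t. indicator {0..1::real} t * G (x + t *\<^sub>R h) \<partial>lborel \<partial>lborel)"
    by (rule nn_integral_mono) (rule ptw)
  also have "\<dots> = (\<integral>\<^sup>+t. \<integral>\<^sup>+x. indicator {0..1::real} t * G (x + t *\<^sub>R h) \<partial>lborel \<partial>lborel)"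
    by (rule lborel_pair.Fubini') measurable
  also have "\<dots> = (\<integral>\<^sup>+t. indicator {0..1::real} t * (\<integral>\<^sup>+x. G x \<partial>lborel) \<partial>lborel)"
    by (simp add: nn_integral_cmult nn_integral_lborel_translate)
  also have "\<dots> = (\<integral>\<^sup>+x. G x \<partial>lborel)"
    by (simp add: nn_integral_multc)
  also have "\<dots> = (\<integral>\<^sup>+x. indicator K x * ennreal \<bar>U' x h\<bar> \<partial>lborel)"
    by (rule nn_integral_cong) (auto simp: G_def indicator_def)
  finally show ?thesis .
qed

text \<open>By Tonelli in \<open>(x, h)\<close>, for almost every \<open>x\<close> in
  \<open>K\<close> the value \<open>f x\<close> is attained at almost every point of
  \<open>K\<close>; one such \<open>x\<close> supplies the constant. If \<open>K\<close> is null
  there may be no point to choose, hence the case split.\<close>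

lemma AE_constant_if_increments_0:
  fixes f :: "'e::euclidean_space \<Rightarrow> real"
  assumes [measurable]: "f \<in> borel_measurable borel" "K \<in> sets borel"
    and zero: "\<And>h. (\<integral>\<^sup>+x. indicator K x * indicator K (x + h) * ennreal \<bar>f (x + h) - f x\<bar> \<partial>lborel) = 0"
  shows "\<exists>k. AE x in lborel. x \<in> K \<longrightarrow> f x = k"
proof (cases "AE x in lborel. x \<notin> K")
  case True
  then have "AE x in lborel. x \<in> K \<longrightarrow> f x = 0" by eventually_elim auto
  then show ?thesis by blast
next
  case False
  define J where "J x = (\<integral>\<^sup>+y. indicator K y * ennreal \<bar>f y - f x\<bar> \<partial>lborel)" for x
  have Jm[measurable]: "J \<in> borel_measurable lborel" unfolding J_def[abs_def] by measurable
  have "(\<integral>\<^sup>+x. indicator K x * J x \<partial>lborel)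
      = (\<integral>\<^sup>+x. \<integral>\<^sup>+h. indicator K x * indicator K (x + h) * ennreal \<bar>f (x + h) - f x\<bar> \<partial>lborel \<partial>lborel)"
  proof (rule nn_integral_cong)
    fix x
    have "J x = (\<integral>\<^sup>+h. indicator K (h + x) * ennreal \<bar>f (h + x) - f x\<bar> \<partial>lborel)"
      unfolding J_def by (rule nn_integral_lborel_translate[symmetric]) measurable
    then show "indicator K x * J x = (\<integral>\<^sup>+h. indicator K x * indicator K (x + h) * ennreal \<bar>f (x + h) - f x\<bar> \<partial>lborel)"
      by (simp add: nn_integral_cmult[symmetric] mult.assoc add.commute)
  qed
  also have "\<dots> = (\<integral>\<^sup>+h. \<integral>\<^sup>+x. indicator K x * indicator K (x + h) * ennreal \<bar>f (x + h) - f x\<bar> \<partial>lborel \<partial>lborel)"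
    by (rule lborel_pair.Fubini') measurable
  also have "\<dots> = 0" by (simp add: zero)
  finally have "AE x in lborel. indicator K x * J x = 0" by (simp add: nn_integral_0_iff_AE)
  then have "\<exists>x. x \<in> K \<and> J x = 0"
  proof (rule contrapos_pp)
    assume n: "\<not> (\<exists>x. x \<in> K \<and> J x = 0)"
    show "\<not> (AE x in lborel. indicator K x * J x = 0)"
    proof
      assume "AE x in lborel. indicator K x * J x = 0"
      then have "AE x in lborel. x \<notin> K" by eventually_elim (use n in \<open>auto simp: indicator_def\<close>)
      then show False using False by simp
    qed
  qed
  then obtain x where "J x = 0" by blast
  then have "AE y in lborel. indicator K y * ennreal \<bar>f y - f x\<bar> = 0"
    unfolding J_def by (subst (asm) nn_integral_0_iff_AE) auto
  then have "AE y in lborel. y \<in> K \<longrightarrow> f y = f x"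
    by eventually_elim (auto simp: indicator_def)
  then show ?thesis by blast
qed

text \<open>Lebesgue differentiation: at almost every \<open>x\<close> the value \<open>F x\<close>
  is the limit of averages over small cubes with corner \<open>x\<close>, and inside
  \<open>W\<close> all these averages vanish.\<close>

lemma AE_eq_0_if_box_integrals_0:
  fixes F :: "'e::euclidean_space \<Rightarrow> real"
  assumes F: "integrable lborel F" and W: "open W"
    and zero: "\<And>a b. (\<And>i. i \<in> Basis \<Longrightarrow> a \<bullet> i < b \<bullet> i) \<Longrightarrow> cbox a b \<subseteq> W \<Longrightarrow>
                 (\<integral>x. indicator (box a b) x * F x \<partial>lborel) = 0"
  shows "AE x in lborel. x \<in> W \<longrightarrow> F x = 0"
proof -
  have Fm[measurable]: "F \<in> borel_measurable borel" using F by (simp add: borel_measurable_integrable)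
  have "F integrable_on UNIV" using integrable_on_lborel[OF F] .
  then have "F integrable_on cbox a b" for a b by (rule integrable_on_subcbox) auto
  then obtain N where N: "negligible N" "\<And>x e. x \<notin> N \<Longrightarrow> 0 < e \<Longrightarrow>
      \<exists>d>0. \<forall>h. 0 < h \<and> h < d \<longrightarrow> norm (integral (cbox x (x + h *\<^sub>R One)) F /\<^sub>R h ^ DIM('e) - F x) < e"
    using integrable_ccontinuous_explicit[of F] by blast
  have *: "F x = 0" if x: "x \<in> W" "x \<notin> N" for x
  proof (rule ccontr)
    assume "F x \<noteq> 0"
    then obtain d where d: "d > 0" "\<And>h. 0 < h \<Longrightarrow> h < d \<Longrightarrow>
        norm (integral (cbox x (x + h *\<^sub>R One)) F /\<^sub>R h ^ DIM('e) - F x) < \<bar>F x\<bar>"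
      using N(2)[OF x(2), of "\<bar>F x\<bar>"] by auto
    obtain r where r: "r > 0" "ball x r \<subseteq> W" using W x(1) openE by blast
    \<comment> \<open>The factor \<open>norm One + 1\<close> exceeds the diagonal of the unit cube,
      so the cube of side \<open>h\<close> fits into the ball of radius \<open>r\<close>; halving
      makes the bounds strict.\<close>
    define h where "h = min d (r / (norm (One :: 'e) + 1)) / 2"
    have np: "norm (One :: 'e) + 1 > 0" by (simp add: add_nonneg_pos)
    have h: "0 < h" "h < d" "h * (norm (One :: 'e) + 1) < r"
    proof -
      show "0 < h" using d(1) r(1) np by (simp add: h_def)
      show "h < d" using d(1) by (simp add: h_def min_def)
      have "h \<le> r / (norm (One :: 'e) + 1) / 2"
        unfolding h_def by (intro divide_right_mono min.cobounded2) simp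
      then have "h * (norm (One :: 'e) + 1) \<le> r / 2" using np by (simp add: field_simps)
      then show "h * (norm (One :: 'e) + 1) < r" using r(1) by simp
    qed
    have sub: "cbox x (x + h *\<^sub>R One) \<subseteq> W"
    proof
      fix y assume y: "y \<in> cbox x (x + h *\<^sub>R One)"
      have "norm (y - x) \<le> norm (h *\<^sub>R (One :: 'e))"
        by (rule norm_le_componentwise) (use y h(1) in \<open>auto simp: mem_box algebra_simps abs_le_iff\<close>)
      also have "\<dots> = h * norm (One :: 'e)" using h(1) by simp
      also have "\<dots> < r" using h by (simp add: distrib_left)
      finally show "y \<in> W" using r(2) by (auto simp: dist_norm norm_minus_commute)
    qed
    have "(\<integral>y. indicator (box x (x + h *\<^sub>R One)) y * F y \<partial>lborel) = 0"
      by (rule zero[OF _ sub]) (use h(1) in \<open>auto simp: inner_add_left\<close>)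
    moreover have "set_integrable lborel (box x (x + h *\<^sub>R One)) F"
      unfolding set_integrable_def by (rule integrable_mult_indicator[OF _ F]) auto
    from set_borel_integral_eq_integral(2)[OF this]
    have "(\<integral>y. indicator (box x (x + h *\<^sub>R One)) y * F y \<partial>lborel) = integral (box x (x + h *\<^sub>R One)) F"
      by (simp add: set_lebesgue_integral_def)
    ultimately have "integral (cbox x (x + h *\<^sub>R One)) F = 0" by (simp add: integral_open_interval)
    then show False using d(2)[OF h(1,2)] by simp
  qed
  have "{x. \<not> (x \<in> W \<longrightarrow> F x = 0)} \<in> null_sets lborel"
  proof -
    have "negligible {x. \<not> (x \<in> W \<longrightarrow> F x = 0)}"
      by (rule negligible_subset[OF N(1)]) (use * in blast)
    moreover have "{x. \<not> (x \<in> W \<longrightarrow> F x = 0)} = W \<inter> {x \<in> space borel. F x \<noteq> 0}" by auto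
    then have "{x. \<not> (x \<in> W \<longrightarrow> F x = 0)} \<in> sets lborel" using W by simp
    ultimately show ?thesis by (simp add: negligible_iff_null_sets null_sets_completion_iff)
  qed
  then show ?thesis by (rule AE_I') simp
qed

context riemannian
begin

text \<open>On a chart domain \<open>\<mu>\<close> has a density with respect to Lebesgue measure,
  so exceptional null sets in coordinates give null sets on the manifold.\<close>

lemma chart_AE:
  assumes c: "c \<in> \<A>" and P[measurable]: "{q. P q} \<in> sets borel" and K[measurable]: "K \<in> sets borel"
    and ae: "AE x in lborel. x \<in> K \<longrightarrow> P (chart_inv c x)"
    and D: "D \<subseteq> {q \<in> chart_dom c. chart_map c q \<in> K}"
  shows "AE q in \<mu>. q \<in> D \<longrightarrow> P q"
proof -
  define f where "f q = (indicator {q \<in> chart_dom c. chart_map c q \<in> K} q * indicator {q. \<not> P q} q :: ennreal)" for q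
  have m1: "{q \<in> chart_dom c. chart_map c q \<in> K} \<in> sets borel"
  proof -
    have "(\<lambda>q. if q \<in> chart_dom c then chart_map c q else undefined) \<in> borel_measurable borel"
      by (intro borel_measurable_continuous_on_if chart_map_cont c continuous_intros chart_dom_borel)
    then have "(\<lambda>q. if q \<in> chart_dom c then chart_map c q else undefined) -` K \<inter> space borel \<in> sets borel"
      by (rule measurable_sets) (rule K)
    then have "(\<lambda>q. if q \<in> chart_dom c then chart_map c q else undefined) -` K \<in> sets borel" by simp
    from sets.Int[OF this chart_dom_borel[OF c]]
    have "(\<lambda>q. if q \<in> chart_dom c then chart_map c q else undefined) -` K \<inter> chart_dom c \<in> sets borel" .
    moreover have "(\<lambda>q. if q \<in> chart_dom c then chart_map c q else undefined) -` K \<inter> chart_dom c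
        = {q \<in> chart_dom c. chart_map c q \<in> K}" by auto
    ultimately show ?thesis by simp
  qed
  have m2: "{q. \<not> P q} \<in> sets borel"
  proof -
    have "{q. \<not> P q} = - {q. P q}" by auto
    then show ?thesis using P by (metis borel_comp)
  qed
  have fm[measurable]: "f \<in> borel_measurable borel" unfolding f_def[abs_def] using m1 m2 by measurable
  have "(\<integral>\<^sup>+q. indicator (chart_dom c) q * f q \<partial>\<mu>) = (\<integral>\<^sup>+x. ennreal (chart_weight c x) * f (chart_inv c x) \<partial>lborel)"
    by (rule chart_nn_integral[OF c fm])
  also have "\<dots> = (\<integral>\<^sup>+x. 0 \<partial>(lborel :: (real ^ 'n) measure))"
  proof (rule nn_integral_cong_AE, use ae in eventually_elim)
    fix x assume x: "x \<in> K \<longrightarrow> P (chart_inv c x)"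
    show "ennreal (chart_weight c x) * f (chart_inv c x) = 0"
      using x c by (auto simp: chart_weight_def[OF c] f_def indicator_def)
  qed
  finally have "AE q in \<mu>. indicator (chart_dom c) q * f q = 0"
    using chart_dom_borel[OF c] by (simp add: nn_integral_0_iff_AE)
  then show ?thesis
    by eventually_elim (use D in \<open>auto simp: f_def indicator_def split: if_splits\<close>)
qed

text \<open>By second countability countably many of the neighbourhoods cover the manifold, and a
  countable union of null sets is null.\<close>

lemma AE_local:
  assumes "\<And>p. \<exists>N. open N \<and> p \<in> N \<and> (AE q in \<mu>. q \<in> N \<longrightarrow> P q)"
  shows "AE q in \<mu>. P q"
proof -
  obtain N where N: "\<And>p. open (N p)" "\<And>p. p \<in> N p" "\<And>p. AE q in \<mu>. q \<in> N p \<longrightarrow> P q"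
    using assms by metis
  obtain F where F: "F \<subseteq> range N" "countable F" "\<Union>F = \<Union>(range N)"
    using Lindelof[of "range N"] N(1) by blast
  have "AE q in \<mu>. \<forall>S\<in>F. q \<in> S \<longrightarrow> P q"
    unfolding AE_ball_countable[OF F(2)] using F(1) N(3) by blast
  then show ?thesis
  proof eventually_elim
    fix q assume q: "\<forall>S\<in>F. q \<in> S \<longrightarrow> P q"
    have "q \<in> \<Union>(range N)" using N(2) by blast
    then show "P q" using F(3) q by blast
  qed
qed

text \<open>Where two neighbourhoods meet, their overlap is a nonempty open set, hence not null, so
  the two local constants agree. The assignment of constants to points is then genuinely locally
  constant, and connectedness applies to it.\<close>

lemma locally_constant_imp_ae_constant:
  assumes conn: "connected (UNIV :: 'a set)"
    and loc: "\<And>p. \<exists>N k. open N \<and> p \<in> N \<and> (AE q in \<mu>. q \<in> N \<longrightarrow> f q = k)"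
  shows "ae_constant \<mu> f"
proof -
  obtain N k where N: "\<And>p. open (N p)" "\<And>p. p \<in> N p" "\<And>p. AE q in \<mu>. q \<in> N p \<longrightarrow> f q = k p"
    using loc by metis
  have local: "k p = k q" if q: "q \<in> N p" for p q
  proof (rule ccontr)
    assume ne: "k p \<noteq> k q"
    have op: "open (N p \<inter> N q)" using N(1) by blast
    have "AE r in \<mu>. r \<notin> N p \<inter> N q"
      using N(3)[of p] N(3)[of q] by eventually_elim (use ne in auto)
    then have "N p \<inter> N q \<in> null_sets \<mu>" using AE_iff_null_sets[of "N p \<inter> N q" \<mu>] op by simp
    then have "N p \<inter> N q = {}" using open_null_set_empty[OF op] by auto
    then show False using q N(2) by blast
  qed
  have const: "k p = k q" for p q
  proof (rule connected_local_const[OF conn UNIV_I UNIV_I], intro ballI)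
    fix a
    show "\<forall>\<^sub>F b in at a. k a = k b"
      unfolding eventually_at_topological using N(1,2) local by (intro exI[of _ "N a"]) blast
  qed
  have "AE q in \<mu>. f q = k undefined"
  proof (rule AE_local)
    fix p
    show "\<exists>N. open N \<and> p \<in> N \<and> (AE q in \<mu>. q \<in> N \<longrightarrow> f q = k undefined)"
      using N const[of p undefined] by metis
  qed
  then show ?thesis by (auto simp: ae_constant_def)
qed

text \<open>Turns a weighted square bound into an unweighted bound of the first power. From
  \<open>(v * \<bar>q\<bar> - \<delta>)\<^sup>2 \<ge> 0\<close> one gets
  \<open>\<bar>q\<bar> \<le> v * q\<^sup>2 / \<delta> + \<delta> / v\<close>, where \<open>v\<close>
  is the density. The free parameter \<open>\<delta>\<close> takes the place of a square root:
  \<open>E\<close> tends to zero for fixed \<open>\<delta>\<close>, and \<open>\<delta>\<close>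
  afterwards.\<close>

lemma weighted_bound:
  fixes q :: "real ^ 'n \<Rightarrow> real"
  assumes c: "c \<in> \<A>" and K: "K \<subseteq> chart_img c" "K \<in> sets borel" "emeasure lborel K < \<infinity>"
    and m: "0 < m" "\<And>x. x \<in> K \<Longrightarrow> m \<le> vol_density g c x" and \<delta>: "0 < \<delta>"
    and q: "(\<lambda>x. indicator K x * q x) \<in> borel_measurable borel"
    and E: "(\<integral>\<^sup>+x. indicator K x * ennreal (chart_weight c x * (q x)\<^sup>2) \<partial>lborel) \<le> ennreal E" "0 \<le> E"
  shows "(\<integral>\<^sup>+x. indicator K x * ennreal \<bar>q x\<bar> \<partial>lborel) \<le> ennreal (E / \<delta> + \<delta> / m * measure lborel K)"
proof -
  have ptw: "indicator K x * ennreal \<bar>q x\<bar> \<le>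
      ennreal (1 / \<delta>) * (indicator K x * ennreal (chart_weight c x * (q x)\<^sup>2)) + ennreal (\<delta> / m) * indicator K x" for x
  proof (cases "x \<in> K")
    case True
    define v where "v = vol_density g c x"
    have v: "v \<ge> m" "v > 0" using m True by (auto simp: v_def intro: less_le_trans)
    have w: "chart_weight c x = v" using True K(1) by (auto simp: chart_weight_def[OF c] v_def)
    have "0 \<le> (v * \<bar>q x\<bar> - \<delta>)\<^sup>2" by simp
    then have "2 * \<delta> * (v * \<bar>q x\<bar>) \<le> v\<^sup>2 * (q x)\<^sup>2 + \<delta>\<^sup>2" by (simp add: power2_diff power_mult_distrib algebra_simps)
    moreover have "\<delta> * (v * \<bar>q x\<bar>) \<ge> 0" using \<delta> v by simp
    ultimately have "\<delta> * (v * \<bar>q x\<bar>) \<le> v\<^sup>2 * (q x)\<^sup>2 + \<delta>\<^sup>2" by linarith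
    then have "\<bar>q x\<bar> \<le> (v\<^sup>2 * (q x)\<^sup>2 + \<delta>\<^sup>2) / (\<delta> * v)" using \<delta> v by (simp add: field_simps)
    also have "\<dots> = 1 / \<delta> * (v * (q x)\<^sup>2) + \<delta> / v" using \<delta> v by (simp add: field_simps power2_eq_square)
    also have "\<dots> \<le> 1 / \<delta> * (v * (q x)\<^sup>2) + \<delta> / m" using \<delta> v m(1) by (simp add: frac_le)
    finally have "ennreal \<bar>q x\<bar> \<le> ennreal (1 / \<delta> * (v * (q x)\<^sup>2) + \<delta> / m)" by (rule ennreal_leI)
    also have "\<dots> = ennreal (1 / \<delta> * (v * (q x)\<^sup>2)) + ennreal (\<delta> / m)"
      by (rule ennreal_plus) (use \<delta> v m(1) in auto)
    also have "ennreal (1 / \<delta> * (v * (q x)\<^sup>2)) = ennreal (1 / \<delta>) * ennreal (v * (q x)\<^sup>2)"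
      by (rule ennreal_mult) (use \<delta> v in auto)
    finally show ?thesis using True w by simp
  qed simp
  have wq: "(\<lambda>x. indicator K x * ennreal (chart_weight c x * (q x)\<^sup>2)) \<in> borel_measurable borel"
  proof -
    have "(\<lambda>x. ennreal (chart_weight c x * (indicator K x * q x)\<^sup>2)) \<in> borel_measurable borel"
      using q chart_weight_measurable[OF c] by measurable
    moreover have "ennreal (chart_weight c x * (indicator K x * q x)\<^sup>2) = indicator K x * ennreal (chart_weight c x * (q x)\<^sup>2)" for x
      by (auto simp: indicator_def)
    ultimately show ?thesis by simp
  qed
  have "(\<integral>\<^sup>+x. indicator K x * ennreal \<bar>q x\<bar> \<partial>lborel)
      \<le> (\<integral>\<^sup>+x. ennreal (1 / \<delta>) * (indicator K x * ennreal (chart_weight c x * (q x)\<^sup>2)) + ennreal (\<delta> / m) * indicator K x \<partial>lborel)"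
    by (rule nn_integral_mono) (rule ptw)
  also have "\<dots> = ennreal (1 / \<delta>) * (\<integral>\<^sup>+x. indicator K x * ennreal (chart_weight c x * (q x)\<^sup>2) \<partial>lborel)
      + ennreal (\<delta> / m) * emeasure lborel K"
    using wq K(2) by (simp add: nn_integral_add nn_integral_cmult nn_integral_cmult_indicator)
  also have "\<dots> \<le> ennreal (1 / \<delta>) * ennreal E + ennreal (\<delta> / m) * ennreal (measure lborel K)"
    using E(1) K(3) by (intro add_mono mult_left_mono) (auto simp: emeasure_eq_ennreal_measure)
  also have "\<dots> = ennreal (E / \<delta> + \<delta> / m * measure lborel K)"
    using \<delta> m(1) E(2) by (subst ennreal_plus) (auto simp: ennreal_mult'[symmetric])
  finally show ?thesis .
qed

section \<open>Essential self-adjointness and the Liouville property\<close>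

text \<open>Cauchy-Schwarz for the metric bounds the directional derivative by the energy density, so a
  vanishing energy limit forces vanishing increments of \<open>f\<close> on the coordinate box.\<close>

lemma energy_limit_imp_locally_constant:
  assumes u: "\<And>n. u n \<in> laplace_dom" and f: "f \<in> l2_space \<mu>"
    and conv: "(\<lambda>n. l2_norm \<mu> (\<lambda>p. u n p - f p)) \<longlonglongrightarrow> 0"
    and energy: "(\<lambda>n. \<integral>p. carre (u n) (u n) p \<partial>\<mu>) \<longlonglongrightarrow> 0"
  shows "\<exists>N k. open N \<and> p \<in> N \<and> (AE q in \<mu>. q \<in> N \<longrightarrow> f q = k)"
proof -
  obtain c where c: "c \<in> \<A>" "p \<in> chart_dom c" using chart_cover by blast
  obtain a b K where ab: "chart_map c p \<in> box a b" "\<And>i. a $ i < b $ i" "compact K"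
    "K \<subseteq> chart_map c ` (UNIV \<inter> chart_dom c)" "chart_img c \<inter> cbox a b = K" "convex K"
    using coord_box[OF c(1) open_UNIV UNIV_I c(2)] by blast
  let ?V = "chart_img c"
  have KV: "K \<subseteq> ?V" using ab(5) by blast
  have Kb[measurable]: "K \<in> sets borel" using borel_compact[OF ab(3)] .
  have Kfin: "emeasure lborel K < \<infinity>" using emeasure_compact_finite[OF ab(3)] by simp
  have "chart_map c p \<in> ?V \<inter> cbox a b" using ab(1) box_subset_cbox[of a b] chart_map_in[OF c] by blast
  then have K0: "K \<noteq> {}" unfolding ab(5) by blast
  have us: "smooth_fun \<A> (u n)" "compact (supp (u n))" for n using u by (auto simp: laplace_dom_def)
  have fm[measurable]: "f \<in> borel_measurable borel" using l2_measurable[OF f] by simp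
  have um[measurable]: "u n \<in> borel_measurable borel" for n
    by (rule borel_measurable_continuous_onI[OF smooth_fun_continuous[OF us(1)]])
  have uL: "u n \<in> l2_space \<mu>" for n
    by (rule l2_continuous_compact[OF smooth_fun_continuous[OF us(1)] us(2)]) (rule supp_eq_0)
  note [measurable] = chart_ext_measurable[OF c(1)]
  \<comment> \<open>The minimum of the density over the compact \<open>K\<close> is the positive
    lower bound \<open>m\<close> with which the weight can be removed.\<close>
  obtain x0 where x0: "x0 \<in> K" "\<And>x. x \<in> K \<Longrightarrow> vol_density g c x0 \<le> vol_density g c x"
    using continuous_attains_inf[OF ab(3) K0 continuous_on_subset[OF vol_cont[OF c(1)] KV]] by blast
  define m where "m = vol_density g c x0"
  have m: "0 < m" "\<And>x. x \<in> K \<Longrightarrow> m \<le> vol_density g c x"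
    using vol_pos[OF c(1)] x0 KV by (auto simp: m_def)
  \<comment> \<open>Composing with \<open>chart_ext\<close> keeps \<open>F\<close> Borel on the
    whole space; on \<open>K\<close> it is \<open>f\<close> in coordinates.\<close>
  define F where "F x = f (chart_ext c x)" for x
  define U where "U n = u n \<circ> chart_inv c" for n
  have Fm[measurable]: "F \<in> borel_measurable borel" unfolding F_def[abs_def] by measurable
  have ext: "chart_ext c x = chart_inv c x" if "x \<in> ?V" for x using that by (simp add: chart_ext_def[OF c(1)])
  define E1 where "E1 n = (l2_norm \<mu> (\<lambda>p. u n p - f p))\<^sup>2" for n
  define E2 where "E2 n = (\<integral>p. carre (u n) (u n) p \<partial>\<mu>)" for n
  have chart_bound: "(\<integral>\<^sup>+x. indicator K x * ennreal (chart_weight c x * \<phi> (chart_inv c x)) \<partial>lborel) \<le> (\<integral>\<^sup>+q. ennreal (\<phi> q) \<partial>\<mu>)"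
    if [measurable]: "\<phi> \<in> borel_measurable borel" and nn: "\<And>q. 0 \<le> \<phi> q" for \<phi>
  proof -
    have "(\<integral>\<^sup>+x. indicator K x * ennreal (chart_weight c x * \<phi> (chart_inv c x)) \<partial>lborel)
        \<le> (\<integral>\<^sup>+x. ennreal (chart_weight c x) * ennreal (\<phi> (chart_inv c x)) \<partial>lborel)"
      by (rule nn_integral_mono) (auto simp: indicator_def ennreal_mult chart_weight_nonneg[OF c(1)] nn)
    also have "\<dots> = (\<integral>\<^sup>+q. indicator (chart_dom c) q * ennreal (\<phi> q) \<partial>\<mu>)"
      by (rule chart_nn_integral[OF c(1), symmetric]) measurable
    also have "\<dots> \<le> (\<integral>\<^sup>+q. ennreal (\<phi> q) \<partial>\<mu>)"
      by (rule nn_integral_mono) (auto simp: indicator_def)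
    finally show ?thesis .
  qed
  have bound1: "(\<integral>\<^sup>+x. indicator K x * ennreal \<bar>F x - U n x\<bar> \<partial>lborel) \<le> ennreal (E1 n / \<delta> + \<delta> / m * measure lborel K)"
    if \<delta>: "0 < \<delta>" for n \<delta>
  proof (rule weighted_bound[OF c(1) KV Kb Kfin m \<delta>])
    have "(\<lambda>x. indicator K x * (F x - u n (chart_ext c x))) \<in> borel_measurable borel" by measurable
    moreover have "indicator K x * (F x - u n (chart_ext c x)) = indicator K x * (F x - U n x)" for x
      using KV ext by (auto simp: indicator_def U_def)
    ultimately show "(\<lambda>x. indicator K x * (F x - U n x)) \<in> borel_measurable borel" by simp
    have "(\<integral>\<^sup>+x. indicator K x * ennreal (chart_weight c x * (F x - U n x)\<^sup>2) \<partial>lborel)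
        = (\<integral>\<^sup>+x. indicator K x * ennreal (chart_weight c x * (u n (chart_inv c x) - f (chart_inv c x))\<^sup>2) \<partial>lborel)"
      by (rule nn_integral_cong) (use KV ext in \<open>auto simp: indicator_def U_def F_def power2_commute\<close>)
    also have "\<dots> \<le> (\<integral>\<^sup>+q. ennreal ((u n q - f q)\<^sup>2) \<partial>\<mu>)"
      by (rule chart_bound[of "\<lambda>q. (u n q - f q)\<^sup>2"]) auto
    also have "\<dots> = ennreal (E1 n)" unfolding E1_def by (rule l2_nn_integral[OF l2_diff[OF uL f]])
    finally show "(\<integral>\<^sup>+x. indicator K x * ennreal (chart_weight c x * (F x - U n x)\<^sup>2) \<partial>lborel) \<le> ennreal (E1 n)" .
    show "0 \<le> E1 n" by (simp add: E1_def)
  qed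
  have carre_int: "integrable \<mu> (carre (u n) (u n))" for n
    by (rule integrable_continuous_compact[OF carre_cont[OF us(1) us(1)] us(2)])
       (rule carre_supp[OF us(1) us(1)])
  have E2nn: "0 \<le> E2 n" for n unfolding E2_def by (intro Bochner_Integration.integral_nonneg carre_nonneg us)
  have zero: "(\<integral>\<^sup>+x. indicator K x * indicator K (x + h) * ennreal \<bar>F (x + h) - F x\<bar> \<partial>lborel) = 0" (is "?Z = 0") for h
  proof -
    have "continuous_on K (\<lambda>x. h \<bullet> (g c x *v h))"
      unfolding matrix_vector_mult_def inner_vec_def inner_real_def
      by (simp, intro continuous_intros continuous_on_subset[OF smooth_on_continuous_on[OF metric_entry_smooth[OF c(1)]] KV])
    then have "bounded ((\<lambda>x. h \<bullet> (g c x *v h)) ` K)"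
      using compact_continuous_image ab(3) compact_imp_bounded by blast
    then obtain C' where C': "\<And>x. x \<in> K \<Longrightarrow> \<bar>h \<bullet> (g c x *v h)\<bar> \<le> C'" by (auto simp: bounded_iff)
    \<comment> \<open>A bound for the squared length of the fixed vector \<open>h\<close> in the
      metric over \<open>K\<close>, made nonnegative so that it can multiply the energy.\<close>
    define C where "C = \<bar>C'\<bar>"
    have C: "C \<ge> 0" "\<And>x. x \<in> K \<Longrightarrow> h \<bullet> (g c x *v h) \<le> C" using C' by (fastforce simp: C_def)+
    have bound2: "(\<integral>\<^sup>+x. indicator K x * ennreal \<bar>dgrad c (u n) x \<bullet> h\<bar> \<partial>lborel)
        \<le> ennreal (C * E2 n / \<delta> + \<delta> / m * measure lborel K)" if \<delta>: "0 < \<delta>" for n \<delta>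
    proof (rule weighted_bound[OF c(1) KV Kb Kfin m \<delta>])
      have "continuous_on ?V (\<lambda>x. dgrad c (u n) x \<bullet> h)"
        unfolding inner_vec_def inner_real_def
        by (intro continuous_intros smooth_on_continuous_on dgrad_smooth c us)
      from borel_measurable_continuous_on_indicator[OF Kb continuous_on_subset[OF this KV]]
      show "(\<lambda>x. indicator K x * (dgrad c (u n) x \<bullet> h)) \<in> borel_measurable borel" by simp
      have cm[measurable]: "carre (u n) (u n) \<in> borel_measurable borel"
        by (rule borel_measurable_continuous_onI[OF carre_cont[OF us(1) us(1)]])
      have "(\<integral>\<^sup>+x. indicator K x * ennreal (chart_weight c x * (dgrad c (u n) x \<bullet> h)\<^sup>2) \<partial>lborel)
          \<le> (\<integral>\<^sup>+x. indicator K x * ennreal (chart_weight c x * (C * carre (u n) (u n) (chart_inv c x))) \<partial>lborel)"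
      proof (rule nn_integral_mono)
        fix x
        show "indicator K x * ennreal (chart_weight c x * (dgrad c (u n) x \<bullet> h)\<^sup>2)
            \<le> indicator K x * ennreal (chart_weight c x * (C * carre (u n) (u n) (chart_inv c x)))"
        proof (cases "x \<in> K")
          case True
          then have x: "x \<in> ?V" using KV by blast
          have "(dgrad c (u n) x \<bullet> h)\<^sup>2 \<le> gam c (u n) (u n) x * (h \<bullet> (g c x *v h))"
            by (rule dgrad_le_gam[OF c(1) x])
          also have "\<dots> \<le> gam c (u n) (u n) x * C"
            using C(2)[OF True] gam_nonneg[OF c(1) x] by (rule mult_left_mono)
          also have "gam c (u n) (u n) x = carre (u n) (u n) (chart_inv c x)"
            using carre_eq[OF c(1) _ us(1) us(1), of "chart_inv c x"] x c(1) by simp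
          finally show ?thesis
            using chart_weight_nonneg[OF c(1)] by (auto intro!: ennreal_leI mult_left_mono simp: mult.commute indicator_def)
        qed simp
      qed
      also have "\<dots> \<le> (\<integral>\<^sup>+q. ennreal (C * carre (u n) (u n) q) \<partial>\<mu>)"
        by (rule chart_bound[of "\<lambda>q. C * carre (u n) (u n) q"]) (use C(1) carre_nonneg[OF us(1)] in auto)
      also have "\<dots> = ennreal (C * E2 n)"
        unfolding E2_def using C(1) carre_nonneg[OF us(1)] carre_int
        by (subst nn_integral_eq_integral) auto
      finally show "(\<integral>\<^sup>+x. indicator K x * ennreal (chart_weight c x * (dgrad c (u n) x \<bullet> h)\<^sup>2) \<partial>lborel) \<le> ennreal (C * E2 n)" .
      show "0 \<le> C * E2 n" using C(1) E2nn by simp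
    qed
    have inc: "(\<integral>\<^sup>+x. indicator K x * indicator K (x + h) * ennreal \<bar>U n (x + h) - U n x\<bar> \<partial>lborel)
        \<le> (\<integral>\<^sup>+x. indicator K x * ennreal \<bar>dgrad c (u n) x \<bullet> h\<bar> \<partial>lborel)" for n
    proof (rule nn_integral_increment_le[OF ab(3,6) KV, where U' = "\<lambda>x h. dgrad c (u n) x \<bullet> h"])
      show "(U n has_derivative (\<lambda>h. dgrad c (u n) x \<bullet> h)) (at x within ?V)" if x: "x \<in> ?V" for x
        unfolding U_def dgrad_inner[OF c(1) x us(1), symmetric]
        by (rule smooth_on_has_derivative[OF smooth_funD[OF us(1) c(1)] x])
      show "continuous_on ?V (\<lambda>x. dgrad c (u n) x \<bullet> h)"
        unfolding inner_vec_def inner_real_def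
        by (intro continuous_intros smooth_on_continuous_on dgrad_smooth c us)
    qed
    define B where "B = measure lborel K / m"
    have Bnn: "0 \<le> B" using m(1) by (simp add: B_def)
    \<comment> \<open>The increment of \<open>F\<close> is compared with that of \<open>U n\<close>:
      two approximation errors, at \<open>x\<close> and at \<open>x + h\<close>, have equal
      integrals by translation invariance, and the increment of \<open>U n\<close> is controlled by
      the energy. Each of the three terms contributes one \<open>\<delta> * B\<close>.\<close>
    have est: "?Z \<le> ennreal (2 * E1 n / \<delta> + C * E2 n / \<delta> + 3 * \<delta> * B)" if \<delta>: "0 < \<delta>" for n \<delta>
    proof -
      define Q where "Q x = indicator K x * ennreal \<bar>F x - u n (chart_ext c x)\<bar>" for x
      have Qm[measurable]: "Q \<in> borel_measurable borel" unfolding Q_def[abs_def] by measurable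
      have Qeq: "Q x = indicator K x * ennreal \<bar>F x - U n x\<bar>" for x
        using KV ext by (auto simp: Q_def indicator_def U_def)
      define R where "R x = indicator K x * indicator K (x + h) * ennreal \<bar>U n (x + h) - U n x\<bar>" for x
      have Rm[measurable]: "R \<in> borel_measurable borel"
      proof -
        have "(\<lambda>x. indicator K x * indicator K (x + h) * ennreal \<bar>u n (chart_ext c (x + h)) - u n (chart_ext c x)\<bar>) \<in> borel_measurable borel"
          by measurable
        moreover have "indicator K x * indicator K (x + h) * ennreal \<bar>u n (chart_ext c (x + h)) - u n (chart_ext c x)\<bar> = R x" for x
          by (auto simp: R_def indicator_def U_def ext[OF subsetD[OF KV]])
        ultimately show ?thesis by simp
      qed
      have "?Z \<le> (\<integral>\<^sup>+x. Q (x + h) + (Q x + R x) \<partial>lborel)"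
      proof (rule nn_integral_mono)
        fix x
        have "ennreal \<bar>F (x + h) - F x\<bar> \<le> ennreal (\<bar>F (x + h) - U n (x + h)\<bar> + (\<bar>F x - U n x\<bar> + \<bar>U n (x + h) - U n x\<bar>))"
          by (rule ennreal_leI) linarith
        also have "\<dots> = ennreal \<bar>F (x + h) - U n (x + h)\<bar> + (ennreal \<bar>F x - U n x\<bar> + ennreal \<bar>U n (x + h) - U n x\<bar>)"
          by (simp add: ennreal_plus)
        finally show "indicator K x * indicator K (x + h) * ennreal \<bar>F (x + h) - F x\<bar> \<le> Q (x + h) + (Q x + R x)"
          by (auto simp: Qeq R_def indicator_def)
      qed
      also have "\<dots> = (\<integral>\<^sup>+x. Q (x + h) \<partial>lborel) + ((\<integral>\<^sup>+x. Q x \<partial>lborel) + (\<integral>\<^sup>+x. R x \<partial>lborel))"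
        by (simp add: nn_integral_add)
      also have "(\<integral>\<^sup>+x. Q (x + h) \<partial>lborel) = (\<integral>\<^sup>+x. Q x \<partial>lborel)"
        by (rule nn_integral_lborel_translate[OF Qm])
      also have "(\<integral>\<^sup>+x. Q x \<partial>lborel) + ((\<integral>\<^sup>+x. Q x \<partial>lborel) + (\<integral>\<^sup>+x. R x \<partial>lborel)) \<le>
          ennreal (E1 n / \<delta> + \<delta> * B) + (ennreal (E1 n / \<delta> + \<delta> * B) + ennreal (C * E2 n / \<delta> + \<delta> * B))"
        using bound1[OF \<delta>, of n] order_trans[OF inc[of n] bound2[OF \<delta>, of n]]
        by (intro add_mono) (simp_all add: Qeq R_def B_def)
      also have "\<dots> = ennreal (2 * E1 n / \<delta> + C * E2 n / \<delta> + 3 * \<delta> * B)"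
      proof -
        have 1: "0 \<le> E1 n / \<delta> + \<delta> * B" using \<delta> Bnn by (simp add: E1_def)
        have 2: "0 \<le> C * E2 n / \<delta> + \<delta> * B" using \<delta> Bnn C(1) E2nn by simp
        show ?thesis
          unfolding ennreal_plus[OF 1 2, symmetric] ennreal_plus[OF 1 add_nonneg_nonneg[OF 1 2], symmetric]
          by (rule arg_cong[where f = ennreal]) (use \<delta> in \<open>simp add: field_simps\<close>)
      qed
      finally show ?thesis .
    qed
    \<comment> \<open>Here \<open>n\<close> tends to infinity with \<open>\<delta>\<close> fixed;
      afterwards \<open>\<delta>\<close> runs through \<open>1 / Suc j\<close>.\<close>
    have lim: "?Z \<le> ennreal (3 * \<delta> * B)" if \<delta>: "0 < \<delta>" for \<delta>
    proof (rule LIMSEQ_le_const)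
      have "(\<lambda>n. 2 * E1 n / \<delta> + C * E2 n / \<delta> + 3 * \<delta> * B) \<longlonglongrightarrow> 2 * 0\<^sup>2 / \<delta> + C * 0 / \<delta> + 3 * \<delta> * B"
        unfolding E1_def E2_def by (intro tendsto_intros conv energy) (use \<delta> in auto)
      then show "(\<lambda>n. ennreal (2 * E1 n / \<delta> + C * E2 n / \<delta> + 3 * \<delta> * B)) \<longlonglongrightarrow> ennreal (3 * \<delta> * B)"
        by (intro tendsto_ennrealI) simp
      show "\<exists>N. \<forall>n\<ge>N. ?Z \<le> ennreal (2 * E1 n / \<delta> + C * E2 n / \<delta> + 3 * \<delta> * B)"
        using est[OF \<delta>] by blast
    qed
    have "?Z \<le> ennreal 0"
    proof (rule LIMSEQ_le_const)
      have "(\<lambda>j. 3 * inverse (real (Suc j)) * B) \<longlonglongrightarrow> 3 * 0 * B"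
        by (intro tendsto_intros LIMSEQ_inverse_real_of_nat)
      then show "(\<lambda>j. ennreal (3 * inverse (real (Suc j)) * B)) \<longlonglongrightarrow> ennreal 0"
        by (intro tendsto_ennrealI) simp
      show "\<exists>N. \<forall>j\<ge>N. ?Z \<le> ennreal (3 * inverse (real (Suc j)) * B)"
        using lim by (intro exI[of _ 0] allI impI) simp
    qed
    then show ?thesis by simp
  qed
  obtain k where k: "AE x in lborel. x \<in> K \<longrightarrow> F x = k"
    using AE_constant_if_increments_0[OF Fm Kb zero] by blast
  define N where "N = {q \<in> chart_dom c. chart_map c q \<in> ?V \<inter> box a b}"
  have "open N" unfolding N_def
    by (rule chart_preimage_open[OF c(1)]) (rule openin_open_Int, rule open_box)
  moreover have "p \<in> N" using ab(1) c by (simp add: N_def)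
  moreover have "AE q in \<mu>. q \<in> N \<longrightarrow> f q = k"
  proof (rule chart_AE[OF c(1) _ Kb])
    show "{q. f q = k} \<in> sets borel" using borel_measurable_eq[of f borel "\<lambda>_. k"] by simp
    show "AE x in lborel. x \<in> K \<longrightarrow> f (chart_inv c x) = k"
      using k by eventually_elim (use KV ext in \<open>auto simp: F_def\<close>)
    show "N \<subseteq> {q \<in> chart_dom c. chart_map c q \<in> K}"
      using ab(5) box_subset_cbox[of a b] by (auto simp: N_def)
  qed
  ultimately show ?thesis by blast
qed

section \<open>Density of the domain\<close>

text \<open>Interior coordinates in one chart exclude boundary points of all charts, by
  \<open>interior_chart_change\<close>. The function thus vanishes near every boundary point and
  satisfies the Neumann condition trivially.\<close>

lemma lift_in_laplace_dom:
  assumes c: "c \<in> \<A>" and \<phi>: "Cinf UNIV \<phi>" and K: "compact K" "K \<subseteq> interior (chart_img c)"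
    and \<phi>0: "\<And>x. x \<notin> K \<Longrightarrow> \<phi> x = 0"
  shows "lift c \<phi> \<in> laplace_dom"
proof -
  have KV: "K \<subseteq> chart_img c" using K(2) interior_subset by blast
  have s: "smooth_on (chart_img c) \<phi>" by (rule Cinf_imp_smooth_on[OF open_UNIV \<phi>]) simp
  note L = c s K(1) KV
  have sm: "smooth_fun \<A> (lift c \<phi>)" by (rule smooth_lift[OF L]) (use \<phi>0 in auto)
  have cs: "compact (supp (lift c \<phi>))" by (rule compact_supp_lift[OF L]) (use \<phi>0 in auto)
  have sub: "supp (lift c \<phi>) \<subseteq> chart_inv c ` K" by (rule supp_lift[OF L]) (use \<phi>0 in auto)
  have "neumann \<A> g (lift c \<phi>)"
    unfolding neumann_def
  proof (intro ballI allI impI)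
    fix c' i x \<nu>
    assume c': "c' \<in> \<A>" and h: "openin (top_of_set (half_space i)) (chart_img c')" and x: "x \<in> chart_img c'"
      and n: "x $ i = 0 \<and> outward_unit_normal g c' i x \<nu>"
    have "chart_inv c' x \<notin> supp (lift c \<phi>)"
    proof
      assume "chart_inv c' x \<in> supp (lift c \<phi>)"
      then obtain y where y: "y \<in> K" "chart_inv c' x = chart_inv c y" using sub by blast
      then have "y \<in> chart_img c" using KV by blast
      then have "chart_inv c' x \<in> chart_dom c" "chart_map c (chart_inv c' x) \<in> interior (chart_img c)"
        using y K(2) c by auto
      from interior_chart_change[OF c c' this(1) _ this(2) h] show False using n x c' by simp
    qed
    then have "dgrad c' (lift c \<phi>) (chart_map c' (chart_inv c' x)) = 0"
      by (intro dgrad_locally_0[OF c' open_Compl[OF closed_supp]]) (use supp_eq_0 x c' in auto)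
    then show "frechet_derivative (lift c \<phi> \<circ> chart_inv c') (at x within chart_img c') \<nu> = 0"
      using dgrad_inner[OF c' x sm] x c' by simp
  qed
  then show ?thesis using sm cs by (simp add: laplace_dom_def)
qed

text \<open>In coordinates, \<open>f\<close> times the density is orthogonal to all bumps on boxes
  inside the interior of \<open>K\<close>, hence has zero integral over these boxes and vanishes
  almost everywhere there. Boxes meeting the boundary need not be tested, since the frontier of the
  convex set \<open>K\<close> is null.\<close>

lemma laplace_dom_dense:
  assumes f: "f \<in> l2_space \<mu>" and orth: "\<And>u. u \<in> laplace_dom \<Longrightarrow> l2_inner \<mu> u f = 0"
  shows "AE q in \<mu>. f q = 0"
proof (rule AE_local)
  fix p
  obtain c where c: "c \<in> \<A>" "p \<in> chart_dom c" using chart_cover by blast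
  obtain a b K where ab: "chart_map c p \<in> box a b" "\<And>i. a $ i < b $ i" "compact K"
    "K \<subseteq> chart_map c ` (UNIV \<inter> chart_dom c)" "chart_img c \<inter> cbox a b = K" "convex K"
    using coord_box[OF c(1) open_UNIV UNIV_I c(2)] by blast
  let ?V = "chart_img c"
  have KV: "K \<subseteq> ?V" using ab(5) by blast
  have Kb[measurable]: "K \<in> sets borel" using borel_compact[OF ab(3)] .
  have fm[measurable]: "f \<in> borel_measurable borel" using l2_measurable[OF f] by simp
  note [measurable] = chart_weight_measurable[OF c(1)] chart_ext_measurable[OF c(1)]
  define F where "F x = indicator K x * (chart_weight c x * f (chart_inv c x))" for x
  define K' where "K' = chart_inv c ` K"
  have K': "compact K'" unfolding K'_def
    by (rule compact_continuous_image[OF continuous_on_subset[OF chart_inv_cont[OF c(1)] KV] ab(3)])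
  have K'b[measurable]: "K' \<in> sets borel" using K' compact_imp_closed borel_closed by blast
  have K'D: "K' \<subseteq> chart_dom c" using KV c(1) by (auto simp: K'_def)
  have inK': "chart_inv c x \<in> K' \<longleftrightarrow> x \<in> K" if "x \<in> ?V" for x
  proof
    assume "chart_inv c x \<in> K'"
    then obtain y where y: "y \<in> K" "chart_inv c x = chart_inv c y" by (auto simp: K'_def)
    then have "chart_map c (chart_inv c x) = chart_map c (chart_inv c y)" by simp
    then show "x \<in> K" using that y(1) KV c(1) by (simp add: subset_iff)
  qed (simp add: K'_def)
  \<comment> \<open>The function \<open>f\<close> is only square integrable; its product with the
    indicator of the compact \<open>K'\<close>, which is square integrable as well, is
    integrable.\<close>
  have Fint: "integrable lborel F"
  proof -
    have "integrable \<mu> (indicator K' :: 'a \<Rightarrow> real)"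
      by (rule integrable_real_indicator) (use compact_finite_measure[OF K'] in auto)
    moreover have "(\<lambda>q. (indicator K' q :: real)\<^sup>2) = indicator K'" by (auto simp: indicator_def)
    ultimately have "indicator K' \<in> l2_space \<mu>" by (simp add: l2_space_def)
    then have "integrable \<mu> (\<lambda>q. indicator K' q * f q)" by (rule l2_integrable_mult[OF _ f])
    then have "integrable lborel (\<lambda>x. chart_weight c x * (indicator K' (chart_inv c x) * f (chart_inv c x)))"
      by (subst (asm) chart_integral(1)[OF c(1)]) (use K'D in \<open>auto simp: indicator_def\<close>)
    moreover have "chart_weight c x * (indicator K' (chart_inv c x) * f (chart_inv c x)) = F x" for x
      using inK'[of x] KV by (auto simp: F_def chart_weight_def[OF c(1)] indicator_def)
    ultimately show ?thesis by simp
  qed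
  then have Fm[measurable]: "F \<in> borel_measurable borel" by (simp add: borel_measurable_integrable)
  have "AE x in lborel. x \<in> interior K \<longrightarrow> F x = 0"
  proof (rule AE_eq_0_if_box_integrals_0[OF Fint open_interior])
    fix a' b' :: "real ^ 'n"
    assume lt: "\<And>i. i \<in> Basis \<Longrightarrow> a' \<bullet> i < b' \<bullet> i" and sub: "cbox a' b' \<subseteq> interior K"
    have lt': "a' $ i < b' $ i" for i using lt[of "axis i 1"] by (simp add: inner_axis)
    define \<phi> where "\<phi> j = box_bump a' b' (real (Suc j))" for j
    have \<phi>0: "\<phi> j x = 0" if "x \<notin> cbox a' b'" for j x
      unfolding \<phi>_def by (rule box_bump_eq_0) (use that lt' box_subset_cbox[of a' b'] in auto)
    have dom: "lift c (\<phi> j) \<in> laplace_dom" for j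
    proof (rule lift_in_laplace_dom[OF c(1) _ compact_cbox])
      show "Cinf UNIV (\<phi> j)" unfolding \<phi>_def by (rule Cinf_box_bump)
      show "cbox a' b' \<subseteq> interior ?V" using sub interior_mono[OF KV] by blast
    qed (rule \<phi>0)
    have \<phi>m[measurable]: "\<phi> j \<in> borel_measurable borel" for j
      unfolding \<phi>_def by (rule borel_measurable_continuous_onI[OF Cinf_continuous_on[OF Cinf_box_bump]])
    have int0: "(\<integral>x. \<phi> j x * F x \<partial>lborel) = 0" for j
    proof -
      have lm: "lift c (\<phi> j) \<in> borel_measurable borel"
        unfolding \<phi>_def
        by (rule lift_measurable[OF c(1) continuous_on_subset[OF Cinf_continuous_on[OF Cinf_box_bump]]]) simp
      have "0 = (\<integral>q. lift c (\<phi> j) q * f q \<partial>\<mu>)" using orth[OF dom[of j]] by (simp add: l2_inner_def)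
      also have "\<dots> = (\<integral>x. chart_weight c x * (lift c (\<phi> j) (chart_inv c x) * f (chart_inv c x)) \<partial>lborel)"
        by (rule chart_integral(2)[OF c(1) borel_measurable_times[OF lm fm]]) (simp add: lift_def)
      also have "\<dots> = (\<integral>x. \<phi> j x * F x \<partial>lborel)"
      proof (rule Bochner_Integration.integral_cong[OF refl])
        fix x
        show "chart_weight c x * (lift c (\<phi> j) (chart_inv c x) * f (chart_inv c x)) = \<phi> j x * F x"
        proof (cases "x \<in> ?V")
          case True
          have "\<phi> j x = 0" if "x \<notin> K" using \<phi>0 sub interior_subset that by blast
          then show ?thesis using True c(1) by (cases "x \<in> K") (auto simp: lift_def F_def)
        qed (simp add: chart_weight_def[OF c(1)] F_def)
      qed
      finally show ?thesis by simp
    qed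
    have "(\<lambda>j. \<integral>x. \<phi> j x * F x \<partial>lborel) \<longlonglongrightarrow> (\<integral>x. indicator (box a' b') x * F x \<partial>lborel)"
    proof (rule integral_dominated_convergence[where w = "\<lambda>x. \<bar>F x\<bar>"])
      show "integrable lborel (\<lambda>x. \<bar>F x\<bar>)" using Fint by simp
      show "AE x in lborel. (\<lambda>j. \<phi> j x * F x) \<longlonglongrightarrow> indicator (box a' b') x * F x"
        unfolding \<phi>_def by (intro AE_I2 tendsto_intros box_bump_tendsto lt')
      show "AE x in lborel. norm (\<phi> j x * F x) \<le> \<bar>F x\<bar>" for j
      proof (rule AE_I2)
        fix x
        have "\<bar>\<phi> j x\<bar> \<le> 1"
          using box_bump_nonneg[of a' b' "real (Suc j)" x] box_bump_le_1[of a' b' "real (Suc j)" x]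
          by (simp add: \<phi>_def del: of_nat_Suc)
        then show "norm (\<phi> j x * F x) \<le> \<bar>F x\<bar>" by (simp add: abs_mult mult_left_le_one_le)
      qed
    qed auto
    then show "(\<integral>x. indicator (box a' b') x * F x \<partial>lborel) = 0" by (simp add: int0 LIMSEQ_const_iff)
  qed
  moreover have "AE x in lborel. x \<notin> frontier K"
  proof (rule AE_not_in)
    have "negligible (frontier K)" by (rule negligible_convex_frontier[OF ab(6)])
    then show "frontier K \<in> null_sets lborel"
      by (simp add: negligible_iff_null_sets null_sets_completion_iff borel_closed frontier_closed)
  qed
  ultimately have ae: "AE x in lborel. x \<in> K \<longrightarrow> f (chart_inv c x) = 0"
  proof eventually_elim
    fix x assume x: "x \<in> interior K \<longrightarrow> F x = 0" "x \<notin> frontier K"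
    show "x \<in> K \<longrightarrow> f (chart_inv c x) = 0"
    proof
      assume xK: "x \<in> K"
      then have "x \<in> interior K" using x(2) closure_subset by (auto simp: frontier_def)
      then have "chart_weight c x * f (chart_inv c x) = 0" using x(1) xK by (simp add: F_def)
      moreover have "chart_weight c x > 0" using xK KV vol_pos[OF c(1)] by (auto simp: chart_weight_def[OF c(1)])
      ultimately show "f (chart_inv c x) = 0" by simp
    qed
  qed
  define N where "N = {q \<in> chart_dom c. chart_map c q \<in> ?V \<inter> box a b}"
  have "open N" unfolding N_def
    by (rule chart_preimage_open[OF c(1)]) (rule openin_open_Int, rule open_box)
  moreover have "p \<in> N" using ab(1) c by (simp add: N_def)
  moreover have "AE q in \<mu>. q \<in> N \<longrightarrow> f q = 0"
  proof (rule chart_AE[OF c(1) _ Kb ae])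
    show "{q. f q = 0} \<in> sets borel" using borel_measurable_eq[of f borel "\<lambda>_. 0"] by simp
    show "N \<subseteq> {q \<in> chart_dom c. chart_map c q \<in> K}"
      using ab(5) box_subset_cbox[of a b] by (auto simp: N_def)
  qed
  ultimately show "\<exists>N. open N \<and> p \<in> N \<and> (AE q in \<mu>. q \<in> N \<longrightarrow> f q = 0)" by blast
qed

lemma essentially_self_adjoint_imp_liouville:
  assumes conn: "connected (UNIV :: 'a set)" and esa: "essentially_self_adjoint \<mu> (laplace_op \<A> g)"
  shows "l2_liouville \<mu> (laplace_op \<A> g)"
  unfolding l2_liouville_def
proof (intro allI impI)
  fix f assume "(f, \<lambda>_. 0) \<in> l2_adjoint \<mu> (laplace_op \<A> g)"
  then have "(f, \<lambda>_. 0) \<in> l2_adjoint \<mu> (l2_closure \<mu> (laplace_op \<A> g))"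
    by (rule l2_adjoint_closure[OF laplace_op_l2])
  then have "(f, \<lambda>_. 0) \<in> l2_closure \<mu> (laplace_op \<A> g)"
    using esa by (simp add: essentially_self_adjoint_def self_adjoint_def)
  then obtain u v where f: "f \<in> l2_space \<mu>" and uv: "\<And>n. (u n, v n) \<in> laplace_op \<A> g"
      and lim: "(\<lambda>n. l2_norm \<mu> (\<lambda>x. u n x - f x)) \<longlonglongrightarrow> 0" "(\<lambda>n. l2_norm \<mu> (v n)) \<longlonglongrightarrow> 0"
    by (auto simp: l2_closure_def)
  have L: "u n \<in> l2_space \<mu>" "v n \<in> l2_space \<mu>" for n using uv[of n] laplace_op_l2 by auto
  \<comment> \<open>The energy is the inner product of \<open>u n\<close> with its image; the norms
    of \<open>u n\<close> stay bounded by convergence while those of \<open>v n\<close> tend to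
    zero.\<close>
  have "(\<lambda>n. \<integral>p. carre (u n) (u n) p \<partial>\<mu>) \<longlonglongrightarrow> 0"
  proof (rule Lim_null_comparison)
    have "(\<lambda>n. (l2_norm \<mu> (\<lambda>x. u n x - f x) + l2_norm \<mu> f) * l2_norm \<mu> (v n)) \<longlonglongrightarrow> (0 + l2_norm \<mu> f) * 0"
      by (intro tendsto_intros lim)
    then show "(\<lambda>n. (l2_norm \<mu> (\<lambda>x. u n x - f x) + l2_norm \<mu> f) * l2_norm \<mu> (v n)) \<longlonglongrightarrow> 0" by simp
    have "norm (\<integral>p. carre (u n) (u n) p \<partial>\<mu>) \<le> (l2_norm \<mu> (\<lambda>x. u n x - f x) + l2_norm \<mu> f) * l2_norm \<mu> (v n)" for n
    proof -
      have "norm (\<integral>p. carre (u n) (u n) p \<partial>\<mu>) = \<bar>l2_inner \<mu> (u n) (v n)\<bar>"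
        using laplace_op_energy[OF uv uv] by simp
      also have "\<dots> \<le> l2_norm \<mu> (u n) * l2_norm \<mu> (v n)" by (rule l2_Cauchy_Schwarz[OF L])
      also have "\<dots> \<le> (l2_norm \<mu> (\<lambda>x. u n x - f x) + l2_norm \<mu> f) * l2_norm \<mu> (v n)"
        using l2_norm_triangle[OF l2_diff[OF L(1)[of n] f] f] l2_norm_nonneg by (intro mult_right_mono) simp_all
      finally show ?thesis .
    qed
    then show "\<forall>\<^sub>F n in sequentially. norm (\<integral>p. carre (u n) (u n) p \<partial>\<mu>)
        \<le> (l2_norm \<mu> (\<lambda>x. u n x - f x) + l2_norm \<mu> f) * l2_norm \<mu> (v n)" by simp
  qed
  moreover have "u n \<in> laplace_dom" for n using uv[of n] by (simp add: laplace_op_iff)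
  ultimately show "ae_constant \<mu> f"
    using locally_constant_imp_ae_constant[OF conn energy_limit_imp_locally_constant[OF _ f lim(1)]] by blast
qed

text \<open>With empty boundary every function in the domain is admissible as a test function in
  \<open>harmonic\<close>, so the distributional equation contains the adjoint relation with image
  zero.\<close>

lemma harmonic_imp_adjoint_kernel:
  assumes nb: "manifold_boundary \<A> = {}" and u: "u \<in> l2_space \<mu>" and harm: "harmonic \<A> g \<mu> u"
  shows "(u, \<lambda>_. 0) \<in> l2_adjoint \<mu> (laplace_op \<A> g)"
  using u harm nb by (auto simp: l2_adjoint_def l2_0 laplace_op_def harmonic_def l2_inner_def mult.commute)

lemma liouville_imp_essentially_self_adjoint:
  assumes li: "l2_liouville \<mu> (laplace_op \<A> g)" and pos: "strictly_positive \<mu> (laplace_op \<A> g)"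
    and inf: "emeasure \<mu> UNIV = \<infinity>"
  shows "essentially_self_adjoint \<mu> (laplace_op \<A> g)"
proof (rule essentially_self_adjointI[OF laplace_op_l2 laplace_op_nonempty laplace_op_linear laplace_op_symmetric pos])
  fix f assume adj: "(f, \<lambda>_. 0) \<in> l2_adjoint \<mu> (laplace_op \<A> g)"
  then obtain k where k: "AE x in \<mu>. f x = k" using li by (auto simp: l2_liouville_def ae_constant_def)
  have f: "f \<in> l2_space \<mu>" using adj by (simp add: l2_adjoint_def)
  \<comment> \<open>The square of the almost everywhere value \<open>k\<close> is integrable over a
    space of infinite measure, which leaves only \<open>k = 0\<close>.\<close>
  have "integrable \<mu> (\<lambda>x. (f x)\<^sup>2)" using f by (simp add: l2_space_def)
  then have "integrable \<mu> (\<lambda>_. k\<^sup>2)"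
    by (rule integrable_cong_AE_imp) (use k in \<open>auto elim!: eventually_mono\<close>)
  then have "ennreal (k\<^sup>2) * emeasure \<mu> UNIV < \<infinity>" by (simp add: integrable_iff_bounded)
  then have "k = 0" using inf by (auto simp: ennreal_mult_top split: if_splits)
  then show "AE x in \<mu>. f x = 0" using k by simp
next
  fix f assume f: "f \<in> l2_space \<mu>" and orth: "\<And>u v. (u, v) \<in> laplace_op \<A> g \<Longrightarrow> l2_inner \<mu> u f = 0"
  show "AE x in \<mu>. f x = 0"
    by (rule laplace_dom_dense[OF f]) (use orth in \<open>auto simp: laplace_op_iff\<close>)
qed

end

theorem corollary4:
  fixes \<A> :: "('a::{t2_space, second_countable_topology}, 'n::finite) chart set"
    and g :: "('a, 'n) metric"
    and \<mu> :: "'a measure"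
  assumes "riemannian_manifold \<A> g"
    and "connected (UNIV :: 'a set)"
    and "manifold_boundary \<A> \<noteq> {} \<Longrightarrow> orientable \<A>"
    and "riemannian_measure \<A> g \<mu>"
  shows "(essentially_self_adjoint \<mu> (laplace_op \<A> g) \<longrightarrow>
            l2_liouville \<mu> (laplace_op \<A> g) \<and>
            (manifold_boundary \<A> = {} \<longrightarrow>
               (\<forall>u\<in>l2_space \<mu>. harmonic \<A> g \<mu> u \<longrightarrow> ae_constant \<mu> u))) \<and>
         (l2_liouville \<mu> (laplace_op \<A> g) \<and> strictly_positive \<mu> (laplace_op \<A> g) \<and>
            emeasure \<mu> UNIV = \<infinity> \<longrightarrow>
            essentially_self_adjoint \<mu> (laplace_op \<A> g))"
proof -
  interpret riemannian \<A> g \<mu> using assms(1,4) by unfold_locales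
  show ?thesis
  proof (intro conjI impI ballI)
    assume esa: "essentially_self_adjoint \<mu> (laplace_op \<A> g)"
    show li: "l2_liouville \<mu> (laplace_op \<A> g)"
      by (rule essentially_self_adjoint_imp_liouville[OF assms(2) esa])
    fix u assume "manifold_boundary \<A> = {}" "u \<in> l2_space \<mu>" "harmonic \<A> g \<mu> u"
    then show "ae_constant \<mu> u"
      using li harmonic_imp_adjoint_kernel unfolding l2_liouville_def by blast
  qed (use liouville_imp_essentially_self_adjoint in blast)
qed

end
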